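(* Consider the linear bandit problem with changing arm set and the Sublinear Time Thompson Sampling algorithm described in the context. For any $T$ not scaling with $K$, one can choose $\eta(T)=\frac1{\sqrt T}$. Then, for any $\delta\in(0,1)$, with probability at least $1-\delta$ the regret is bounded by $R(T)=\widetilde O(d^{3/2}\sqrt T)$, and the per-step time complexity is $K^{1-\Theta\left(\frac1T\right)}$ for sufficiently large $K$ (in particular it is sublinear in $K$).
   Context: Linear bandit setting. $\mathcal{A}$ is the set of arms; arm $a$ has feature vector $x_a\in\mathbb{R}^d$. At each time step $t\in\{1,\dots,T\}$ at most $C_{change}$ arms ($C_{change}$ a constant) are added to or deleted from $\mathcal{A}$. $K$ is the maximum size of $\mathcal{A}$. The learner plays $a_t\in\mathcal{A}$ and observes reward $r_t$. Assumptions: (i) there is $\theta^*\in\mathbb{R}^d$ with $r_t=\langle\theta^*,x_{a_t}\rangle+\eta_t$, $\eta_t$ a mean-zero noise; (ii) $\mathbb{E}[\exp(\alpha\eta_t)\mid\mathcal{F}_{t-1}]\le\exp(\alpha^2/2)$ for all $\alpha\in\mathbb{R}$, $t\in[T]$, where $\mathcal{F}_{t-1}=\sigma(a_1,r_1,\dots,a_{t-1},r_{t-1},a_t)$; (iii) $\|\theta^*\|_2\le1$ and $\|x_a\|_2\le1$ for all $a$; (iv) the largest expected reward $\max_{a\in\mathcal{A}}x_a^\top\theta^*$ is non-negative. The regret is $R(T)=\sum_{t=1}^T(x_{a_t^*}^\top\theta^*-x_{a_t}^\top\theta^* )$, where $a_t^*=\arg\max_{a\in\mathcal{A}}x_a^\top\theta^*$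 is the optimal arm at step $t$. $\widetilde O$ hides logarithmic factors. $d=K^{o(1)}$. Per-step time complexity excludes the one-time initialization of the data structures. Sampling distribution. $\mathcal{D}^{TS}$ is a distribution on $\mathbb{R}^d$, absolutely continuous with respect to Lebesgue measure, such that: (anti-concentration) there is a constant $p>0$ with $\mathbb{P}_{\xi\sim\mathcal{D}^{TS}}(u^\top\xi\ge1)\ge p$ for every $u\in\mathbb{R}^d$ with $\|u\|_2=1$; (concentration) there are positive constants $b,b'$ with $\mathbb{P}_{\xi\sim\mathcal{D}^{TS}}\left(\|\xi\|\le\sqrt{bd\log\frac{b'd}{\delta'}}\right)\ge1-\delta'$ for all $\delta'\in(0,1)$. Adaptive MIPS solver. The $(c,r,\epsilon)$-MIPS problem for a finite set $P$ in the unit ball of $\mathbb{R}^d$ and a query $q$ with $\|q\|_2\le1$: find $p\in P$ with $\langle q,p\rangle\ge cr-\epsilon$ if there is $p^*\in P$ with $\langle q,p^*\rangle\ge r+\epsilon$. A single-query solver $\mathcal{S}(c,r,0)$ for $|P|=K$ (adapted from Andoni et al. 2017) solves $(c,r,0)$-MIPS for any given query with probability at least $0.9$, with preprocessing time $K^{1+o(1)}$, time $K^{o(1)}$ to add a point (deletions are likewise supported efficiently), query time $K^{\rho_q+o(\log^{-0.45}K)}$, $\rho_q=\frac{4c'^2}{(1+c'^2)^2}$, $c'=\sqrt{\frac{3-cr}{3-r}}$. The adaptive solver $\mathcal{M}(c,r,\epsilon,\delta')$ keeps $\kappa=d\log(Kd/(\epsilon\delta'))$ independent copies of $\mathcal{S}(c,r,0)$;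 adding a point adds it to all copies; a query $q$ is rounded to the nearest point $\widehat q$ with all coordinates multiples of $\epsilon/d$, all copies are queried with $\widehat q$, and any point returned by any copy is returned (null if none). Sublinear Time Thompson Sampling algorithm. Input: $\mathcal{A}$, $T$, $\delta$, $\eta(T)\in(0,1)$. Set $\beta(\delta/4T)=1+\sqrt{2\log\frac{4T}\delta+d\log(1+\frac Td)}$, $V_1=I$, $\widehat\theta_1=0$. For $i=1,\dots,\lceil d/\eta(T)\rceil$ build an independent adaptive MIPS solver $\mathcal{M}_i$ with parameters $\left(1-\frac1{i+1},\frac{i\,\eta(T)}{d},\frac{\eta(T)}{d},\frac{\delta\,\eta(T)}{2d}\right)$ on the points $x_a$, $a\in\mathcal{A}$. For $t=1,\dots,T$: add/delete the changing arms in all $\mathcal{M}_i$; sample $\xi_t\sim\mathcal{D}^{TS}$; put $\widetilde\theta_t=\widehat\theta_t+\beta(\delta/4T)V_t^{-1/2}\xi_t$; query the solvers $\mathcal{M}_i$ with $\widetilde\theta_t/\|\widetilde\theta_t\|$ and let $a_t$ be the non-null result with the largest index $i$ (found by binary search over $i$); play $a_t$, observe $r_t$; set $V_{t+1}=V_t+x_{a_t}x_{a_t}^\top$ and $\widehat\theta_{t+1}=(X_{1:t}^\top X_{1:t}+I)^{-1}X_{1:t}^\top Y_{1:t}$, where $X_{1:t}$ has rows $x_{a_1}^\top,\dots,x_{a_t}^\top$ and $Y_{1:t}=(r_1,\dots,r_t)$.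
   Formalization: If all solvers return null, an arm with non-negative expected reward is played; solvers return only points with inner product at least cr; queries are rounded within the unit ball; d does not grow with K in the time bound, and its Θ constants may depend on d. *)

theory Defs
  imports
    "HOL-Probability.Probability"
    "HOL-Library.Landau_Symbols"
    "Jordan_Normal_Form.Gauss_Jordan_Elimination"
begin

text \<open>
  The dimension \<open>d\<close> has to be quantified inside the final statement (the constant hidden in the
  regret bound must not depend on it), so vectors and matrices are those of
  \<open>Jordan_Normal_Form.Matrix\<close>.  Names shared with \<open>HOL-Analysis\<close> are qualified.

  In the running time, by contrast, \<open>d\<close> and \<open>T\<close> stay fixed while \<open>K\<close> grows, and the constants
  in the exponent may depend on \<open>d\<close>: \<open>1 - rho_q\<close> is of exact order \<open>1 / (d\<^sup>2 T)\<close>, so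
  constants uniform in \<open>d\<close> cannot exist.
\<close>

type_synonym rvec = "real Matrix.vec"
type_synonym rmat = "real Matrix.mat"

section \<open>Linear algebra\<close>

definition vnorm :: "rvec \<Rightarrow> real" where
  "vnorm v = sqrt (scalar_prod v v)"

definition unit_ball :: "nat \<Rightarrow> rvec set" where
  "unit_ball d = {v \<in> carrier_vec d. vnorm v \<le> 1}"

definition outer :: "nat \<Rightarrow> rvec \<Rightarrow> rmat" where
  "outer d v = Matrix.mat d d (\<lambda>(i, j). vec_index v i * vec_index v j)"

text \<open>For positive definite \<open>V\<close>: the unique symmetric positive semidefinite square root of the
  inverse of \<open>V\<close>.\<close>

definition inv_sqrt_mat :: "nat \<Rightarrow> rmat \<Rightarrow> rmat" where
  "inv_sqrt_mat d V = (THE B. B \<in> carrier_mat d d \<and> transpose_mat B = B \<and>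
     (\<forall>v \<in> carrier_vec d. 0 \<le> scalar_prod v (B *\<^sub>v v)) \<and>
     B * B = the (mat_inverse V))"

section \<open>Maximum inner product search\<close>

definition solves_mips :: "real \<Rightarrow> real \<Rightarrow> real \<Rightarrow> rvec set \<Rightarrow> rvec \<Rightarrow> rvec option \<Rightarrow> bool" where
  "solves_mips c r eps P q res \<longleftrightarrow>
     (\<exists>p' \<in> P. scalar_prod q p' \<ge> r + eps) \<longrightarrow>
     (\<exists>p \<in> P. res = Some p \<and> scalar_prod q p \<ge> c * r - eps)"

text \<open>
  A family of dynamic single-query solvers, one for each \<open>(d, c, r, K)\<close>, where \<open>K\<close> bounds the
  number of stored points.  All the randomness of a solver is in its seed.  The answer to a
  query may depend on the seed and on the history \<open>Ps\<close> of stored point sets (initial set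
  first, current set last).  The four times are the costs charged to the respective operations.
\<close>

record 's mips_solver =
  seed :: "nat \<Rightarrow> real \<Rightarrow> real \<Rightarrow> nat \<Rightarrow> 's measure"
  answer :: "nat \<Rightarrow> real \<Rightarrow> real \<Rightarrow> nat \<Rightarrow> 's \<Rightarrow> rvec set list \<Rightarrow> rvec \<Rightarrow> rvec option"
  prep_time :: "nat \<Rightarrow> real \<Rightarrow> real \<Rightarrow> nat \<Rightarrow> real"
  add_time :: "nat \<Rightarrow> real \<Rightarrow> real \<Rightarrow> nat \<Rightarrow> real"
  del_time :: "nat \<Rightarrow> real \<Rightarrow> real \<Rightarrow> nat \<Rightarrow> real"
  query_time :: "nat \<Rightarrow> real \<Rightarrow> real \<Rightarrow> nat \<Rightarrow> real"

text \<open>At most \<open>K\<close> to the power \<open>e + o(1)\<close>.\<close>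

definition bounded_by_power :: "real \<Rightarrow> (nat \<Rightarrow> real) \<Rightarrow> bool" where
  "bounded_by_power e f \<longleftrightarrow> (\<forall>K. 0 \<le> f K) \<and>
     (\<exists>g \<in> o[at_top](\<lambda>_. 1). \<forall>\<^sub>F K in at_top. f K \<le> real K powr (e + g K))"

definition rho_q :: "real \<Rightarrow> real \<Rightarrow> real" where
  "rho_q c r = (let c' = sqrt ((3 - c * r) / (3 - r)) in 4 * c'\<^sup>2 / (1 + c'\<^sup>2)\<^sup>2)"

definition solver_history :: "nat \<Rightarrow> nat \<Rightarrow> rvec set list \<Rightarrow> bool" where
  "solver_history d K Ps \<longleftrightarrow> Ps \<noteq> [] \<and>
     (\<forall>P \<in> set Ps. finite P \<and> card P \<le> K \<and> P \<subseteq> unit_ball d)"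

text \<open>
  The success probability \<open>0.9\<close> refers to a history and a query fixed in advance.  Moreover a
  solver never returns a point it has not checked (third conjunct): without this, ``any point
  returned by any copy'' would not be meaningful in the adaptive solver below.  The range
  \<open>r < 3\<close> is where \<open>rho_q\<close> is defined; the solver of largest index in the algorithm may have
  \<open>r\<close> slightly above \<open>1\<close>.
\<close>

definition mips_solver_spec :: "'s mips_solver \<Rightarrow> bool" where
  "mips_solver_spec S \<longleftrightarrow> (\<forall>d c r. 1 \<le> d \<longrightarrow> 0 < c \<longrightarrow> c < 1 \<longrightarrow> 0 < r \<longrightarrow> r < 3 \<longrightarrow>
     (\<forall>K \<ge> 1. prob_space (seed S d c r K) \<and>
       (\<forall>Ps q. solver_history d K Ps \<longrightarrow> q \<in> unit_ball d \<longrightarrow>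
          (\<lambda>s. answer S d c r K s Ps q) \<in> measurable (seed S d c r K) (count_space UNIV) \<and>
          measure (seed S d c r K)
            {s \<in> space (seed S d c r K). solves_mips c r 0 (last Ps) q (answer S d c r K s Ps q)}
            \<ge> 0.9 \<and>
          (\<forall>s \<in> space (seed S d c r K). \<forall>p. answer S d c r K s Ps q = Some p \<longrightarrow>
             p \<in> last Ps \<and> scalar_prod q p \<ge> c * r))) \<and>
     bounded_by_power 1 (prep_time S d c r) \<and>
     bounded_by_power 0 (add_time S d c r) \<and>
     bounded_by_power 0 (del_time S d c r) \<and>
     (\<exists>g \<in> o[at_top](\<lambda>K. ln (real K) powr (- 0.45)).
        \<forall>\<^sub>F K in at_top. query_time S d c r K = real K powr (rho_q c r + g K)) \<and>
     (\<forall>K. 0 \<le> query_time S d c r K))"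

section \<open>Adaptive solver\<close>

definition copies :: "nat \<Rightarrow> nat \<Rightarrow> real \<Rightarrow> real \<Rightarrow> nat" where
  "copies d K eps delta' = nat \<lceil>real d * ln (real K * real d / (eps * delta'))\<rceil>"

text \<open>
  Queries are rounded to the nearest grid point inside the unit ball, since solvers only accept
  queries of norm at most 1 and the nearest point of the unrestricted grid can lie outside.
\<close>

definition query_grid :: "nat \<Rightarrow> real \<Rightarrow> rvec set" where
  "query_grid d eps =
     {v \<in> unit_ball d. \<forall>i < d. \<exists>k::int. vec_index v i = of_int k * (eps / real d)}"

definition round_query :: "nat \<Rightarrow> real \<Rightarrow> rvec \<Rightarrow> rvec" where
  "round_query d eps q = arg_min_on (\<lambda>v. vnorm (q - v)) (query_grid d eps)"

text \<open>\<open>s j\<close> is the seed of the \<open>j\<close>-th copy.\<close>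

definition adaptive_answer ::
  "'s mips_solver \<Rightarrow> nat \<Rightarrow> real \<Rightarrow> real \<Rightarrow> real \<Rightarrow> real \<Rightarrow> nat \<Rightarrow> (nat \<Rightarrow> 's) \<Rightarrow>
     rvec set list \<Rightarrow> rvec \<Rightarrow> rvec option" where
  "adaptive_answer S d c r eps delta' K s Ps q =
     (let R = {p. \<exists>j < copies d K eps delta'.
                    answer S d c r K (s j) Ps (round_query d eps q) = Some p}
      in if R = {} then None else Some (SOME p. p \<in> R))"

section \<open>Binary search\<close>

text \<open>
  Search for the largest index \<open>i\<close> with \<open>f i\<close>, assuming \<open>f lo\<close> and \<open>\<not> f hi\<close> without testing
  these two; \<open>bsearch_probes\<close> is the set of tested indices.
\<close>

function bsearch :: "(nat \<Rightarrow> bool) \<Rightarrow> nat \<Rightarrow> nat \<Rightarrow> nat" where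
  "bsearch f lo hi = (if hi \<le> Suc lo then lo else
     let m = (lo + hi) div 2 in if f m then bsearch f m hi else bsearch f lo m)"
  by pat_completeness auto
termination by (relation "Wellfounded.measure (\<lambda>(f, lo, hi). hi - lo)") auto

function bsearch_probes :: "(nat \<Rightarrow> bool) \<Rightarrow> nat \<Rightarrow> nat \<Rightarrow> nat set" where
  "bsearch_probes f lo hi = (if hi \<le> Suc lo then {} else
     let m = (lo + hi) div 2 in
     insert m (if f m then bsearch_probes f m hi else bsearch_probes f lo m))"
  by pat_completeness auto
termination by (relation "Wellfounded.measure (\<lambda>(f, lo, hi). hi - lo)") auto

declare bsearch.simps [simp del] bsearch_probes.simps [simp del]

lemma bsearch_eqI:
  assumes "lo \<le> k" "k < hi"
    and "\<And>i. lo < i \<Longrightarrow> i < hi \<Longrightarrow> f i \<longleftrightarrow> i \<le> k"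
  shows "bsearch f lo hi = k"
  using assms
proof (induction f lo hi rule: bsearch.induct)
  case (1 f lo hi)
  note lo = "1.prems"(1) and hi = "1.prems"(2) and f = "1.prems"(3)
  show ?case
  proof (cases "hi \<le> Suc lo")
    case True
    then show ?thesis using lo hi by (subst bsearch.simps) simp
  next
    case False
    define m where "m = (lo + hi) div 2"
    have m: "lo < m" "m < hi" using False by (simp_all add: m_def)
    have step: "bsearch f lo hi = (if f m then bsearch f m hi else bsearch f lo m)"
      using False by (subst bsearch.simps) (simp add: m_def Let_def)
    show ?thesis
    proof (cases "f m")
      case True
      then have "m \<le> k" using f m by blast
      then have "bsearch f m hi = k"
        using "1.IH"(1)[OF False m_def True] hi f m by simp
      then show ?thesis using True step by simp
    next
      case nf: False
      then have "k < m" using f m by (meson not_le)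
      then have "bsearch f lo m = k"
        using "1.IH"(2)[OF False m_def nf] lo f m by simp
      then show ?thesis using nf step by simp
    qed
  qed
qed

text \<open>If \<open>f\<close> is downward closed, the search returns the largest index satisfying \<open>f\<close>.\<close>

lemma bsearch_largest:
  assumes "1 \<le> k" "k \<le> n" "f k"
    and "\<And>i. k < i \<Longrightarrow> i \<le> n \<Longrightarrow> \<not> f i"
    and "\<And>i. 1 \<le> i \<Longrightarrow> i \<le> k \<Longrightarrow> f i"
  shows "bsearch f 0 (Suc n) = k"
proof (rule bsearch_eqI)
  fix i assume "0 < i" "i < Suc n"
  then show "f i \<longleftrightarrow> i \<le> k"
    using assms(4)[of i] assms(5)[of i] by (cases "i \<le> k") simp_all
qed (use assms(2) in simp_all)

section \<open>Thompson sampling with approximate search\<close>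

text \<open>The arm set at step \<open>t \<ge> 1\<close> is \<open>A t\<close>; the data structures are built on \<open>A 0\<close>.\<close>

definition ts_distribution :: "nat \<Rightarrow> real \<Rightarrow> real \<Rightarrow> real \<Rightarrow> (nat \<Rightarrow> real) measure \<Rightarrow> bool" where
  "ts_distribution d p b b' D \<longleftrightarrow>
     prob_space D \<and> sets D = sets (\<Pi>\<^sub>M i\<in>{..<d}. borel) \<and>
     absolutely_continuous (\<Pi>\<^sub>M i\<in>{..<d}. lborel) D \<and>
     (\<forall>u \<in> carrier_vec d. vnorm u = 1 \<longrightarrow>
        measure D {z \<in> space D. scalar_prod u (Matrix.vec d z) \<ge> 1} \<ge> p) \<and>
     (\<forall>delta'. 0 < delta' \<and> delta' < 1 \<longrightarrow>
        measure D {z \<in> space D. vnorm (Matrix.vec d z) \<le> sqrt (b * real d * ln (b' * real d / delta'))}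
          \<ge> 1 - delta')"

definition conf_radius :: "nat \<Rightarrow> nat \<Rightarrow> real \<Rightarrow> real" where
  "conf_radius d T delta' = 1 + sqrt (2 * ln (1 / delta') + real d * ln (1 + real T / real d))"

text \<open>In the following, \<open>acts k\<close> and \<open>rew k\<close> are the arm and the reward of step \<open>k \<ge> 1\<close>;
  \<open>gram_mat d x acts t\<close> is the matrix \<open>V\<close> after \<open>t\<close> steps, that is, with index \<open>t + 1\<close>, and
  similarly for the estimate.\<close>

primrec gram_mat :: "nat \<Rightarrow> (nat \<Rightarrow> rvec) \<Rightarrow> (nat \<Rightarrow> nat) \<Rightarrow> nat \<Rightarrow> rmat" where
  "gram_mat d x acts 0 = 1\<^sub>m d"
| "gram_mat d x acts (Suc t) = gram_mat d x acts t + outer d (x (acts (Suc t)))"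

definition design_mat :: "nat \<Rightarrow> (nat \<Rightarrow> rvec) \<Rightarrow> (nat \<Rightarrow> nat) \<Rightarrow> nat \<Rightarrow> rmat" where
  "design_mat d x acts t = Matrix.mat t d (\<lambda>(k, j). vec_index (x (acts (Suc k))) j)"

definition theta_hat ::
  "nat \<Rightarrow> (nat \<Rightarrow> rvec) \<Rightarrow> (nat \<Rightarrow> nat) \<Rightarrow> (nat \<Rightarrow> real) \<Rightarrow> nat \<Rightarrow> rvec" where
  "theta_hat d x acts rew t =
     (let X = design_mat d x acts t; Y = Matrix.vec t (\<lambda>k. rew (Suc k)) in
      the (mat_inverse (transpose_mat X * X + 1\<^sub>m d)) *\<^sub>v (transpose_mat X *\<^sub>v Y))"

text \<open>The query of step \<open>t \<ge> 1\<close>, where \<open>z\<close> is the sample.\<close>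

definition ts_query ::
  "nat \<Rightarrow> nat \<Rightarrow> real \<Rightarrow> (nat \<Rightarrow> rvec) \<Rightarrow> (nat \<Rightarrow> nat) \<Rightarrow> (nat \<Rightarrow> real) \<Rightarrow> nat \<Rightarrow> (nat \<Rightarrow> real) \<Rightarrow> rvec"
  where
  "ts_query d T delta x acts rew t z =
     (let th = theta_hat d x acts rew (t - 1) +
          conf_radius d T (delta / (4 * real T)) \<cdot>\<^sub>v
            (inv_sqrt_mat d (gram_mat d x acts (t - 1)) *\<^sub>v Matrix.vec d z)
      in (1 / vnorm th) \<cdot>\<^sub>v th)"

definition num_solvers :: "nat \<Rightarrow> real \<Rightarrow> nat" where
  "num_solvers d eta = nat \<lceil>real d / eta\<rceil>"

definition par_c :: "nat \<Rightarrow> real" where "par_c i = 1 - 1 / (real i + 1)"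
definition par_r :: "nat \<Rightarrow> real \<Rightarrow> nat \<Rightarrow> real" where "par_r d eta i = real i * eta / real d"
definition par_eps :: "nat \<Rightarrow> real \<Rightarrow> real" where "par_eps d eta = eta / real d"
definition par_delta :: "nat \<Rightarrow> real \<Rightarrow> real \<Rightarrow> real" where
  "par_delta d eta delta = delta * eta / (2 * real d)"

definition num_copies :: "nat \<Rightarrow> nat \<Rightarrow> real \<Rightarrow> real \<Rightarrow> nat" where
  "num_copies d K eta delta = copies d K (par_eps d eta) (par_delta d eta delta)"

definition point_history :: "(nat \<Rightarrow> nat set) \<Rightarrow> (nat \<Rightarrow> rvec) \<Rightarrow> nat \<Rightarrow> rvec set list" where
  "point_history A x t = map (\<lambda>k. x ` A k) [0..<Suc t]"

text \<open>Answer at step \<open>t\<close> of the adaptive solver with index \<open>i\<close>; \<open>s i j\<close> is the seed of its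
  \<open>j\<close>-th copy.\<close>

definition ts_answer ::
  "'s mips_solver \<Rightarrow> nat \<Rightarrow> nat \<Rightarrow> real \<Rightarrow> real \<Rightarrow> (nat \<Rightarrow> nat set) \<Rightarrow> (nat \<Rightarrow> rvec) \<Rightarrow>
     (nat \<Rightarrow> nat \<Rightarrow> 's) \<Rightarrow> nat \<Rightarrow> rvec \<Rightarrow> nat \<Rightarrow> rvec option" where
  "ts_answer S d K eta delta A x s t q i =
     adaptive_answer S d (par_c i) (par_r d eta i) (par_eps d eta) (par_delta d eta delta) K
       (s i) (point_history A x t) q"

definition ts_index ::
  "'s mips_solver \<Rightarrow> nat \<Rightarrow> nat \<Rightarrow> real \<Rightarrow> real \<Rightarrow> (nat \<Rightarrow> nat set) \<Rightarrow> (nat \<Rightarrow> rvec) \<Rightarrow>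
     (nat \<Rightarrow> nat \<Rightarrow> 's) \<Rightarrow> nat \<Rightarrow> rvec \<Rightarrow> nat" where
  "ts_index S d K eta delta A x s t q =
     bsearch (\<lambda>i. ts_answer S d K eta delta A x s t q i \<noteq> None) 0 (Suc (num_solvers d eta))"

text \<open>Index \<open>0\<close> means that the search met only null results; then the arm \<open>dflt t\<close> is played.\<close>

definition ts_arm ::
  "'s mips_solver \<Rightarrow> nat \<Rightarrow> nat \<Rightarrow> real \<Rightarrow> real \<Rightarrow> (nat \<Rightarrow> nat set) \<Rightarrow> (nat \<Rightarrow> rvec) \<Rightarrow>
     (nat \<Rightarrow> nat) \<Rightarrow> (nat \<Rightarrow> nat \<Rightarrow> 's) \<Rightarrow> nat \<Rightarrow> rvec \<Rightarrow> nat" where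
  "ts_arm S d K eta delta A x dflt s t q =
     (let i = ts_index S d K eta delta A x s t q in
      if i = 0 then dflt t
      else SOME a. a \<in> A t \<and> Some (x a) = ts_answer S d K eta delta A x s t q i)"

text \<open>
  Running time of step \<open>t\<close>: updates of all copies of all solvers, one query to all copies of
  each solver probed by the binary search, and the remaining work \<open>rest t\<close> (sampling, update
  of \<open>V\<close> and of the estimate, rounding, bookkeeping).  Initialization is not included.
\<close>

definition step_time ::
  "'s mips_solver \<Rightarrow> (nat \<Rightarrow> real) \<Rightarrow> nat \<Rightarrow> nat \<Rightarrow> real \<Rightarrow> real \<Rightarrow> (nat \<Rightarrow> nat set) \<Rightarrow> (nat \<Rightarrow> rvec) \<Rightarrow>
     (nat \<Rightarrow> nat \<Rightarrow> 's) \<Rightarrow> nat \<Rightarrow> rvec \<Rightarrow> real" where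
  "step_time S rest d K eta delta A x s t q =
     (let \<kappa> = real (num_copies d K eta delta); n = num_solvers d eta in
      (\<Sum>i = 1..n. \<kappa> *
         (real (card (A t - A (t - 1))) * add_time S d (par_c i) (par_r d eta i) K +
          real (card (A (t - 1) - A t)) * del_time S d (par_c i) (par_r d eta i) K)) +
      (\<Sum>i \<in> bsearch_probes (\<lambda>i. ts_answer S d K eta delta A x s t q i \<noteq> None) 0 (Suc n).
         \<kappa> * query_time S d (par_c i) (par_r d eta i) K) +
      rest t)"

definition opt_arm :: "(nat \<Rightarrow> nat set) \<Rightarrow> (nat \<Rightarrow> rvec) \<Rightarrow> rvec \<Rightarrow> nat \<Rightarrow> nat" where
  "opt_arm A x theta t = arg_max_on (\<lambda>a. scalar_prod (x a) theta) (A t)"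

definition regret ::
  "nat \<Rightarrow> (nat \<Rightarrow> nat set) \<Rightarrow> (nat \<Rightarrow> rvec) \<Rightarrow> rvec \<Rightarrow> (nat \<Rightarrow> nat) \<Rightarrow> real" where
  "regret T A x theta acts =
     (\<Sum>t = 1..T. scalar_prod (x (opt_arm A x theta t)) theta - scalar_prod (x (acts t)) theta)"

section \<open>Runs of the algorithm\<close>

text \<open>The sigma-algebra generated by \<open>a 1, r 1, \<dots>, a (t - 1), r (t - 1), a t\<close>.\<close>

definition noise_filtration ::
  "'w measure \<Rightarrow> (nat \<Rightarrow> 'w \<Rightarrow> nat) \<Rightarrow> (nat \<Rightarrow> 'w \<Rightarrow> real) \<Rightarrow> nat \<Rightarrow> 'w measure" where
  "noise_filtration M a r t =
     vimage_algebra (space M) (\<lambda>\<omega>. (\<lambda>k\<in>{1..t}. a k \<omega>, \<lambda>k\<in>{1..<t}. r k \<omega>))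
       ((\<Pi>\<^sub>M k\<in>{1..t}. count_space UNIV) \<Otimes>\<^sub>M (\<Pi>\<^sub>M k\<in>{1..<t}. borel))"

text \<open>The sigma-algebra of everything that happened before the sample of step \<open>t\<close> is drawn:
  all seeds, indexed by \<open>I\<close>, and the earlier samples and rewards.\<close>

definition sampling_past ::
  "'w measure \<Rightarrow> nat \<Rightarrow> (nat \<times> nat) set \<Rightarrow> (nat \<times> nat \<Rightarrow> 's measure) \<Rightarrow> (nat \<Rightarrow> nat \<Rightarrow> 'w \<Rightarrow> 's) \<Rightarrow>
     (nat \<Rightarrow> 'w \<Rightarrow> nat \<Rightarrow> real) \<Rightarrow> (nat \<Rightarrow> 'w \<Rightarrow> real) \<Rightarrow> nat \<Rightarrow> 'w measure" where
  "sampling_past M d I N s \<xi> r t =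
     vimage_algebra (space M)
       (\<lambda>\<omega>. (\<lambda>ij\<in>I. s (fst ij) (snd ij) \<omega>, \<lambda>k\<in>{1..<t}. \<xi> k \<omega>, \<lambda>k\<in>{1..<t}. r k \<omega>))
       ((\<Pi>\<^sub>M ij\<in>I. N ij) \<Otimes>\<^sub>M ((\<Pi>\<^sub>M k\<in>{1..<t}. \<Pi>\<^sub>M i\<in>{..<d}. borel) \<Otimes>\<^sub>M (\<Pi>\<^sub>M k\<in>{1..<t}. borel)))"

text \<open>
  The arm sets are fixed in advance.  The algorithm does not say what to play when all results
  are null, which does happen, e.g.\ when all arms have negative inner product with the sampled
  parameter.  With an arbitrary choice the regret could then be linear, so \<open>dflt t\<close> is taken to
  be an arm with non-negative expected reward, e.g.\ an arm with zero features.  By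
  \<open>nonneg_opt\<close> there always is one.

  \<open>eta = 1\<close> is admitted so that \<open>eta = 1 / sqrt T\<close> covers \<open>T = 1\<close>.
\<close>

locale sublinear_ts_run = prob_space M
  for M :: "'w measure" +
  fixes S :: "'s mips_solver"
    and p b b' :: real and C_change :: nat
    and d T K :: nat and delta eta :: real
    and A :: "nat \<Rightarrow> nat set" and x :: "nat \<Rightarrow> rvec" and theta :: rvec
    and dflt :: "nat \<Rightarrow> nat"
    and D :: "(nat \<Rightarrow> real) measure"
    and s :: "nat \<Rightarrow> nat \<Rightarrow> 'w \<Rightarrow> 's"
    and \<xi> :: "nat \<Rightarrow> 'w \<Rightarrow> nat \<Rightarrow> real"
    and a :: "nat \<Rightarrow> 'w \<Rightarrow> nat"
    and r noise :: "nat \<Rightarrow> 'w \<Rightarrow> real"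
  fixes I :: "(nat \<times> nat) set" and N :: "nat \<times> nat \<Rightarrow> 's measure"
  defines "I \<equiv> {1..num_solvers d eta} \<times> {..<num_copies d K eta delta}"
    and "N \<equiv> \<lambda>ij. seed S d (par_c (fst ij)) (par_r d eta (fst ij)) K"
  assumes params: "1 \<le> d" "1 \<le> T" "1 \<le> K" "0 < delta" "delta < 1" "0 < eta" "eta \<le> 1"
    (* bandit instance *)
    and arms: "\<And>t. t \<le> T \<Longrightarrow> finite (A t) \<and> A t \<noteq> {} \<and> card (A t) \<le> K"
    and change: "\<And>t. t \<in> {1..T} \<Longrightarrow> card (A t - A (t - 1)) + card (A (t - 1) - A t) \<le> C_change"
    and features: "\<And>t e. t \<le> T \<Longrightarrow> e \<in> A t \<Longrightarrow> x e \<in> carrier_vec d \<and> vnorm (x e) \<le> 1"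
    and theta: "theta \<in> carrier_vec d" "vnorm theta \<le> 1"
    and nonneg_opt: "\<And>t. t \<in> {1..T} \<Longrightarrow> 0 \<le> (MAX e\<in>A t. scalar_prod (x e) theta)"
    and dflt: "\<And>t. t \<in> {1..T} \<Longrightarrow> dflt t \<in> A t \<and> 0 \<le> scalar_prod (x (dflt t)) theta"
    (* rewards *)
    and rewards: "\<And>t \<omega>. t \<in> {1..T} \<Longrightarrow> \<omega> \<in> space M \<Longrightarrow>
          r t \<omega> = scalar_prod theta (x (a t \<omega>)) + noise t \<omega>"
    and noise_mean: "\<And>t. t \<in> {1..T} \<Longrightarrow> integrable M (noise t) \<and> expectation (noise t) = 0"
    and noise_subgaussian: "\<And>t \<alpha>. t \<in> {1..T} \<Longrightarrow>
          AE \<omega> in M. nn_cond_exp M (noise_filtration M a r t) (\<lambda>\<omega>. ennreal (exp (\<alpha> * noise t \<omega>))) \<omega>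
            \<le> ennreal (exp (\<alpha>\<^sup>2 / 2))"
    (* randomness of the algorithm *)
    and distribution: "ts_distribution d p b b' D"
    and seeds: "\<And>ij. ij \<in> I \<Longrightarrow> s (fst ij) (snd ij) \<in> measurable M (N ij) \<and>
          distr M (N ij) (s (fst ij) (snd ij)) = N ij"
    and seeds_indep: "indep_vars N (\<lambda>ij. s (fst ij) (snd ij)) I"
    and samples: "\<And>t. t \<in> {1..T} \<Longrightarrow> \<xi> t \<in> measurable M D \<and> distr M D (\<xi> t) = D"
    and samples_indep: "\<And>t. t \<in> {1..T} \<Longrightarrow>
          indep_set (sets (vimage_algebra (space M) (\<xi> t) D)) (sets (sampling_past M d I N s \<xi> r t))"
    (* the arm played *)
    and arm_measurable: "\<And>t. t \<in> {1..T} \<Longrightarrow> a t \<in> measurable M (count_space UNIV)"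
    and arm_played: "\<And>t \<omega>. t \<in> {1..T} \<Longrightarrow> \<omega> \<in> space M \<Longrightarrow>
          a t \<omega> = ts_arm S d K eta delta A x dflt (\<lambda>i j. s i j \<omega>) t
            (ts_query d T delta x (\<lambda>k. a k \<omega>) (\<lambda>k. r k \<omega>) t (\<xi> t \<omega>))"

end

(*
  Regret.  By the method of mixtures, with a Gaussian prior on the exponent, the true parameter
  stays in the confidence ellipsoids with high probability.  The adaptive solvers fix their seeds
  before the queries are known, but the rounded queries range over a finite grid, so enough copies
  make all solvers correct on the whole grid and at all steps.  Then the arm played maximizes the
  inner product with the sampled parameter up to O(eta / d) times the norm of that parameter; this
  holds although the answers need not be monotone in the index, because binary search still stops
  at an index that succeeds and whose successor fails.  Let the gap of a step be the distance from
  the optimal value to the best lower confidence bound; it is determined by the past.  Conditionally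
  on the past, a sample makes the algorithm optimistic with probability at least p / 2, and then the
  gap is bounded by the confidence width of the arm played.  An exponential supermartingale compares
  the sum of all gaps with the sum over the optimistic steps, and the elliptical potential lemma
  bounds the sum of the widths by sqrt (T d log T).

  Running time.  Since 1 - rho_q c r = (r (1 - c) / (6 - r (1 + c)))^2, all solvers satisfy
  eta^2 / (144 d^2) <= 1 - rho_q <= eta^2 / (4 d^2) with eta^2 = 1 / T.  One query is always made,
  and every other factor in the cost of a step is K^o(1).
*)
theory Submission
  imports Defs "Jordan_Normal_Form.Determinant" "HOL-Real_Asymp.Real_Asymp"
begin

text \<open>Four obstacles shape the details. The dimension is a variable and not a type, so the
  Gaussian mixture never appears as an integral over R^d: its closed form is used, whose successive
  quotients are one-dimensional Gaussian integrals. The matrices depend on the past only through the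
  list of arms played, which takes countably many values; for a fixed list they are constants, so
  measurability and conditioning are settled one list at a time. When every solver returns null,
  nothing relates the arm played to the sampled parameter; but its true value is non-negative while
  all sampled values are small, and this gives the same upper bound on the sampled values as a
  successful search, so one inequality serves both cases. Finally, the number of copies is bounded
  below, uniformly in K, by d log (2 d^3 T / delta). This beats the union over grid, steps and
  solvers once T \<ge> 256; for smaller T the regret is trivially at most 2 T.\<close>

unbundle no inner_syntax and no vec_syntax

section \<open>Symmetric bilinear forms and matrices bounded below by the identity\<close>

lemma scalar_prod_self_nonneg: "0 \<le> (v :: rvec) \<bullet> v"
  by (simp add: scalar_prod_def sum_nonneg)

lemma scalar_prod_self_eq_0:
  fixes v :: rvec
  assumes "v \<in> carrier_vec n" "v \<bullet> v = 0"
  shows "v = 0\<^sub>v n"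
proof
  fix i assume i: "i < dim_vec (0\<^sub>v n)"
  have "\<forall>i\<in>{0..<n}. v $ i * v $ i = 0"
    using assms by (subst sum_nonneg_eq_0_iff[symmetric]) (auto simp: scalar_prod_def)
  then show "v $ i = 0\<^sub>v n $ i" using i by simp
qed (use assms in simp)

lemma sym_form_commute:
  fixes A :: rmat
  assumes "A \<in> carrier_mat n n" "A\<^sup>T = A" "u \<in> carrier_vec n" "v \<in> carrier_vec n"
  shows "u \<bullet> (A *\<^sub>v v) = v \<bullet> (A *\<^sub>v u)"
  using transpose_vec_mult_scalar[of A n n v u] assms
  by (metis comm_scalar_prod mult_mat_vec_carrier)

lemma sym_move:
  fixes A :: rmat
  assumes "A \<in> carrier_mat n n" "A\<^sup>T = A" "u \<in> carrier_vec n" "v \<in> carrier_vec n"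
  shows "(A *\<^sub>v u) \<bullet> v = u \<bullet> (A *\<^sub>v v)"
  using transpose_vec_mult_scalar[of A n n v u] assms by simp

lemma form_add_smult:
  fixes A :: rmat
  assumes A: "A \<in> carrier_mat n n" "A\<^sup>T = A" and u: "u \<in> carrier_vec n" and v: "v \<in> carrier_vec n"
  shows "(u + s \<cdot>\<^sub>v v) \<bullet> (A *\<^sub>v (u + s \<cdot>\<^sub>v v))
     = u \<bullet> (A *\<^sub>v u) + 2 * s * (u \<bullet> (A *\<^sub>v v)) + s\<^sup>2 * (v \<bullet> (A *\<^sub>v v))"
proof -
  have "A *\<^sub>v (u + s \<cdot>\<^sub>v v) = A *\<^sub>v u + s \<cdot>\<^sub>v (A *\<^sub>v v)"
    using A u v by (simp add: mult_add_distrib_mat_vec mult_mat_vec)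
  moreover have "(u + s \<cdot>\<^sub>v v) \<bullet> (A *\<^sub>v u + s \<cdot>\<^sub>v (A *\<^sub>v v))
      = u \<bullet> (A *\<^sub>v u) + s * (u \<bullet> (A *\<^sub>v v)) + (s * (v \<bullet> (A *\<^sub>v u)) + s * (s * (v \<bullet> (A *\<^sub>v v))))"
    using A u v
    by (simp add: add_scalar_prod_distrib[of _ n] scalar_prod_add_distrib[of _ n] algebra_simps)
  ultimately show ?thesis
    using sym_form_commute[OF A u v] by (simp add: power2_eq_square algebra_simps)
qed

text \<open>The form at \<open>u + s v\<close> is a nonnegative polynomial in \<open>s\<close> of
  degree at most two, so its discriminant is not positive. The matrix may be singular.\<close>

lemma psd_cauchy_schwarz:
  fixes A :: rmat
  assumes A: "A \<in> carrier_mat n n" "A\<^sup>T = A" and pos: "\<And>v. v \<in> carrier_vec n \<Longrightarrow> 0 \<le> v \<bullet> (A *\<^sub>v v)"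
    and u: "u \<in> carrier_vec n" and v: "v \<in> carrier_vec n"
  shows "(u \<bullet> (A *\<^sub>v v))\<^sup>2 \<le> (u \<bullet> (A *\<^sub>v u)) * (v \<bullet> (A *\<^sub>v v))"
proof -
  define a b c where abc: "a = u \<bullet> (A *\<^sub>v u)" "b = u \<bullet> (A *\<^sub>v v)" "c = v \<bullet> (A *\<^sub>v v)"
  have q: "0 \<le> a + 2 * s * b + s\<^sup>2 * c" for s
    using pos[of "u + s \<cdot>\<^sub>v v"] form_add_smult[OF A u v, of s] u v by (simp add: abc)
  have "b\<^sup>2 \<le> a * c"
  proof (cases "c = 0")
    case True
    have "b = 0"
    proof (rule ccontr)
      assume "b \<noteq> 0"
      \<comment> \<open>With \<open>c = 0\<close> the polynomial is linear and takes the value -1 at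
        this point.\<close>
      then show False using q[of "- (a + 1) / (2 * b)"] True by (simp add: field_simps)
    qed
    then show ?thesis using True by simp
  next
    case False
    then have c: "c > 0" using pos[OF v] by (simp add: abc)
    have "0 \<le> a + 2 * (- b / c) * b + (- b / c)\<^sup>2 * c" by (rule q)
    also have "\<dots> = a - b\<^sup>2 / c" using c by (simp add: field_simps power2_eq_square)
    finally show ?thesis using c by (simp add: field_simps)
  qed
  then show ?thesis by (simp add: abc)
qed

lemma vec_cauchy_schwarz:
  fixes u v :: rvec
  assumes "u \<in> carrier_vec n" "v \<in> carrier_vec n"
  shows "(u \<bullet> v)\<^sup>2 \<le> (u \<bullet> u) * (v \<bullet> v)"
  using psd_cauchy_schwarz[of "1\<^sub>m n" n u v] assms by (simp add: scalar_prod_self_nonneg)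

lemma vnorm_nonneg [simp]: "0 \<le> vnorm v"
  by (simp add: vnorm_def scalar_prod_self_nonneg)

lemma vnorm_sq: "(vnorm v)\<^sup>2 = v \<bullet> v"
  by (simp add: vnorm_def scalar_prod_self_nonneg)

lemma abs_scalar_prod_le_vnorm:
  assumes "u \<in> carrier_vec n" "v \<in> carrier_vec n"
  shows "\<bar>u \<bullet> v\<bar> \<le> vnorm u * vnorm v"
  using real_sqrt_le_mono[OF vec_cauchy_schwarz[OF assms]]
  by (simp add: vnorm_def real_sqrt_mult)

text \<open>Symmetric and at least the identity in the Loewner order. The bound by 1, rather than
  mere positivity, passes to leading blocks and makes the inverse at most the identity.\<close>

definition ge_one :: "nat \<Rightarrow> rmat \<Rightarrow> bool" where
  "ge_one n V \<longleftrightarrow> V \<in> carrier_mat n n \<and> V\<^sup>T = V \<and> (\<forall>v \<in> carrier_vec n. v \<bullet> v \<le> v \<bullet> (V *\<^sub>v v))"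

definition minv :: "rmat \<Rightarrow> rmat" where "minv V = the (mat_inverse V)"

lemma ge_one_det_nonzero:
  assumes "ge_one n V"
  shows "Determinant.det V \<noteq> 0"
proof
  assume "Determinant.det V = 0"
  then obtain v where v: "v \<in> carrier_vec n" "v \<noteq> 0\<^sub>v n" "V *\<^sub>v v = 0\<^sub>v n"
    using det_0_iff_vec_prod_zero_field[of V n] assms by (auto simp: ge_one_def)
  then have "v \<bullet> v \<le> 0" using assms by (force simp: ge_one_def)
  then show False using scalar_prod_self_nonneg[of v] scalar_prod_self_eq_0[OF v(1)] v(2) by simp
qed

lemma minv:
  assumes "ge_one n V"
  shows "minv V \<in> carrier_mat n n" "V * minv V = 1\<^sub>m n" "minv V * V = 1\<^sub>m n" "(minv V)\<^sup>T = minv V"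
proof -
  have V: "V \<in> carrier_mat n n" "V\<^sup>T = V" using assms by (auto simp: ge_one_def)
  have "mat_inverse V \<noteq> None"
    using mat_inverse(1)[OF V(1), of "()"] det_non_zero_imp_unit[OF V(1) ge_one_det_nonzero[OF assms], of "()"] by blast
  then obtain W where "mat_inverse V = Some W" by blast
  with mat_inverse(2)[OF V(1) this] show W: "minv V \<in> carrier_mat n n" "V * minv V = 1\<^sub>m n" "minv V * V = 1\<^sub>m n"
    by (auto simp: minv_def)
  \<comment> \<open>The transpose is a left inverse of the symmetric \<open>V\<close>, and a left
    inverse equals any right inverse.\<close>
  have "(minv V)\<^sup>T * V = 1\<^sub>m n"
    using V W by (metis transpose_mult transpose_one)
  then have "(minv V)\<^sup>T * V * minv V = minv V" using W by simp
  moreover have "(minv V)\<^sup>T * V * minv V = (minv V)\<^sup>T * (V * minv V)"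
    using V W by (intro assoc_mult_mat[of _ n n _ n _ n]) auto
  ultimately show "(minv V)\<^sup>T = minv V" using W by simp
qed

lemma minv_cancel:
  assumes "ge_one n V" "v \<in> carrier_vec n"
  shows "V *\<^sub>v (minv V *\<^sub>v v) = v" "minv V *\<^sub>v (V *\<^sub>v v) = v"
proof -
  have V: "V \<in> carrier_mat n n" using assms by (auto simp: ge_one_def)
  show "V *\<^sub>v (minv V *\<^sub>v v) = v"
    using assoc_mult_mat_vec[OF V minv(1)[OF assms(1)] assms(2)] minv(2)[OF assms(1)] assms(2) by simp
  show "minv V *\<^sub>v (V *\<^sub>v v) = v"
    using assoc_mult_mat_vec[OF minv(1)[OF assms(1)] V assms(2)] minv(3)[OF assms(1)] assms(2) by simp
qed

text \<open>For \<open>u = minv V *\<^sub>v v\<close> one has \<open>V u = v\<close>. The lower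
  bound on \<open>V\<close> at \<open>u\<close> gives \<open>u . u\<close> \<le>
  \<open>v . u\<close>, hence the first claim and, with Cauchy-Schwarz for \<open>u\<close> and
  \<open>v\<close>, the second. The third is Cauchy-Schwarz for the form of \<open>V\<close> itself
  at \<open>v\<close> and \<open>u\<close>.\<close>

lemma minv_form:
  assumes V: "ge_one n V" and v: "v \<in> carrier_vec n"
  shows "0 \<le> v \<bullet> (minv V *\<^sub>v v)" "v \<bullet> (minv V *\<^sub>v v) \<le> v \<bullet> v"
    and "(\<And>u. u \<in> carrier_vec n \<Longrightarrow> u \<bullet> (V *\<^sub>v u) \<le> m * (u \<bullet> u)) \<Longrightarrow> v \<bullet> v \<le> m * (v \<bullet> (minv V *\<^sub>v v))"
proof -
  define u where "u = minv V *\<^sub>v v"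
  have Vc: "V \<in> carrier_mat n n" "V\<^sup>T = V" using V by (auto simp: ge_one_def)
  have u: "u \<in> carrier_vec n" using minv(1)[OF V] v by (simp add: u_def)
  have Vu: "V *\<^sub>v u = v" using minv_cancel[OF V v] by (simp add: u_def)
  have pos: "\<And>v. v \<in> carrier_vec n \<Longrightarrow> 0 \<le> v \<bullet> (V *\<^sub>v v)"
    using V order_trans[OF scalar_prod_self_nonneg] by (auto simp: ge_one_def)
  have uv: "u \<bullet> u \<le> v \<bullet> u" using V u Vu comm_scalar_prod[OF u v] by (auto simp: ge_one_def)
  then show nn: "0 \<le> v \<bullet> (minv V *\<^sub>v v)" using scalar_prod_self_nonneg[of u] by (simp add: u_def)
  have "(v \<bullet> u)\<^sup>2 \<le> (v \<bullet> v) * (u \<bullet> u)" by (rule vec_cauchy_schwarz[OF v u])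
  also have "\<dots> \<le> (v \<bullet> v) * (v \<bullet> u)" by (intro mult_left_mono uv scalar_prod_self_nonneg)
  finally show "v \<bullet> (minv V *\<^sub>v v) \<le> v \<bullet> v"
    using nn scalar_prod_self_nonneg[of v] unfolding u_def[symmetric] power2_eq_square
    by (cases "v \<bullet> u = 0") auto
  assume m: "\<And>u. u \<in> carrier_vec n \<Longrightarrow> u \<bullet> (V *\<^sub>v u) \<le> m * (u \<bullet> u)"
  have "(v \<bullet> (V *\<^sub>v u))\<^sup>2 \<le> (v \<bullet> (V *\<^sub>v v)) * (u \<bullet> (V *\<^sub>v u))"
    by (rule psd_cauchy_schwarz[OF Vc pos v u])
  then have "(v \<bullet> v)\<^sup>2 \<le> (v \<bullet> (V *\<^sub>v v)) * (v \<bullet> u)"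
    using Vu comm_scalar_prod[OF u v] by simp
  also have "\<dots> \<le> m * (v \<bullet> v) * (v \<bullet> u)" using nn m[OF v] by (intro mult_right_mono) (auto simp: u_def)
  finally have "(v \<bullet> v) * (v \<bullet> v) \<le> (v \<bullet> v) * (m * (v \<bullet> u))" by (simp add: power2_eq_square algebra_simps)
  then show "v \<bullet> v \<le> m * (v \<bullet> (minv V *\<^sub>v v))"
  proof (cases "v \<bullet> v = 0")
    case True
    then have "v = 0\<^sub>v n" by (rule scalar_prod_self_eq_0[OF v])
    then show ?thesis using True u v by (simp add: u_def)
  next
    case False
    then have "v \<bullet> v > 0" using scalar_prod_self_nonneg[of v] by simp
    with \<open>(v \<bullet> v) * (v \<bullet> v) \<le> _\<close> show ?thesis by (simp add: u_def)
  qed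
qed

section \<open>Determinants\<close>

text \<open>Bordering a square matrix by block composition takes the border as genuine matrices with
  one column, one row and one entry.\<close>

definition col_mat :: "nat \<Rightarrow> rvec \<Rightarrow> rmat" where "col_mat n v = Matrix.mat n 1 (\<lambda>(i, j). v $ i)"
definition row_mat :: "nat \<Rightarrow> rvec \<Rightarrow> rmat" where "row_mat n v = Matrix.mat 1 n (\<lambda>(i, j). v $ j)"
definition scal_mat :: "real \<Rightarrow> rmat" where "scal_mat a = Matrix.mat 1 1 (\<lambda>_. a)"

lemma small_carriers [simp]:
  "col_mat n v \<in> carrier_mat n 1" "row_mat n v \<in> carrier_mat 1 n" "scal_mat a \<in> carrier_mat 1 1"
  "col_mat n v \<in> carrier_mat n (Suc 0)" "row_mat n v \<in> carrier_mat (Suc 0) n"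
  "scal_mat a \<in> carrier_mat (Suc 0) (Suc 0)"
  by (simp_all add: col_mat_def row_mat_def scal_mat_def)

lemma det_scal_mat [simp]: "Determinant.det (scal_mat a) = a"
  by (subst det_single) (auto simp: scal_mat_def)

lemma bordered_carrier:
  assumes "V \<in> carrier_mat n n" "B \<in> carrier_mat n 1" "C \<in> carrier_mat 1 n" "D \<in> carrier_mat 1 1"
  shows "four_block_mat V B C D \<in> carrier_mat (Suc n) (Suc n)"
  using four_block_carrier_mat[OF assms(1,4)] by simp

lemma mult_col_mat:
  assumes "A \<in> carrier_mat n n" "v \<in> carrier_vec n"
  shows "A * col_mat n v = col_mat n (A *\<^sub>v v)"
  using assms by (intro eq_matI) (auto simp: col_mat_def scalar_prod_def)

lemma row_mult_col:
  assumes "u \<in> carrier_vec n" "v \<in> carrier_vec n"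
  shows "row_mat n u * col_mat n v = scal_mat (u \<bullet> v)"
  using assms by (intro eq_matI) (auto simp: col_mat_def row_mat_def scal_mat_def scalar_prod_def)

text \<open>Schur complement: adding to the last column the combination of the first
  \<open>n\<close> columns with coefficients \<open>w = - W b\<close> clears the upper right block,
  and this operation is multiplication by a unitriangular matrix.\<close>

lemma det_bordered:
  fixes V W :: rmat
  assumes V: "V \<in> carrier_mat n n" and W: "W \<in> carrier_mat n n" "V * W = 1\<^sub>m n"
    and b: "b \<in> carrier_vec n" and c: "c \<in> carrier_vec n"
  shows "Determinant.det (four_block_mat V (col_mat n b) (row_mat n c) (scal_mat a))
     = Determinant.det V * (a - c \<bullet> (W *\<^sub>v b))"
proof -
  define w where "w = - (W *\<^sub>v b)"
  have w: "w \<in> carrier_vec n" using W b by (simp add: w_def)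
  have Vw: "V *\<^sub>v w = - b"
  proof -
    have "V *\<^sub>v (W *\<^sub>v b) = b" using assoc_mult_mat_vec[OF V W(1) b] W b by simp
    moreover have "V *\<^sub>v (- (W *\<^sub>v b)) = - (V *\<^sub>v (W *\<^sub>v b))"
      using V W b by (intro eq_vecI) auto
    ultimately show ?thesis by (simp add: w_def)
  qed
  let ?X = "four_block_mat V (col_mat n b) (row_mat n c) (scal_mat a)"
  let ?Y = "four_block_mat (1\<^sub>m n) (col_mat n w) (0\<^sub>m 1 n) (1\<^sub>m 1)"
  have cw: "c \<bullet> w = - (c \<bullet> (W *\<^sub>v b))" using W b c by (simp add: w_def)
  have "?X * ?Y = four_block_mat (V * 1\<^sub>m n + col_mat n b * 0\<^sub>m 1 n) (V * col_mat n w + col_mat n b * 1\<^sub>m 1)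
     (row_mat n c * 1\<^sub>m n + scal_mat a * 0\<^sub>m 1 n) (row_mat n c * col_mat n w + scal_mat a * 1\<^sub>m 1)"
    using V by (intro mult_four_block_mat[where ?n1.0=n and ?n2.0=1 and ?nr2.0=1]) auto
  also have "V * 1\<^sub>m n + col_mat n b * 0\<^sub>m 1 n = V"
    using V right_mult_zero_mat[OF small_carriers(1)[of n b], of n] by simp
  also have "V * col_mat n w + col_mat n b * 1\<^sub>m 1 = 0\<^sub>m n 1"
    unfolding mult_col_mat[OF V w] Vw right_mult_one_mat[OF small_carriers(1)]
    using b by (intro eq_matI) (auto simp: col_mat_def)
  also have "row_mat n c * 1\<^sub>m n + scal_mat a * 0\<^sub>m 1 n = row_mat n c"
    using right_mult_zero_mat[OF small_carriers(3)[of a], of n] right_mult_one_mat[OF small_carriers(2)[of n c]] by simp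
  also have "row_mat n c * col_mat n w + scal_mat a * 1\<^sub>m 1 = scal_mat (a - c \<bullet> (W *\<^sub>v b))"
    unfolding row_mult_col[OF c w] right_mult_one_mat[OF small_carriers(3)] cw
    by (intro eq_matI) (auto simp: scal_mat_def)
  finally have "Determinant.det (?X * ?Y) = Determinant.det (four_block_mat V (0\<^sub>m n 1) (row_mat n c) (scal_mat (a - c \<bullet> (W *\<^sub>v b))))"
    by simp
  also have "\<dots> = Determinant.det V * (a - c \<bullet> (W *\<^sub>v b))"
    by (subst det_four_block_mat_upper_right_zero[where n=n and m=1]) (use V in auto)
  also have "Determinant.det (?X * ?Y) = Determinant.det ?X * Determinant.det ?Y"
    using V by (intro det_mult[where n="Suc n"] bordered_carrier) auto
  also have "Determinant.det ?Y = 1"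
    by (subst det_four_block_mat_lower_left_zero[where n=n and m=1]) auto
  finally show ?thesis by simp
qed

lemma outer_carrier [simp]: "outer n v \<in> carrier_mat n n"
  by (simp add: outer_def)

lemma outer_mult_vec:
  assumes "x \<in> carrier_vec n" "v \<in> carrier_vec n"
  shows "outer n x *\<^sub>v v = (x \<bullet> v) \<cdot>\<^sub>v x"
  using assms by (intro eq_vecI) (auto simp: outer_def scalar_prod_def sum_distrib_right sum_distrib_left algebra_simps intro!: sum.cong)

lemma outer_transpose [simp]: "(outer n x)\<^sup>T = outer n x"
  by (intro eq_matI) (auto simp: outer_def)

text \<open>The matrix determinant lemma. The determinant of the bordered matrix with corner -1 is
  computed twice: by the Schur complement of \<open>V\<close>, and by clearing the last row with
  column operations, which turns \<open>V\<close> into \<open>V + outer n x\<close>.\<close>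

lemma det_rank_one_update:
  fixes V W :: rmat
  assumes V: "V \<in> carrier_mat n n" and W: "W \<in> carrier_mat n n" "V * W = 1\<^sub>m n"
    and x: "x \<in> carrier_vec n"
  shows "Determinant.det (V + outer n x) = Determinant.det V * (1 + x \<bullet> (W *\<^sub>v x))"
proof -
  let ?X = "four_block_mat V (col_mat n x) (row_mat n x) (scal_mat (-1))"
  let ?Y = "four_block_mat (1\<^sub>m n) (0\<^sub>m n 1) (row_mat n x) (1\<^sub>m 1)"
  have "?X * ?Y = four_block_mat (V * 1\<^sub>m n + col_mat n x * row_mat n x) (V * 0\<^sub>m n 1 + col_mat n x * 1\<^sub>m 1)
     (row_mat n x * 1\<^sub>m n + scal_mat (-1) * row_mat n x) (row_mat n x * 0\<^sub>m n 1 + scal_mat (-1) * 1\<^sub>m 1)"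
    using V by (intro mult_four_block_mat[where ?n1.0=n and ?n2.0=1 and ?nr2.0=1]) auto
  also have "V * 1\<^sub>m n + col_mat n x * row_mat n x = V + outer n x"
    using V by (intro eq_matI) (auto simp: col_mat_def row_mat_def outer_def scalar_prod_def)
  also have "V * 0\<^sub>m n 1 + col_mat n x * 1\<^sub>m 1 = col_mat n x"
    using right_mult_zero_mat[OF V, of 1] right_mult_one_mat[OF small_carriers(1)[of n x]] by simp
  also have "row_mat n x * 1\<^sub>m n + scal_mat (-1) * row_mat n x = 0\<^sub>m 1 n"
    unfolding right_mult_one_mat[OF small_carriers(2)]
    by (intro eq_matI) (auto simp: row_mat_def scal_mat_def scalar_prod_def)
  also have "row_mat n x * 0\<^sub>m n 1 + scal_mat (-1) * 1\<^sub>m 1 = scal_mat (-1)"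
    using right_mult_zero_mat[OF small_carriers(2)[of n x], of 1] right_mult_one_mat[OF small_carriers(3)[of "-1"]] by simp
  finally have "Determinant.det (?X * ?Y) = Determinant.det (four_block_mat (V + outer n x) (col_mat n x) (0\<^sub>m 1 n) (scal_mat (-1)))"
    by simp
  also have "\<dots> = - Determinant.det (V + outer n x)"
    by (subst det_four_block_mat_lower_left_zero[where n=n and m=1]) (use V in auto)
  also have "Determinant.det (?X * ?Y) = Determinant.det ?X * Determinant.det ?Y"
    using V by (intro det_mult[where n="Suc n"] bordered_carrier) auto
  also have "Determinant.det ?Y = 1"
    by (subst det_four_block_mat_upper_right_zero[where n=n and m=1]) auto
  also have "Determinant.det ?X = Determinant.det V * (- 1 - x \<bullet> (W *\<^sub>v x))"
    by (rule det_bordered[OF V W x x])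
  finally show ?thesis by (simp add: algebra_simps)
qed

text \<open>Hadamard's inequality, by eliminating the last row and column.\<close>

lemma hadamard_ge_one:
  "ge_one n V \<Longrightarrow> 0 < Determinant.det V \<and> Determinant.det V \<le> (\<Prod>i<n. V $$ (i, i))"
proof (induction n arbitrary: V)
  case 0
  then show ?case by (auto simp: ge_one_def)
next
  case (Suc n)
  have V: "V \<in> carrier_mat (Suc n) (Suc n)" "V\<^sup>T = V"
    and Vpos: "\<And>v. v \<in> carrier_vec (Suc n) \<Longrightarrow> v \<bullet> v \<le> v \<bullet> (V *\<^sub>v v)"
    using Suc.prems by (auto simp: ge_one_def)
  have sym: "V $$ (i, j) = V $$ (j, i)" if "i < Suc n" "j < Suc n" for i j
    using V(1) that index_transpose_mat(1)[of j V i] unfolding V(2) by simp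
  define U where "U = Matrix.mat n n (\<lambda>(i, j). V $$ (i, j))"
  define b where "b = Matrix.vec n (\<lambda>i. V $$ (i, n))"
  define a where "a = V $$ (n, n)"
  have U: "U \<in> carrier_mat n n" and b: "b \<in> carrier_vec n" by (auto simp: U_def b_def)
  have Vblock: "V = four_block_mat U (col_mat n b) (row_mat n b) (scal_mat a)"
  proof (rule eq_matI)
    fix i j
    assume "i < dim_row (four_block_mat U (col_mat n b) (row_mat n b) (scal_mat a))"
      "j < dim_col (four_block_mat U (col_mat n b) (row_mat n b) (scal_mat a))"
    then have ij: "i < Suc n" "j < Suc n" using U by (auto simp: scal_mat_def)
    then show "V $$ (i, j) = four_block_mat U (col_mat n b) (row_mat n b) (scal_mat a) $$ (i, j)"
      using sym[OF ij] 
      by (auto simp: U_def b_def a_def col_mat_def row_mat_def scal_mat_def less_Suc_eq)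
  qed (use V U in \<open>auto simp: scal_mat_def\<close>)
  have form: "(v @\<^sub>v Matrix.vec 1 (\<lambda>_. s)) \<bullet> (V *\<^sub>v (v @\<^sub>v Matrix.vec 1 (\<lambda>_. s)))
      = v \<bullet> (U *\<^sub>v v) + 2 * s * (v \<bullet> b) + s\<^sup>2 * a" if v: "v \<in> carrier_vec n" for v s
  proof -
    have "V *\<^sub>v (v @\<^sub>v Matrix.vec 1 (\<lambda>_. s)) = (U *\<^sub>v v + s \<cdot>\<^sub>v b) @\<^sub>v Matrix.vec 1 (\<lambda>_. b \<bullet> v + s * a)"
    proof -
      have "V *\<^sub>v (v @\<^sub>v Matrix.vec 1 (\<lambda>_. s)) =
        (U *\<^sub>v v + col_mat n b *\<^sub>v Matrix.vec 1 (\<lambda>_. s)) @\<^sub>v (row_mat n b *\<^sub>v v + scal_mat a *\<^sub>v Matrix.vec 1 (\<lambda>_. s))"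
        unfolding Vblock by (rule four_block_mat_mult_vec[OF U small_carriers(1-3) v]) simp
      also have "col_mat n b *\<^sub>v Matrix.vec 1 (\<lambda>_. s) = s \<cdot>\<^sub>v b"
        using b by (intro eq_vecI) (auto simp: col_mat_def scalar_prod_def)
      also have "row_mat n b *\<^sub>v v + scal_mat a *\<^sub>v Matrix.vec 1 (\<lambda>_. s) = Matrix.vec 1 (\<lambda>_. b \<bullet> v + s * a)"
        using v b by (intro eq_vecI) (auto simp: row_mat_def scal_mat_def scalar_prod_def)
      finally show ?thesis .
    qed
    then show ?thesis using v U b comm_scalar_prod[OF v b]
      by (simp add: scalar_prod_append[of _ n _ 1] scalar_prod_add_distrib[of _ n])
        (simp add: scalar_prod_def power2_eq_square algebra_simps)
  qed
  have sq: "(v @\<^sub>v Matrix.vec 1 (\<lambda>_. s)) \<bullet> (v @\<^sub>v Matrix.vec 1 (\<lambda>_. s)) = v \<bullet> v + s\<^sup>2"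
    if v: "v \<in> carrier_vec n" for v :: rvec and s
    using scalar_prod_append[OF v _ v, of "Matrix.vec 1 (\<lambda>_. s)" 1 "Matrix.vec 1 (\<lambda>_. s)"]
    by (simp add: scalar_prod_def power2_eq_square)
  have lower: "v \<bullet> v + s\<^sup>2 \<le> v \<bullet> (U *\<^sub>v v) + 2 * s * (v \<bullet> b) + s\<^sup>2 * a" if v: "v \<in> carrier_vec n" for v s
  proof -
    have "v @\<^sub>v Matrix.vec 1 (\<lambda>_. s) \<in> carrier_vec (Suc n)"
      using append_carrier_vec[OF v, of "Matrix.vec 1 (\<lambda>_. s)" 1] by simp
    from Vpos[OF this] show ?thesis unfolding form[OF v] sq[OF v] .
  qed
  \<comment> \<open>Vectors with last entry 0 carry the lower bound over to the leading
    block.\<close>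
  have "ge_one n U"
    unfolding ge_one_def
  proof (intro conjI ballI)
    show "U\<^sup>T = U" using sym by (intro eq_matI) (auto simp: U_def)
  qed (use U lower[of _ 0] in auto)
  note IH = Suc.IH[OF this] and W = minv[OF this] and Wf = minv_form[OF this b]
  define w where "w = minv U *\<^sub>v b"
  have w: "w \<in> carrier_vec n" using W b by (simp add: w_def)
  have Uw: "U *\<^sub>v w = b" using minv_cancel[OF \<open>ge_one n U\<close> b] by (simp add: w_def)
  \<comment> \<open>The form at the vector with blocks \<open>w\<close> and -1 is the Schur
    complement \<open>a - b . w\<close>, which is therefore positive.\<close>
  have "w \<bullet> w + 1 \<le> a - b \<bullet> w"
    using lower[OF w, of "-1"] comm_scalar_prod[OF w b] unfolding Uw by simp
  then have pos: "0 < a - b \<bullet> w" using scalar_prod_self_nonneg[of w] by simp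
  have d: "Determinant.det V = Determinant.det U * (a - b \<bullet> w)"
    unfolding w_def by (subst Vblock) (rule det_bordered[OF U W(1,2) b b])
  \<comment> \<open>The form of the inverse is nonnegative at \<open>b\<close>, so the Schur
    complement is at most the corner entry \<open>a\<close>.\<close>
  have "Determinant.det U * (a - b \<bullet> w) \<le> (\<Prod>i<n. U $$ (i, i)) * a"
    using IH pos Wf(1) by (intro mult_mono) (auto simp: w_def)
  also have "\<dots> = (\<Prod>i<Suc n. V $$ (i, i))" by (simp add: a_def U_def)
  finally show ?case using d IH pos by simp
qed

section \<open>Square roots\<close>

text \<open>These are the coefficients of sqrt (1 - z). The ratio of successive ones is
  \<open>(k - 1/2) / (k + 1)\<close>, negative at \<open>k = 0\<close> and in [0, 1] afterwards. The
  sign pattern later bounds the matrix series from below.\<close>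

lemma gbinomial_half_sign:
  fixes k :: nat
  defines "a \<equiv> \<lambda>k. ((1/2 :: real) gchoose k) * (- 1) ^ k"
  shows "\<bar>a k\<bar> \<le> 1" "k \<ge> 1 \<Longrightarrow> a k \<le> 0"
proof -
  have step: "a (Suc k) = a k * ((real k - 1/2) / (real k + 1))" for k
  proof -
    have "((1/2 :: real) gchoose Suc k) * (real k + 1) = (1/2 gchoose k) * (1/2 - real k)"
      using gbinomial_mult_1[of "1/2::real" k] by (simp add: algebra_simps)
    then have e: "((1/2 :: real) gchoose Suc k) = (1/2 gchoose k) * (1/2 - real k) / (real k + 1)"
      by (simp add: field_simps)
    show ?thesis unfolding a_def e by (simp add: field_simps)
  qed
  have "k \<ge> 1 \<longrightarrow> a k \<le> 0 \<and> \<bar>a k\<bar> \<le> 1" for k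
  proof (induction k)
    case (Suc k)
    show ?case
    proof (cases "k = 0")
      case False
      then have r: "0 \<le> (real k - 1/2) / (real k + 1)" "(real k - 1/2) / (real k + 1) \<le> 1"
        by (auto simp: field_simps)
      have "\<bar>a (Suc k)\<bar> = \<bar>a k\<bar> * ((real k - 1/2) / (real k + 1))"
        unfolding step abs_mult abs_of_nonneg[OF r(1)] ..
      moreover have "\<dots> \<le> 1 * 1" using Suc False r by (intro mult_mono) auto
      moreover have "a (Suc k) \<le> 0" unfolding step using Suc False r by (intro mult_nonpos_nonneg) auto
      ultimately show ?thesis by simp
    qed (simp add: a_def)
  qed simp
  note * = this[of k]
  then show "k \<ge> 1 \<Longrightarrow> a k \<le> 0" by simp
  show "\<bar>a k\<bar> \<le> 1" using * by (cases "k = 0") (auto simp: a_def)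
qed

lemma pow_mat_add:
  fixes A :: rmat
  assumes "A \<in> carrier_mat n n"
  shows "A ^\<^sub>m (k + l) = A ^\<^sub>m k * A ^\<^sub>m l"
proof (induction l)
  case 0
  then show ?case using assms by simp
next
  case (Suc l)
  have "A ^\<^sub>m k * (A ^\<^sub>m l * A) = A ^\<^sub>m k * A ^\<^sub>m l * A"
    using assms by (intro assoc_mult_mat[symmetric]) (auto intro: pow_carrier_mat)
  then show ?case using Suc by simp
qed

lemma pow_mat_sym:
  fixes A :: rmat
  assumes "A \<in> carrier_mat n n" "A\<^sup>T = A"
  shows "(A ^\<^sub>m k)\<^sup>T = A ^\<^sub>m k"
proof (induction k)
  case 0
  then show ?case using assms by simp
next
  case (Suc k)
  have "(A ^\<^sub>m k * A)\<^sup>T = A * A ^\<^sub>m k"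
    using transpose_mult[of "A ^\<^sub>m k" n n A n] Suc assms by (simp add: pow_carrier_mat)
  also have "\<dots> = A ^\<^sub>m k * A"
    using pow_mat_add[OF assms(1), of 1 k] pow_mat_add[OF assms(1), of k 1] assms(1) by simp
  finally show ?case by simp
qed

lemma mult_mat_entry:
  fixes X Y :: rmat
  assumes "X \<in> carrier_mat n n" "Y \<in> carrier_mat n n" "i < n" "j < n"
  shows "(X * Y) $$ (i, j) = (\<Sum>l<n. X $$ (i, l) * Y $$ (l, j))"
  using assms by (simp add: scalar_prod_def atLeast0LessThan)

text \<open>The root is the binomial series of sqrt (1 - A) in \<open>A = 1 - P\<close>, which
  avoids diagonalization. Since \<open>A\<close> lies between 0 and \<open>q\<close>, the entries of
  its \<open>k\<close>-th power are at most \<open>q ^ k\<close> in absolute value, and the series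
  converges absolutely entry by entry.\<close>

lemma psd_sqrt_exists:
  fixes P :: rmat
  assumes P: "P \<in> carrier_mat n n" "P\<^sup>T = P" and q: "0 \<le> q" "q < 1"
    and lo: "\<And>v. v \<in> carrier_vec n \<Longrightarrow> (1 - q) * (v \<bullet> v) \<le> v \<bullet> (P *\<^sub>v v)"
    and hi: "\<And>v. v \<in> carrier_vec n \<Longrightarrow> v \<bullet> (P *\<^sub>v v) \<le> v \<bullet> v"
  obtains B where "B \<in> carrier_mat n n" "B\<^sup>T = B" "\<And>v. v \<in> carrier_vec n \<Longrightarrow> 0 \<le> v \<bullet> (B *\<^sub>v v)" "B * B = P"
proof -
  define A where "A = 1\<^sub>m n - P"
  have A: "A \<in> carrier_mat n n" "A\<^sup>T = A"
    using P transpose_minus[of "1\<^sub>m n" n n P] by (auto simp: A_def)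
  have Af: "u \<bullet> (A *\<^sub>v v) = u \<bullet> v - u \<bullet> (P *\<^sub>v v)" if "u \<in> carrier_vec n" "v \<in> carrier_vec n" for u v
    using that P by (simp add: A_def minus_mult_distrib_mat_vec[of _ n n] scalar_prod_minus_distrib[of _ n])
  have Apos: "0 \<le> v \<bullet> (A *\<^sub>v v)" and Aq: "v \<bullet> (A *\<^sub>v v) \<le> q * (v \<bullet> v)" if "v \<in> carrier_vec n" for v
    using lo[OF that] hi[OF that] Af[OF that that] by (auto simp: algebra_simps)
  have contr: "vnorm (A *\<^sub>v v) \<le> q * vnorm v" if v: "v \<in> carrier_vec n" for v
  proof -
    define u where "u = A *\<^sub>v v"
    have u: "u \<in> carrier_vec n" using A v by (simp add: u_def)
    \<comment> \<open>Cauchy-Schwarz for the semidefinite form of \<open>A\<close> at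
      \<open>u = A v\<close> and \<open>v\<close>; both factors on the right are at most
      \<open>q\<close> times a squared norm.\<close>
    have "(u \<bullet> u)\<^sup>2 \<le> (u \<bullet> (A *\<^sub>v u)) * (v \<bullet> (A *\<^sub>v v))"
      using psd_cauchy_schwarz[OF A Apos u v] by (simp add: u_def)
    also have "\<dots> \<le> (q * (u \<bullet> u)) * (q * (v \<bullet> v))"
      using Apos Aq u v q by (intro mult_mono) (auto simp: scalar_prod_self_nonneg)
    finally have "(u \<bullet> u) * (u \<bullet> u) \<le> (u \<bullet> u) * (q\<^sup>2 * (v \<bullet> v))"
      by (simp add: power2_eq_square algebra_simps)
    then have "u \<bullet> u \<le> q\<^sup>2 * (v \<bullet> v)"
      using scalar_prod_self_nonneg[of u] scalar_prod_self_nonneg[of v]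
      by (cases "u \<bullet> u = 0") (auto simp: mult_le_cancel_left)
    then have "sqrt (u \<bullet> u) \<le> sqrt (q\<^sup>2 * (v \<bullet> v))" by simp
    then show ?thesis using q by (simp add: vnorm_def u_def real_sqrt_mult)
  qed
  have powc: "A ^\<^sub>m k \<in> carrier_mat n n" for k using A by (simp add: pow_carrier_mat)
  have pownorm: "vnorm (A ^\<^sub>m k *\<^sub>v v) \<le> q ^ k * vnorm v" if v: "v \<in> carrier_vec n" for k v
    using v
  proof (induction k arbitrary: v)
    case (Suc k)
    have "A ^\<^sub>m Suc k *\<^sub>v v = A ^\<^sub>m k *\<^sub>v (A *\<^sub>v v)"
      using assoc_mult_mat_vec[OF powc A(1) Suc.prems] by simp
    also have "vnorm \<dots> \<le> q ^ k * vnorm (A *\<^sub>v v)" using A Suc by auto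
    also have "\<dots> \<le> q ^ k * (q * vnorm v)" using contr[OF Suc.prems] q by (intro mult_left_mono) auto
    finally show ?case by (simp add: algebra_simps)
  qed (use A in simp)
  have powform: "\<bar>u \<bullet> (A ^\<^sub>m k *\<^sub>v v)\<bar> \<le> q ^ k * (vnorm u * vnorm v)"
    if u: "u \<in> carrier_vec n" and v: "v \<in> carrier_vec n" for u v k
  proof -
    have "\<bar>u \<bullet> (A ^\<^sub>m k *\<^sub>v v)\<bar> \<le> vnorm u * vnorm (A ^\<^sub>m k *\<^sub>v v)"
      by (rule abs_scalar_prod_le_vnorm[OF u mult_mat_vec_carrier[OF powc v]])
    also have "\<dots> \<le> vnorm u * (q ^ k * vnorm v)" by (intro mult_left_mono pownorm v) simp
    finally show ?thesis by (simp add: algebra_simps)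
  qed
  define a where "a = (\<lambda>k. ((1/2 :: real) gchoose k) * (- 1) ^ k)"
  have abs_a: "\<bar>a k\<bar> \<le> 1" and neg_a: "k \<ge> 1 \<Longrightarrow> a k \<le> 0" for k
    using gbinomial_half_sign[of k] by (auto simp: a_def)
  have a0: "a 0 = 1" by (simp add: a_def)
  have entry: "\<bar>a k * (A ^\<^sub>m k) $$ (i, j)\<bar> \<le> q ^ k" if "i < n" "j < n" for i j k
  proof -
    have *: "unit_vec n i \<bullet> (A ^\<^sub>m k *\<^sub>v unit_vec n j) = (A ^\<^sub>m k) $$ (i, j)"
      using that powc[of k] carrier_matD[OF A(1)] by (auto simp: scalar_prod_left_unit[of _ n])
    have "vnorm (unit_vec n i) = 1" "vnorm (unit_vec n j) = 1" using that by (auto simp: vnorm_def)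
    with powform[of "unit_vec n i" "unit_vec n j" k] * have "\<bar>(A ^\<^sub>m k) $$ (i, j)\<bar> \<le> q ^ k" by simp
    then have "\<bar>a k\<bar> * \<bar>(A ^\<^sub>m k) $$ (i, j)\<bar> \<le> 1 * q ^ k" using abs_a by (intro mult_mono) auto
    then show ?thesis by (simp add: abs_mult)
  qed
  have qsum: "summable (\<lambda>k. q ^ k)" using q by (intro summable_geometric) auto
  have abssum: "summable (\<lambda>k. \<bar>a k * (A ^\<^sub>m k) $$ (i, j)\<bar>)" if "i < n" "j < n" for i j
    using entry[OF that] by (intro summable_comparison_test'[OF qsum, of 0]) auto
  define B where "B = Matrix.mat n n (\<lambda>(i, j). \<Sum>k. a k * (A ^\<^sub>m k) $$ (i, j))"
  have B: "B \<in> carrier_mat n n" by (simp add: B_def)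
  have Bsums: "(\<lambda>k. a k * (A ^\<^sub>m k) $$ (i, j)) sums (B $$ (i, j))" if "i < n" "j < n" for i j
    using summable_sums[OF summable_rabs_cancel[OF abssum[OF that]]] that by (simp add: B_def)
  have symk: "(A ^\<^sub>m k) $$ (i, j) = (A ^\<^sub>m k) $$ (j, i)" if "i < n" "j < n" for i j k
    using that powc[of k] carrier_matD[OF A(1)] index_transpose_mat(1)[of j "A ^\<^sub>m k" i] unfolding pow_mat_sym[OF A] by simp
  have Bsym: "B\<^sup>T = B" using symk by (intro eq_matI) (auto simp: B_def)
  have form_sum: "u \<bullet> (X *\<^sub>v v) = (\<Sum>i<n. \<Sum>j<n. u $ i * v $ j * X $$ (i, j))"
    if "u \<in> carrier_vec n" "v \<in> carrier_vec n" "X \<in> carrier_mat n n" for u v :: rvec and X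
    using that by (auto simp: scalar_prod_def sum_distrib_left atLeast0LessThan intro!: sum.cong)
  have Bform: "(\<lambda>k. a k * (u \<bullet> (A ^\<^sub>m k *\<^sub>v v))) sums (u \<bullet> (B *\<^sub>v v))"
    if "u \<in> carrier_vec n" "v \<in> carrier_vec n" for u v
  proof -
    have "(\<lambda>k. \<Sum>i<n. \<Sum>j<n. u $ i * v $ j * (a k * (A ^\<^sub>m k) $$ (i, j)))
       sums (\<Sum>i<n. \<Sum>j<n. u $ i * v $ j * B $$ (i, j))"
      by (intro sums_sum sums_mult Bsums) auto
    then show ?thesis
      unfolding form_sum[OF that B] form_sum[OF that powc] sum_distrib_left
      by (simp add: algebra_simps)
  qed
  have Bpos: "0 \<le> v \<bullet> (B *\<^sub>v v)" if v: "v \<in> carrier_vec n" for v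
  proof -
    have "(\<lambda>k. ((1/2) gchoose k) * (- q) ^ k) sums (1 + - q) powr (1/2)"
      using q by (intro gen_binomial_real) auto
    moreover have "((1/2) gchoose k) * (- q) ^ k = a k * q ^ k" for k
      by (simp add: a_def power_minus[of q])
    ultimately have "(\<lambda>k. a k * q ^ k) sums (1 - q) powr (1/2)" by simp
    from sums_mult[OF this, of "v \<bullet> v"]
    have s: "(\<lambda>k. (v \<bullet> v) * (a k * q ^ k)) sums ((v \<bullet> v) * (1 - q) powr (1/2))" .
    \<comment> \<open>Termwise comparison with the scalar series of sqrt (1 - q): the terms agree at
      \<open>k = 0\<close>, and for larger \<open>k\<close> the coefficient is nonpositive while the
      form of the power is at most \<open>q ^ k\<close> times \<open>v . v\<close>.\<close>
    have le: "(v \<bullet> v) * (a k * q ^ k) \<le> a k * (v \<bullet> (A ^\<^sub>m k *\<^sub>v v))" for k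
    proof (cases "k = 0")
      case True
      then show ?thesis using v A by (simp add: a0)
    next
      case False
      have "v \<bullet> (A ^\<^sub>m k *\<^sub>v v) \<le> q ^ k * (v \<bullet> v)"
        using powform[OF v v, of k] vnorm_sq[of v] by (auto simp: power2_eq_square abs_le_iff)
      from mult_left_mono_neg[OF this neg_a] False show ?thesis by (simp add: algebra_simps)
    qed
    have "(v \<bullet> v) * (1 - q) powr (1/2) \<le> v \<bullet> (B *\<^sub>v v)"
      by (rule sums_le[OF _ s Bform[OF v v]]) (rule le)
    from order_trans[OF mult_nonneg_nonneg[OF scalar_prod_self_nonneg powr_ge_zero] this] show ?thesis .
  qed
  have "B * B = P"
  proof (rule eq_matI)
    fix i j assume "i < dim_row P" "j < dim_col P"
    then have ij: "i < n" "j < n" using P by auto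
    have "(\<lambda>N. \<Sum>k\<le>N. (a k * (A ^\<^sub>m k) $$ (i, l)) * (a (N - k) * (A ^\<^sub>m (N - k)) $$ (l, j)))
        sums (B $$ (i, l) * B $$ (l, j))" if l: "l < n" for l
      using Cauchy_product_sums[of "\<lambda>k. a k * (A ^\<^sub>m k) $$ (i, l)" "\<lambda>k. a k * (A ^\<^sub>m k) $$ (l, j)"]
        abssum ij l sums_unique[OF Bsums] by simp
    then have "(\<lambda>N. \<Sum>l<n. \<Sum>k\<le>N. (a k * (A ^\<^sub>m k) $$ (i, l)) * (a (N - k) * (A ^\<^sub>m (N - k)) $$ (l, j)))
        sums (\<Sum>l<n. B $$ (i, l) * B $$ (l, j))"
      by (intro sums_sum) auto
    moreover have "(\<Sum>l<n. B $$ (i, l) * B $$ (l, j)) = (B * B) $$ (i, j)"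
      using B ij by (simp add: scalar_prod_def atLeast0LessThan)
    moreover have "(\<Sum>l<n. \<Sum>k\<le>N. (a k * (A ^\<^sub>m k) $$ (i, l)) * (a (N - k) * (A ^\<^sub>m (N - k)) $$ (l, j)))
       = (if N = 0 then (1\<^sub>m n) $$ (i, j) else if N = 1 then - A $$ (i, j) else 0)" for N
    proof -
      have "(\<Sum>l<n. \<Sum>k\<le>N. (a k * (A ^\<^sub>m k) $$ (i, l)) * (a (N - k) * (A ^\<^sub>m (N - k)) $$ (l, j)))
        = (\<Sum>k\<le>N. a k * a (N - k) * (\<Sum>l<n. (A ^\<^sub>m k) $$ (i, l) * (A ^\<^sub>m (N - k)) $$ (l, j)))"
        by (subst sum.swap) (simp add: sum_distrib_left algebra_simps)
      also have "\<dots> = (\<Sum>k\<le>N. a k * a (N - k) * (A ^\<^sub>m N) $$ (i, j))"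
      proof (intro sum.cong refl)
        fix k assume "k \<in> {..N}"
        then have "A ^\<^sub>m N = A ^\<^sub>m k * A ^\<^sub>m (N - k)" using pow_mat_add[OF A(1), of k "N - k"] by simp
        then show "a k * a (N - k) * (\<Sum>l<n. (A ^\<^sub>m k) $$ (i, l) * (A ^\<^sub>m (N - k)) $$ (l, j)) = a k * a (N - k) * (A ^\<^sub>m N) $$ (i, j)"
          using mult_mat_entry[OF powc powc ij, of k "N - k"] by simp
      qed
      also have "\<dots> = (\<Sum>k\<le>N. a k * a (N - k)) * (A ^\<^sub>m N) $$ (i, j)" by (simp add: sum_distrib_right)
      \<comment> \<open>Vandermonde's convolution turns the coefficients for 1/2 into those for 1/2
        + 1/2 = 1, which vanish from \<open>N = 2\<close> on. The product series thus reduces to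
        \<open>1 - A\<close>, that is, \<open>P\<close>.\<close>
      also have "(\<Sum>k\<le>N. a k * a (N - k)) = (1 gchoose N) * (- 1) ^ N"
      proof -
        have "(\<Sum>k\<le>N. a k * a (N - k)) = (\<Sum>k\<le>N. ((1/2) gchoose k) * ((1/2) gchoose (N - k)) * (- 1) ^ N)"
        proof (intro sum.cong refl)
          fix k assume "k \<in> {..N}"
          then have "(- 1 :: real) ^ N = (- 1) ^ k * (- 1) ^ (N - k)" by (simp flip: power_add)
          then show "a k * a (N - k) = ((1/2) gchoose k) * ((1/2) gchoose (N - k)) * (- 1) ^ N"
            by (simp add: a_def)
        qed
        also have "\<dots> = (1 gchoose N) * (- 1) ^ N"
          using gbinomial_Vandermonde[of "1/2::real" "1/2" N] by (simp add: atLeast0AtMost flip: sum_distrib_right)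
        finally show ?thesis .
      qed
      also have "(1 gchoose N :: real) = (if N \<le> 1 then 1 else 0)"
      proof (cases "1 < N")
        case True
        have "(1 gchoose N :: real) = of_nat (1 choose N)"
          using binomial_gbinomial[of 1 N, where 'a=real] by simp
        also have "1 choose N = 0" using True by (rule binomial_eq_0)
        finally show ?thesis using True by simp
      next
        case False
        then have "N = 0 \<or> N = 1" by auto
        then show ?thesis by auto
      qed
      finally show ?thesis using A ij by auto
    qed
    ultimately have s: "(\<lambda>N. if N = 0 then (1\<^sub>m n) $$ (i, j) else if N = 1 then - A $$ (i, j) else 0) sums ((B * B) $$ (i, j))"
      by simp
    have "(\<lambda>N. if N = 0 then (1\<^sub>m n) $$ (i, j) else if N = 1 then - A $$ (i, j) else 0) sums
       (\<Sum>N\<in>{0,1::nat}. if N = 0 then (1\<^sub>m n) $$ (i, j) else if N = 1 then - A $$ (i, j) else 0)"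
      by (intro sums_finite) auto
    from sums_unique2[OF s this] show "(B * B) $$ (i, j) = P $$ (i, j)"
      using P ij by (simp add: A_def)
  qed (use B P in auto)
  then show ?thesis using that[OF B Bsym Bpos] by simp
qed

text \<open>With \<open>D = B - C\<close>, equality of the squares gives \<open>B D = - D C\<close>
  even if \<open>B\<close> and \<open>C\<close> do not commute. Hence the traces of
  \<open>D B D\<close> and \<open>D C D\<close>, both nonnegative, add up to zero, and the form of
  \<open>B\<close> vanishes at every column of \<open>D\<close>. Then \<open>B\<close> annihilates
  the column, and injectivity makes it zero.\<close>

lemma psd_sqrt_unique:
  fixes B C :: rmat
  assumes B: "B \<in> carrier_mat n n" "B\<^sup>T = B" "\<And>v. v \<in> carrier_vec n \<Longrightarrow> 0 \<le> v \<bullet> (B *\<^sub>v v)"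
    and C: "C \<in> carrier_mat n n" "C\<^sup>T = C" "\<And>v. v \<in> carrier_vec n \<Longrightarrow> 0 \<le> v \<bullet> (C *\<^sub>v v)"
    and eq: "B * B = C * C"
    and inj: "\<And>v. v \<in> carrier_vec n \<Longrightarrow> B *\<^sub>v v = 0\<^sub>v n \<Longrightarrow> v = 0\<^sub>v n"
  shows "B = C"
proof -
  define D where "D = B - C"
  have D: "D \<in> carrier_mat n n" using minus_carrier_mat[OF C(1)] by (simp add: D_def)
  have Dsym: "D\<^sup>T = D" using B C transpose_minus[of B n n C] by (simp add: D_def)
  have anti: "B * D = - (D * C)"
  proof -
    have "B * D = B * B - B * C" using B C by (simp add: D_def mult_minus_distrib_mat)
    moreover have "D * C = B * C - C * C" using B C by (simp add: D_def minus_mult_distrib_mat)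
    ultimately show ?thesis unfolding eq using B C by (intro eq_matI) auto
  qed
  have c: "col D i \<in> carrier_vec n" for i using D by auto
  have diag: "(D * (X * D)) $$ (i, i) = col D i \<bullet> (X *\<^sub>v col D i)"
    if X: "X \<in> carrier_mat n n" and i: "i < n" for X i
  proof -
    have "(D * (X * D)) $$ (i, i) = row D i \<bullet> col (X * D) i" using D X i by simp
    also have "row D i = col D i" using D i row_transpose[of i D] unfolding Dsym by simp
    also have "col (X * D) i = X *\<^sub>v col D i" using D X i by (intro col_mult2) auto
    finally show ?thesis .
  qed
  have tr: "(\<Sum>i<n. (X * Y) $$ (i, i)) = (\<Sum>i<n. (Y * X) $$ (i, i))"
    if "X \<in> carrier_mat n n" "Y \<in> carrier_mat n n" for X Y :: rmat
  proof -
    have "(\<Sum>i<n. (X * Y) $$ (i, i)) = (\<Sum>i<n. \<Sum>j<n. X $$ (i, j) * Y $$ (j, i))"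
      using that by (simp add: scalar_prod_def atLeast0LessThan)
    also have "\<dots> = (\<Sum>j<n. \<Sum>i<n. Y $$ (j, i) * X $$ (i, j))"
      by (subst sum.swap) (simp add: mult.commute)
    also have "\<dots> = (\<Sum>i<n. (Y * X) $$ (i, i))"
      using that by (simp add: scalar_prod_def atLeast0LessThan)
    finally show ?thesis .
  qed
  have "(\<Sum>i<n. (D * (B * D)) $$ (i, i)) = - (\<Sum>i<n. (D * (C * D)) $$ (i, i))"
  proof -
    have "D * (B * D) = - (D * (D * C))" unfolding anti using D C by (intro eq_matI) auto
    then have "(\<Sum>i<n. (D * (B * D)) $$ (i, i)) = - (\<Sum>i<n. (D * (D * C)) $$ (i, i))"
      using D C by (simp add: sum_negf)
    also have "(\<Sum>i<n. (D * (D * C)) $$ (i, i)) = (\<Sum>i<n. ((D * C) * D) $$ (i, i))"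
      using D C by (intro tr) auto
    also have "(D * C) * D = D * (C * D)" using D C by (intro assoc_mult_mat) auto
    finally show ?thesis .
  qed
  then have "(\<Sum>i<n. col D i \<bullet> (B *\<^sub>v col D i)) = - (\<Sum>i<n. col D i \<bullet> (C *\<^sub>v col D i))"
    using diag B C by simp
  moreover have "0 \<le> (\<Sum>i<n. col D i \<bullet> (C *\<^sub>v col D i))" by (intro sum_nonneg C(3) c)
  moreover have "0 \<le> (\<Sum>i<n. col D i \<bullet> (B *\<^sub>v col D i))" by (intro sum_nonneg B(3) c)
  ultimately have "(\<Sum>i<n. col D i \<bullet> (B *\<^sub>v col D i)) = 0" by simp
  then have z: "col D i \<bullet> (B *\<^sub>v col D i) = 0" if "i < n" for i
    using that sum_nonneg_eq_0_iff[of "{..<n}" "\<lambda>i. col D i \<bullet> (B *\<^sub>v col D i)"] B(3)[OF c] by auto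
  have "col D i = 0\<^sub>v n" if i: "i < n" for i
  proof (rule inj[OF c])
    let ?u = "B *\<^sub>v col D i"
    have u: "?u \<in> carrier_vec n" using B c by auto
    have "(?u \<bullet> ?u)\<^sup>2 \<le> 0"
      using psd_cauchy_schwarz[OF B u c, of i] z[OF i] by simp
    then show "?u = 0\<^sub>v n" using scalar_prod_self_eq_0[OF u] by simp
  qed
  moreover have "D $$ (i, j) = col D j $ i" if "i < n" "j < n" for i j using D that by simp
  ultimately have "D $$ (i, j) = 0" if "i < n" "j < n" for i j using that by simp
  then show ?thesis using B C by (intro eq_matI) (auto simp: D_def)
qed

text \<open>Justifies the definite description. The upper bound on \<open>V\<close> becomes the
  positive lower bound on its inverse under which the series for the root converges; the root is
  injective because its square is invertible.\<close>

lemma inv_sqrt_mat: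
  assumes V: "ge_one n V" and m: "\<And>u. u \<in> carrier_vec n \<Longrightarrow> u \<bullet> (V *\<^sub>v u) \<le> m * (u \<bullet> u)"
  shows "inv_sqrt_mat n V \<in> carrier_mat n n" "(inv_sqrt_mat n V)\<^sup>T = inv_sqrt_mat n V"
    "inv_sqrt_mat n V * inv_sqrt_mat n V = minv V"
proof -
  \<comment> \<open>The maximum with 1 keeps \<open>q = 1 - 1 / m'\<close> in [0, 1).\<close>
  define m' where "m' = max m 1"
  have m': "m' \<ge> 1" "\<And>u. u \<in> carrier_vec n \<Longrightarrow> u \<bullet> (V *\<^sub>v u) \<le> m' * (u \<bullet> u)"
    using m order_trans[OF m mult_right_mono[OF _ scalar_prod_self_nonneg]] by (auto simp: m'_def)
  note W = minv[OF V]
  let ?P = "\<lambda>B. B \<in> carrier_mat n n \<and> B\<^sup>T = B \<and> (\<forall>v \<in> carrier_vec n. 0 \<le> v \<bullet> (B *\<^sub>v v)) \<and> B * B = the (mat_inverse V)"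
  have "(1 - (1 - 1 / m')) * (v \<bullet> v) \<le> v \<bullet> (minv V *\<^sub>v v)" if v: "v \<in> carrier_vec n" for v
    using minv_form(3)[OF V v m'(2)] m'(1) by (simp add: field_simps)
  then obtain B where B: "B \<in> carrier_mat n n" "B\<^sup>T = B" "\<And>v. v \<in> carrier_vec n \<Longrightarrow> 0 \<le> v \<bullet> (B *\<^sub>v v)" "B * B = minv V"
    using psd_sqrt_exists[OF W(1,4), of "1 - 1 / m'"] minv_form(2)[OF V] m'(1) by (auto simp: field_simps)
  have inj: "v = 0\<^sub>v n" if v: "v \<in> carrier_vec n" "B *\<^sub>v v = 0\<^sub>v n" for v
  proof -
    have "minv V *\<^sub>v v = B *\<^sub>v (B *\<^sub>v v)" using B v by (metis assoc_mult_mat_vec)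
    then have "minv V *\<^sub>v v = 0\<^sub>v n" using v B by (auto intro!: eq_vecI)
    then have "V *\<^sub>v 0\<^sub>v n = v" using minv_cancel[OF V v(1)] by simp
    then show ?thesis using V by (auto simp: ge_one_def intro!: eq_vecI)
  qed
  have "?P B" using B by (auto simp: minv_def)
  moreover have "C = B" if "?P C" for C
    using psd_sqrt_unique[OF B(1-3), of C] that inj B(4) by (auto simp: minv_def)
  ultimately have "inv_sqrt_mat n V = B" unfolding inv_sqrt_mat_def by (intro the_equality) blast+
  then show "inv_sqrt_mat n V \<in> carrier_mat n n" "(inv_sqrt_mat n V)\<^sup>T = inv_sqrt_mat n V"
    "inv_sqrt_mat n V * inv_sqrt_mat n V = minv V"
    using B by auto
qed

section \<open>The regularized design matrix\<close>

text \<open>The arithmetic-geometric mean inequality, from the bound \<open>a\<close> \<le>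
  \<open>c * exp (a / c - 1)\<close>, which is tangent at \<open>a = c\<close>: in the product the
  exponents add up to a nonpositive number.\<close>

lemma prod_le_mean_power:
  fixes a :: "nat \<Rightarrow> real" and c :: real
  assumes "\<And>i. i < n \<Longrightarrow> 0 \<le> a i" "(\<Sum>i<n. a i) \<le> n * c" "0 < c"
  shows "(\<Prod>i<n. a i) \<le> c ^ n"
proof -
  have "(\<Prod>i<n. a i) \<le> (\<Prod>i<n. c * exp (a i / c - 1))"
  proof (intro prod_mono conjI)
    fix i
    show "a i \<le> c * exp (a i / c - 1)"
      using exp_ge_add_one_self[of "a i / c - 1"] assms(3) by (simp add: field_simps)
  qed (use assms in auto)
  also have "\<dots> = c ^ n * exp (\<Sum>i<n. a i / c - 1)"
    by (simp add: prod.distrib exp_sum)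
  also have "(\<Sum>i<n. a i / c - 1) = (\<Sum>i<n. a i) / c - n" by (simp add: sum_subtractf sum_divide_distrib)
  finally have le: "(\<Prod>i<n. a i) \<le> c ^ n * exp ((\<Sum>i<n. a i) / c - n)" .
  have "(\<Sum>i<n. a i) / c - n \<le> 0" using assms(2,3) by (simp add: field_simps)
  then have "c ^ n * exp ((\<Sum>i<n. a i) / c - n) \<le> c ^ n * 1"
    using assms(3) by (intro mult_left_mono) auto
  with le show ?thesis by simp
qed

text \<open>The dimension is fixed for the arms of steps 1 to \<open>t\<close> alone: runs and lists
  of past arms both become total functions with arbitrary values beyond.\<close>

locale features =
  fixes d :: nat and x :: "nat \<Rightarrow> rvec" and acts :: "nat \<Rightarrow> nat" and t :: nat
  assumes feat: "\<And>k. k \<in> {1..t} \<Longrightarrow> x (acts k) \<in> carrier_vec d"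
begin

lemma feat_Suc: "k < t \<Longrightarrow> x (acts (Suc k)) \<in> carrier_vec d"
  using feat[of "Suc k"] by auto

lemma feat_mono: "s \<le> t \<Longrightarrow> features d x acts s"
  by unfold_locales (rule feat, auto)

end

lemma gram_carrier [simp]: "gram_mat d x acts t \<in> carrier_mat d d"
  by (induction t) auto

lemma gram_transpose: "(gram_mat d x acts t)\<^sup>T = gram_mat d x acts t"
proof (induction t)
  case (Suc t)
  then show ?case
    unfolding gram_mat.simps transpose_add[OF gram_carrier outer_carrier] outer_transpose by (simp only:)
qed simp

lemma gram_entry:
  "i < d \<Longrightarrow> j < d \<Longrightarrow> gram_mat d x acts t $$ (i, j)
     = (if i = j then 1 else 0) + (\<Sum>k<t. x (acts (Suc k)) $ i * x (acts (Suc k)) $ j)"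
proof (induction t)
  case (Suc t)
  then show ?case using gram_carrier[of d x acts t] by (simp add: outer_def)
qed simp

lemma gram_mult_vec:
  assumes "features d x acts t" "v \<in> carrier_vec d" and that: "s < t"
  shows "gram_mat d x acts (Suc s) *\<^sub>v v
    = gram_mat d x acts s *\<^sub>v v + (x (acts (Suc s)) \<bullet> v) \<cdot>\<^sub>v x (acts (Suc s))"
  using add_mult_distrib_mat_vec[OF gram_carrier outer_carrier assms(2), of x acts s "x (acts (Suc s))"]
    outer_mult_vec[OF features.feat_Suc[OF assms(1) that] assms(2)] by simp

lemma gram_form:
  assumes "features d x acts t" "v \<in> carrier_vec d"
  shows "v \<bullet> (gram_mat d x acts t *\<^sub>v v) = v \<bullet> v + (\<Sum>k<t. (x (acts (Suc k)) \<bullet> v)\<^sup>2)"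
  using assms(1)
proof (induction t)
  case (Suc t)
  interpret features d x acts "Suc t" by fact
  have f: "x (acts (Suc t)) \<in> carrier_vec d" by (rule feat_Suc) simp
  have "v \<bullet> (gram_mat d x acts (Suc t) *\<^sub>v v)
     = v \<bullet> (gram_mat d x acts t *\<^sub>v v) + (x (acts (Suc t)) \<bullet> v) * (v \<bullet> x (acts (Suc t)))"
    unfolding gram_mult_vec[OF Suc.prems assms(2) lessI]
    using f assms(2) mult_mat_vec_carrier[OF gram_carrier assms(2)]
    by (simp add: scalar_prod_add_distrib[of _ d])
  then show ?case using Suc.IH[OF feat_mono] comm_scalar_prod[OF f assms(2)]
    by (simp add: power2_eq_square)
qed (use assms in simp)

lemma ge_one_gram:
  assumes "features d x acts t"
  shows "ge_one d (gram_mat d x acts t)"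
  unfolding ge_one_def using gram_form[OF assms] gram_transpose by (auto intro!: sum_nonneg)

lemma gram_form_le:
  assumes "features d x acts t" "\<And>k. k < t \<Longrightarrow> vnorm (x (acts (Suc k))) \<le> 1" "v \<in> carrier_vec d"
  shows "v \<bullet> (gram_mat d x acts t *\<^sub>v v) \<le> (1 + real t) * (v \<bullet> v)"
proof -
  have "(x (acts (Suc k)) \<bullet> v)\<^sup>2 \<le> v \<bullet> v" if k: "k < t" for k
  proof -
    have "\<bar>x (acts (Suc k)) \<bullet> v\<bar> \<le> vnorm (x (acts (Suc k))) * vnorm v"
      by (rule abs_scalar_prod_le_vnorm[OF features.feat_Suc[OF assms(1) k] assms(3)])
    also have "\<dots> \<le> 1 * vnorm v" using assms(2)[OF k] by (intro mult_right_mono) auto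
    finally have "\<bar>x (acts (Suc k)) \<bullet> v\<bar>\<^sup>2 \<le> (vnorm v)\<^sup>2" by (intro power_mono) auto
    then show ?thesis by (simp only: vnorm_sq power2_abs)
  qed
  then have "(\<Sum>k<t. (x (acts (Suc k)) \<bullet> v)\<^sup>2) \<le> (\<Sum>k<t. v \<bullet> v)" by (intro sum_mono) auto
  then show ?thesis unfolding gram_form[OF assms(1,3)] by (simp add: algebra_simps)
qed

text \<open>The squared norm of \<open>v\<close> in the inverse of the Gram matrix after
  \<open>t\<close> steps. Up to the confidence radius, its square root is the confidence width of
  \<open>v\<close> at step \<open>t + 1\<close>.\<close>

definition width :: "nat \<Rightarrow> (nat \<Rightarrow> rvec) \<Rightarrow> (nat \<Rightarrow> nat) \<Rightarrow> nat \<Rightarrow> rvec \<Rightarrow> real" where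
  "width d x acts t v = v \<bullet> (minv (gram_mat d x acts t) *\<^sub>v v)"

lemma width_bounds:
  assumes "features d x acts t" "v \<in> carrier_vec d"
  shows "0 \<le> width d x acts t v" "width d x acts t v \<le> v \<bullet> v"
  using minv_form[OF ge_one_gram[OF assms(1)] assms(2)] by (auto simp: width_def)

lemma det_gram_Suc:
  assumes "features d x acts (Suc t)"
  shows "Determinant.det (gram_mat d x acts (Suc t))
    = Determinant.det (gram_mat d x acts t) * (1 + width d x acts t (x (acts (Suc t))))"
proof -
  have f: "features d x acts t" using features.feat_mono[OF assms, of t] by simp
  note W = minv[OF ge_one_gram[OF f]]
  show ?thesis unfolding width_def gram_mat.simps
    by (rule det_rank_one_update[OF gram_carrier W(1,2) features.feat_Suc[OF assms lessI]])
qed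

lemma det_gram_pos:
  assumes "features d x acts t"
  shows "0 < Determinant.det (gram_mat d x acts t)"
  using hadamard_ge_one[OF ge_one_gram[OF assms]] by simp

text \<open>Hadamard's inequality leaves the diagonal, whose sum is at most \<open>d + t\<close>
  because the feature vectors have norm at most 1; the product is largest when all entries are
  equal.\<close>

lemma det_gram_le:
  assumes "features d x acts t" "\<And>k. k < t \<Longrightarrow> vnorm (x (acts (Suc k))) \<le> 1" "1 \<le> d"
  shows "Determinant.det (gram_mat d x acts t) \<le> (1 + real t / real d) ^ d"
proof -
  have "Determinant.det (gram_mat d x acts t) \<le> (\<Prod>i<d. gram_mat d x acts t $$ (i, i))"
    using hadamard_ge_one[OF ge_one_gram[OF assms(1)]] by simp
  also have "\<dots> \<le> (1 + real t / real d) ^ d"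
  proof (rule prod_le_mean_power)
    show "0 \<le> gram_mat d x acts t $$ (i, i)" if "i < d" for i
      using gram_entry[OF that that] by (simp add: sum_nonneg)
    have "(\<Sum>i<d. gram_mat d x acts t $$ (i, i)) = (\<Sum>i<d. 1 + (\<Sum>k<t. x (acts (Suc k)) $ i * x (acts (Suc k)) $ i))"
      by (intro sum.cong) (auto simp: gram_entry)
    also have "\<dots> = real d + (\<Sum>k<t. \<Sum>i<d. x (acts (Suc k)) $ i * x (acts (Suc k)) $ i)"
      unfolding sum.distrib by (subst sum.swap) simp
    also have "(\<Sum>k<t. \<Sum>i<d. x (acts (Suc k)) $ i * x (acts (Suc k)) $ i) \<le> (\<Sum>k<t. 1)"
    proof (intro sum_mono)
      fix k assume "k \<in> {..<t}"
      then have k: "k < t" by simp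
      have "(\<Sum>i<d. x (acts (Suc k)) $ i * x (acts (Suc k)) $ i) = (vnorm (x (acts (Suc k))))\<^sup>2"
        unfolding vnorm_sq using carrier_vecD[OF features.feat_Suc[OF assms(1) k]]
        by (simp add: scalar_prod_def atLeast0LessThan)
      also have "\<dots> \<le> 1" using assms(2)[OF k] by (simp add: power_le_one)
      finally show "(\<Sum>i<d. x (acts (Suc k)) $ i * x (acts (Suc k)) $ i) \<le> 1" .
    qed
    finally have "(\<Sum>i<d. gram_mat d x acts t $$ (i, i)) \<le> real d + real t" by simp
    also have "\<dots> = real d * (1 + real t / real d)" using assms(3) by (simp add: field_simps)
    finally show "(\<Sum>i<d. gram_mat d x acts t $$ (i, i)) \<le> real d * (1 + real t / real d)" .
    show "0 < 1 + real t / real d" by (simp add: add_pos_nonneg)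
  qed
  finally show ?thesis .
qed

lemma det_gram_eq_prod:
  assumes "features d x acts t"
  shows "Determinant.det (gram_mat d x acts t) = (\<Prod>k<t. 1 + width d x acts k (x (acts (Suc k))))"
  using assms
proof (induction t)
  case (Suc t)
  then show ?case using det_gram_Suc[OF Suc.prems] features.feat_mono[OF Suc.prems, of t] by simp
qed simp

lemma le_two_ln_one_plus:
  assumes "0 \<le> w" "w \<le> (1 :: real)"
  shows "w \<le> 2 * ln (1 + w)"
proof -
  have "exp (w / 2) \<le> 1 + w / 2 + (w / 2)\<^sup>2" using assms by (intro exp_bound) auto
  also have "\<dots> \<le> 1 + w" using assms mult_left_mono[of w 1 w] by (simp add: power2_eq_square field_simps)
  finally have "ln (exp (w / 2)) \<le> ln (1 + w)" using assms by (subst ln_le_cancel_iff) auto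
  then show ?thesis by simp
qed

text \<open>The factors \<open>1 + width\<close> multiply up to the determinant, so their logarithms
  add up to one that is already bounded. As each width is at most 1, it is comparable to its
  logarithm, and Cauchy-Schwarz over the steps passes to square roots.\<close>

lemma sum_sqrt_width_le:
  assumes "features d x acts t" "\<And>k. k < t \<Longrightarrow> vnorm (x (acts (Suc k))) \<le> 1" "1 \<le> d"
  shows "(\<Sum>k<t. sqrt (width d x acts k (x (acts (Suc k))))) \<le> sqrt (2 * real t * (real d * ln (1 + real t / real d)))"
proof -
  let ?w = "\<lambda>k. width d x acts k (x (acts (Suc k)))"
  have w: "0 \<le> ?w k" "?w k \<le> 1" if k: "k < t" for k
  proof -
    have f: "features d x acts k" using features.feat_mono[OF assms(1)] k by simp
    note c = features.feat_Suc[OF assms(1) k]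
    have "x (acts (Suc k)) \<bullet> x (acts (Suc k)) \<le> 1"
      unfolding vnorm_sq[symmetric] using assms(2)[OF k] by (simp add: power_le_one)
    then show "0 \<le> ?w k" "?w k \<le> 1" using width_bounds[OF f c] by auto
  qed
  have nz: "1 + ?w k \<noteq> 0" if "k < t" for k using w(1)[OF that] by linarith
  have "(\<Sum>k<t. ?w k) \<le> (\<Sum>k<t. 2 * ln (1 + ?w k))"
    using w by (intro sum_mono le_two_ln_one_plus) auto
  also have "\<dots> = 2 * ln (\<Prod>k<t. 1 + ?w k)"
    using nz by (subst ln_prod) (auto simp: sum_distrib_left)
  also have "\<dots> = 2 * ln (Determinant.det (gram_mat d x acts t))" by (simp add: det_gram_eq_prod[OF assms(1)])
  also have "\<dots> \<le> 2 * ln ((1 + real t / real d) ^ d)"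
    using det_gram_le[OF assms] det_gram_pos[OF assms(1)] by simp
  also have "\<dots> = 2 * (real d * ln (1 + real t / real d))"
    by (subst ln_realpow) (auto simp: add_pos_nonneg)
  finally have s: "(\<Sum>k<t. ?w k) \<le> 2 * (real d * ln (1 + real t / real d))" .
  have "(\<Sum>k<t. 1 * sqrt (?w k))\<^sup>2 \<le> (\<Sum>k<t. 1\<^sup>2) * (\<Sum>k<t. (sqrt (?w k))\<^sup>2)"
    by (rule Cauchy_Schwarz_ineq_sum)
  also have "\<dots> = real t * (\<Sum>k<t. ?w k)" using w by (intro arg_cong2[where f="(*)"] sum.cong) auto
  also have "\<dots> \<le> real t * (2 * (real d * ln (1 + real t / real d)))" by (intro mult_left_mono s) auto
  finally have "(\<Sum>k<t. sqrt (?w k))\<^sup>2 \<le> 2 * real t * (real d * ln (1 + real t / real d))" by simp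
  then show ?thesis by (rule real_le_rsqrt)
qed

section \<open>The least squares estimate\<close>

text \<open>With the rewards as weights this is the right-hand side of the normal equations; with
  the noise as weights it is the vector whose norm decides the confidence radius.\<close>

primrec weighted_sum :: "nat \<Rightarrow> (nat \<Rightarrow> rvec) \<Rightarrow> (nat \<Rightarrow> nat) \<Rightarrow> (nat \<Rightarrow> real) \<Rightarrow> nat \<Rightarrow> rvec" where
  "weighted_sum d x acts c 0 = 0\<^sub>v d"
| "weighted_sum d x acts c (Suc t) = weighted_sum d x acts c t + c (Suc t) \<cdot>\<^sub>v x (acts (Suc t))"

lemma weighted_sum_carrier:
  "features d x acts t \<Longrightarrow> weighted_sum d x acts c t \<in> carrier_vec d"
proof (induction t)
  case (Suc t)
  then show ?case using features.feat_Suc[OF Suc.prems] features.feat_mono[OF Suc.prems, of t] by auto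
qed simp

lemma weighted_sum_index:
  "features d x acts t \<Longrightarrow> i < d \<Longrightarrow> weighted_sum d x acts c t $ i = (\<Sum>k<t. c (Suc k) * x (acts (Suc k)) $ i)"
proof (induction t)
  case (Suc t)
  have "features d x acts t" using features.feat_mono[OF Suc.prems(1), of t] by simp
  then show ?case using Suc weighted_sum_carrier[of d x acts t c] carrier_vecD[OF features.feat_Suc[OF Suc.prems(1), of t]]
    by simp
qed simp

lemma theta_hat_eq:
  assumes f: "features d x acts t"
  shows "theta_hat d x acts rew t = minv (gram_mat d x acts t) *\<^sub>v weighted_sum d x acts rew t"
proof -
  let ?X = "design_mat d x acts t"
  have X: "?X \<in> carrier_mat t d" by (simp add: design_mat_def)
  have "?X\<^sup>T * ?X + 1\<^sub>m d = gram_mat d x acts t"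
    using X carrier_matD[OF gram_carrier[of d x acts t]]
    by (intro eq_matI) (auto simp: gram_entry design_mat_def scalar_prod_def atLeast0LessThan)
  moreover have "?X\<^sup>T *\<^sub>v Matrix.vec t (\<lambda>k. rew (Suc k)) = weighted_sum d x acts rew t"
    using X carrier_vecD[OF weighted_sum_carrier[OF f]]
    by (intro eq_vecI) (auto simp: weighted_sum_index[OF f] design_mat_def scalar_prod_def atLeast0LessThan
        intro!: sum.cong)
  ultimately show ?thesis by (simp add: theta_hat_def Let_def minv_def)
qed

lemma abs_minv_form_le:
  assumes "ge_one n V" "u \<in> carrier_vec n" "v \<in> carrier_vec n"
  shows "\<bar>u \<bullet> (minv V *\<^sub>v v)\<bar> \<le> sqrt (u \<bullet> (minv V *\<^sub>v u)) * sqrt (v \<bullet> (minv V *\<^sub>v v))"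
  using real_sqrt_le_mono[OF psd_cauchy_schwarz[OF minv(1,4)[OF assms(1)] minv_form(1)[OF assms(1)] assms(2,3)]]
  by (simp add: real_sqrt_mult)

text \<open>As the Gram matrix contains the identity, the normal equations read X^T Y = V theta -
  theta + S with noise part S, and the error of the estimate is V^-1 S - V^-1 theta. The last term
  is the regularization bias; it has norm at most 1 since \<open>V\<close> is at least the identity,
  and gives the summand 1 of the confidence radius.\<close>

lemma theta_hat_error:
  assumes f: "features d x acts t" and th: "theta \<in> carrier_vec d" "vnorm theta \<le> 1"
    and rew: "\<And>k. k \<in> {1..t} \<Longrightarrow> rew k = theta \<bullet> x (acts k) + noise k"
    and u: "u \<in> carrier_vec d"
  shows "\<bar>u \<bullet> theta_hat d x acts rew t - u \<bullet> theta\<bar>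
    \<le> sqrt (width d x acts t u) * (1 + sqrt (width d x acts t (weighted_sum d x acts noise t)))"
proof -
  let ?V = "gram_mat d x acts t" and ?S = "weighted_sum d x acts noise t"
  note g = ge_one_gram[OF f] and S = weighted_sum_carrier[OF f, of noise]
  note W = minv[OF g]
  have decomp: "weighted_sum d x acts rew s = V' *\<^sub>v theta - theta + weighted_sum d x acts noise s"
    if "s \<le> t" "V' = gram_mat d x acts s" for s V'
    using that
  proof (induction s arbitrary: V')
    case 0
    then show ?case using th by (intro eq_vecI) auto
  next
    case (Suc s)
    have xs: "x (acts (Suc s)) \<in> carrier_vec d" using features.feat_Suc[OF f, of s] Suc by simp
    have fs: "features d x acts s" using features.feat_mono[OF f] Suc by simp
    have r: "rew (Suc s) = x (acts (Suc s)) \<bullet> theta + noise (Suc s)"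
      using rew[of "Suc s"] Suc comm_scalar_prod[OF xs th(1)] by simp
    have IH: "weighted_sum d x acts rew s = gram_mat d x acts s *\<^sub>v theta - theta + weighted_sum d x acts noise s"
      using Suc by simp
    have g: "gram_mat d x acts s *\<^sub>v theta \<in> carrier_vec d" using th by (metis gram_carrier mult_mat_vec_carrier)
    show ?case
      unfolding Suc.prems(2) gram_mult_vec[OF f th(1) Suc_le_lessD[OF Suc.prems(1)]] weighted_sum.simps IH r
      using xs th g weighted_sum_carrier[OF fs, of noise]
      by (intro eq_vecI) (auto simp: algebra_simps)
  qed
  have "theta_hat d x acts rew t = minv ?V *\<^sub>v (?V *\<^sub>v theta - theta + ?S)"
    unfolding theta_hat_eq[OF f] decomp[OF order_refl refl] ..
  also have "\<dots> = theta - minv ?V *\<^sub>v theta + minv ?V *\<^sub>v ?S"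
  proof -
    have Vt: "?V *\<^sub>v theta \<in> carrier_vec d" using th by (metis gram_carrier mult_mat_vec_carrier)
    show ?thesis
      using mult_add_distrib_mat_vec[OF W(1) minus_carrier_vec[OF Vt th(1)] S]
        mult_minus_distrib_mat_vec[OF W(1) Vt th(1)] minv_cancel(2)[OF g th(1)] by simp
  qed
  finally have "u \<bullet> theta_hat d x acts rew t = u \<bullet> theta - u \<bullet> (minv ?V *\<^sub>v theta) + u \<bullet> (minv ?V *\<^sub>v ?S)"
    using u th S W(1)
    by (simp add: scalar_prod_add_distrib[of _ d] scalar_prod_minus_distrib[of _ d])
  then have "\<bar>u \<bullet> theta_hat d x acts rew t - u \<bullet> theta\<bar> \<le> \<bar>u \<bullet> (minv ?V *\<^sub>v theta)\<bar> + \<bar>u \<bullet> (minv ?V *\<^sub>v ?S)\<bar>"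
    by linarith
  also have "\<dots> \<le> sqrt (width d x acts t u) * sqrt (width d x acts t theta)
      + sqrt (width d x acts t u) * sqrt (width d x acts t ?S)"
    unfolding width_def by (intro add_mono abs_minv_form_le[OF g u] th S)
  also have "\<dots> \<le> sqrt (width d x acts t u) * 1 + sqrt (width d x acts t u) * sqrt (width d x acts t ?S)"
  proof -
    have "sqrt (width d x acts t theta) \<le> sqrt (theta \<bullet> theta)" using width_bounds(2)[OF f th(1)] by simp
    then have "sqrt (width d x acts t theta) \<le> 1" using th(2) unfolding vnorm_def by linarith
    then show ?thesis using width_bounds(1)[OF f u] by (intro add_mono mult_left_mono) auto
  qed
  finally show ?thesis by (simp add: algebra_simps)
qed

text \<open>A Sherman-Morrison update: the new solution is sought as the old one plus a multiple of
  \<open>minv V x\<close> and verified by multiplication with the new matrix. The increment is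
  exactly twice the exponent in \<open>nn_integral_gaussian_mixture\<close>.\<close>

lemma width_weighted_sum_Suc:
  fixes c :: "nat \<Rightarrow> real"
  assumes f: "features d x acts (Suc t)"
  defines "y \<equiv> x (acts (Suc t)) \<bullet> (minv (gram_mat d x acts t) *\<^sub>v weighted_sum d x acts c t)"
    and "w \<equiv> width d x acts t (x (acts (Suc t)))"
  shows "width d x acts (Suc t) (weighted_sum d x acts c (Suc t))
    = width d x acts t (weighted_sum d x acts c t) + (2 * c (Suc t) * y + (c (Suc t))\<^sup>2 * w - y\<^sup>2) / (1 + w)"
proof -
  let ?V = "gram_mat d x acts t" and ?V' = "gram_mat d x acts (Suc t)"
  let ?S = "weighted_sum d x acts c t" and ?S' = "weighted_sum d x acts c (Suc t)" and ?x = "x (acts (Suc t))"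
  define e where "e = c (Suc t)"
  have ft: "features d x acts t" using features.feat_mono[OF f, of t] by simp
  note g = ge_one_gram[OF ft] and g' = ge_one_gram[OF f]
  note W = minv[OF g] and S = weighted_sum_carrier[OF ft, of c]
  have xc: "?x \<in> carrier_vec d" using features.feat_Suc[OF f] by simp
  have w0: "0 \<le> w" using width_bounds[OF ft xc] by (simp add: w_def)
  \<comment> \<open>Dictated by the equation for the new solution: the new matrix maps
    \<open>z\<close> to \<open>?S\<close> plus \<open>k + y + k * w\<close> times the new feature
    vector, and this coefficient has to be \<open>e\<close>.\<close>
  define k where "k = (e - y) / (1 + w)"
  have k1: "k * (1 + w) = e - y" using w0 by (simp add: k_def)
  define z where "z = minv ?V *\<^sub>v ?S + k \<cdot>\<^sub>v (minv ?V *\<^sub>v ?x)"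
  have c1: "minv ?V *\<^sub>v ?S \<in> carrier_vec d" "minv ?V *\<^sub>v ?x \<in> carrier_vec d" using W(1) S xc by auto
  have z: "z \<in> carrier_vec d" using c1 by (simp add: z_def)
  have xz: "?x \<bullet> z = y + k * w"
    using c1 xc by (simp add: z_def y_def w_def width_def scalar_prod_add_distrib[of _ d])
  have "?V *\<^sub>v z = ?S + k \<cdot>\<^sub>v ?x"
    unfolding z_def using mult_add_distrib_mat_vec[OF gram_carrier c1(1) smult_carrier_vec[THEN iffD2, OF c1(2)], of x acts t k]
      mult_mat_vec[OF gram_carrier c1(2), of x acts t k] minv_cancel(1)[OF g S] minv_cancel(1)[OF g xc] by simp
  then have "?V' *\<^sub>v z = ?S + k \<cdot>\<^sub>v ?x + (y + k * w) \<cdot>\<^sub>v ?x"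
    unfolding gram_mult_vec[OF f z lessI] xz by simp
  also have "\<dots> = ?S + (k + y + k * w) \<cdot>\<^sub>v ?x"
    using S xc by (intro eq_vecI) (auto simp: algebra_simps)
  also have "k + y + k * w = e" using k1 by (simp add: algebra_simps)
  finally have "?V' *\<^sub>v z = ?S'" by (simp add: e_def)
  then have "minv ?V' *\<^sub>v ?S' = z" using minv_cancel(2)[OF g' z] by metis
  then have "width d x acts (Suc t) ?S' = (?S + e \<cdot>\<^sub>v ?x) \<bullet> z" by (simp add: width_def e_def)
  also have "\<dots> = ?S \<bullet> z + e * (y + k * w)"
    using S xc z xz by (simp add: add_scalar_prod_distrib[of _ d])
  also have "?S \<bullet> z = width d x acts t ?S + k * (?S \<bullet> (minv ?V *\<^sub>v ?x))"
    using S c1 by (simp add: z_def width_def scalar_prod_add_distrib[of _ d])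
  also have "?S \<bullet> (minv ?V *\<^sub>v ?x) = y" unfolding y_def by (rule sym_form_commute[OF W(1,4) S xc])
  also have "width d x acts t ?S + k * y + e * (y + k * w) = width d x acts t ?S + (2 * e * y + e\<^sup>2 * w - y\<^sup>2) / (1 + w)"
  proof -
    have "(k * y + e * (y + k * w)) * (1 + w) = (k * (1 + w)) * (y + e * w) + e * y * (1 + w)"
      by (simp add: algebra_simps)
    also have "\<dots> = 2 * e * y + e\<^sup>2 * w - y\<^sup>2" unfolding k1 by (simp add: algebra_simps power2_eq_square)
    finally have "k * y + e * (y + k * w) = (2 * e * y + e\<^sup>2 * w - y\<^sup>2) / (1 + w)"
      using w0 by (simp add: eq_divide_eq)
    then show ?thesis by simp
  qed
  finally show ?thesis by (simp add: e_def)
qed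

section \<open>Exponential supermartingales\<close>

text \<open>In the application \<open>y + sqrt v * z\<close> is the inner product of the direction
  played with a Gaussian exponent vector whose posterior mean is V^-1 S and whose posterior
  covariance is V^-1.\<close>

lemma nn_integral_gaussian_mixture:
  fixes e y v :: real
  assumes "0 \<le> v"
  shows "(\<integral>\<^sup>+ z. ennreal (normal_density 0 1 z) * ennreal (exp (e * (y + sqrt v * z) - (y + sqrt v * z)\<^sup>2 / 2)) \<partial>lborel)
    = ennreal (exp ((2 * e * y + e\<^sup>2 * v - y\<^sup>2) / (2 * (1 + v))) / sqrt (1 + v))"
proof -
  define s where "s = sqrt v"
  have v: "v = s\<^sup>2" using assms by (simp add: s_def)
  \<comment> \<open>Completing the square in \<open>z\<close>: the integrand is a constant times the
    normal density with variance \<open>1 / (1 + v)\<close> and mean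
    \<open>s * (e - y) / (1 + v)\<close>.\<close>
  define sg where "sg = 1 / sqrt (1 + v)"
  define mu where "mu = s * (e - y) / (1 + v)"
  define C where "C = exp ((2 * e * y + e\<^sup>2 * v - y\<^sup>2) / (2 * (1 + v))) / sqrt (1 + v)"
  have v1: "1 + v > 0" using assms by simp
  have sg: "sg > 0" "sg\<^sup>2 = 1 / (1 + v)" using assms by (auto simp: sg_def power_divide)
  have eq: "normal_density 0 1 z * exp (e * (y + s * z) - (y + s * z)\<^sup>2 / 2) = C * normal_density mu sg z" for z
  proof -
    have ex: "- (z\<^sup>2) / 2 + (e * (y + s * z) - (y + s * z)\<^sup>2 / 2)
       = (2 * e * y + e\<^sup>2 * v - y\<^sup>2) / (2 * (1 + v)) + - ((z - mu)\<^sup>2) / (2 * sg\<^sup>2)"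
    proof -
      have m: "mu * (1 + v) = s * (e - y)" using v1 by (simp add: mu_def)
      have "(2 * e * y + e\<^sup>2 * v - y\<^sup>2) / (2 * (1 + v)) + - ((z - mu)\<^sup>2) / (2 * sg\<^sup>2)
        = (2 * e * y + e\<^sup>2 * v - y\<^sup>2 - (z * (1 + v) - mu * (1 + v))\<^sup>2) / (2 * (1 + v))"
      proof -
        have "- ((z - mu)\<^sup>2) / (2 * sg\<^sup>2) = - (((z - mu) * (1 + v))\<^sup>2) / (2 * (1 + v))"
        proof -
          have "- (c\<^sup>2) / (2 * (1 / w)) = - ((c * w)\<^sup>2) / (2 * w)" if "0 < w" for c w :: real
            using that by (simp add: field_simps power2_eq_square)
          then show ?thesis unfolding sg(2) using v1 by blast
        qed
        then show ?thesis unfolding left_diff_distrib[symmetric] by (simp add: diff_divide_distrib)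
      qed
      also have "\<dots> = (- (z\<^sup>2) / 2 + (e * (y + s * z) - (y + s * z)\<^sup>2 / 2)) * (2 * (1 + v)) / (2 * (1 + v))"
        unfolding m by (rule arg_cong2[where f="(/)"]) (simp_all add: v field_simps power2_eq_square)
      finally show ?thesis using v1 by simp
    qed
    have "normal_density 0 1 z * exp (e * (y + s * z) - (y + s * z)\<^sup>2 / 2)
       = 1 / sqrt (2 * pi) * exp (- (z\<^sup>2) / 2 + (e * (y + s * z) - (y + s * z)\<^sup>2 / 2))"
      by (simp add: normal_density_def exp_add[symmetric])
    also have "\<dots> = C * normal_density mu sg z"
      unfolding ex exp_add C_def normal_density_def sg(2) using v1
      by (simp add: real_sqrt_mult real_sqrt_divide field_simps)
    finally show ?thesis .
  qed
  have "(\<integral>\<^sup>+ z. ennreal (normal_density 0 1 z) * ennreal (exp (e * (y + s * z) - (y + s * z)\<^sup>2 / 2)) \<partial>lborel)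
     = (\<integral>\<^sup>+ z. ennreal C * ennreal (normal_density mu sg z) \<partial>lborel)"
    by (intro nn_integral_cong) (simp add: ennreal_mult'[symmetric] ennreal_mult''[symmetric] eq C_def)
  also have "\<dots> = ennreal C * (\<integral>\<^sup>+ z. ennreal (normal_density mu sg z) \<partial>lborel)"
    by (rule nn_integral_cmult) simp
  also have "(\<integral>\<^sup>+ z. ennreal (normal_density mu sg z) \<partial>lborel) = 1"
    using sg(1) by (subst nn_integral_eq_integral) auto
  finally show ?thesis by (simp add: s_def C_def)
qed

text \<open>The sub-Gaussian bound comes with a null set for each constant \<alpha>, whereas the
  exponent \<open>G\<close> is random. Rounding \<open>G\<close> down to multiples of
  \<open>1 / (n + 1)\<close> leaves countably many values, each taken on an event of
  \<open>F\<close> where the constant case applies; Fatou's lemma removes the rounding.\<close>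

lemma nn_integral_subgaussian_random_exponent:
  fixes e G :: "'w \<Rightarrow> real"
  assumes "prob_space M" and sub: "subalgebra M F"
    and e: "e \<in> borel_measurable M"
    and sg: "\<And>\<alpha>. AE \<omega> in M. nn_cond_exp M F (\<lambda>\<omega>. ennreal (exp (\<alpha> * e \<omega>))) \<omega> \<le> ennreal (exp (\<alpha>\<^sup>2 / 2))"
    and Z: "Z \<in> borel_measurable F" and G: "G \<in> borel_measurable F"
  shows "(\<integral>\<^sup>+ \<omega>. Z \<omega> * ennreal (exp (e \<omega> * G \<omega> - (G \<omega>)\<^sup>2 / 2)) \<partial>M) \<le> (\<integral>\<^sup>+ \<omega>. Z \<omega> \<partial>M)"
proof -
  interpret prob_space M by fact
  interpret F: sigma_finite_subalgebra M F
  proof -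
    have "sigma_finite_measure (restr_to_subalg M F)"
      by (intro finite_measure.sigma_finite_measure finite_measure_restr_to_subalg sub) unfold_locales
    then show "sigma_finite_subalgebra M F" using sub by (simp add: sigma_finite_subalgebra_def)
  qed
  have fm: "f \<in> borel_measurable M" if "f \<in> borel_measurable F" for f :: "'w \<Rightarrow> 'c::topological_space"
    using measurable_from_subalg[OF sub that] .
  note [measurable] = e
  have det: "(\<integral>\<^sup>+ \<omega>. U \<omega> * ennreal (exp (e \<omega> * \<alpha> - \<alpha>\<^sup>2 / 2)) \<partial>M) \<le> (\<integral>\<^sup>+ \<omega>. U \<omega> \<partial>M)"
    if U: "U \<in> borel_measurable F" for U \<alpha>
  proof -
    have UM: "U \<in> borel_measurable M" by (rule fm[OF U])
    have "(\<integral>\<^sup>+ \<omega>. U \<omega> * ennreal (exp (e \<omega> * \<alpha> - \<alpha>\<^sup>2 / 2)) \<partial>M)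
      = (\<integral>\<^sup>+ \<omega>. (U \<omega> * ennreal (exp (- (\<alpha>\<^sup>2 / 2)))) * ennreal (exp (\<alpha> * e \<omega>)) \<partial>M)"
    proof (intro nn_integral_cong)
      fix \<omega>
      have "ennreal (exp (e \<omega> * \<alpha> - \<alpha>\<^sup>2 / 2)) = ennreal (exp (- (\<alpha>\<^sup>2 / 2))) * ennreal (exp (\<alpha> * e \<omega>))"
        by (simp add: ennreal_mult'[symmetric] exp_add[symmetric] mult.commute)
      then show "U \<omega> * ennreal (exp (e \<omega> * \<alpha> - \<alpha>\<^sup>2 / 2))
        = (U \<omega> * ennreal (exp (- (\<alpha>\<^sup>2 / 2)))) * ennreal (exp (\<alpha> * e \<omega>))" by (simp add: mult.assoc)
    qed
    also have "\<dots> = (\<integral>\<^sup>+ \<omega>. (U \<omega> * ennreal (exp (- (\<alpha>\<^sup>2 / 2)))) * nn_cond_exp M F (\<lambda>\<omega>. ennreal (exp (\<alpha> * e \<omega>))) \<omega> \<partial>M)"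
      using U e by (intro F.nn_cond_exp_intg[symmetric]) auto
    also have "\<dots> \<le> (\<integral>\<^sup>+ \<omega>. (U \<omega> * ennreal (exp (- (\<alpha>\<^sup>2 / 2)))) * ennreal (exp (\<alpha>\<^sup>2 / 2)) \<partial>M)"
      using sg[of \<alpha>] by (intro nn_integral_mono_AE) (elim eventually_mono, intro mult_left_mono, auto)
    also have "\<dots> = (\<integral>\<^sup>+ \<omega>. U \<omega> \<partial>M)"
      by (intro nn_integral_cong) (simp add: mult.assoc ennreal_mult'[symmetric] exp_add[symmetric])
    finally show ?thesis .
  qed
  define Gn where "Gn n \<omega> = of_int \<lfloor>real (Suc n) * G \<omega>\<rfloor> / real (Suc n)" for n \<omega>
  have Gn: "Gn n \<in> borel_measurable F" for n
    unfolding Gn_def using G by measurable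
  have lim: "(\<lambda>n. Gn n \<omega>) \<longlonglongrightarrow> G \<omega>" for \<omega>
  proof (rule LIMSEQ_I)
    fix r :: real assume "0 < r"
    then obtain N where N: "inverse (real (Suc N)) < r" using reals_Archimedean by blast
    have "norm (Gn n \<omega> - G \<omega>) < r" if "n \<ge> N" for n
    proof -
      have "\<bar>of_int \<lfloor>real (Suc n) * G \<omega>\<rfloor> - real (Suc n) * G \<omega>\<bar> \<le> 1" by linarith
      then have "\<bar>(of_int \<lfloor>real (Suc n) * G \<omega>\<rfloor> - real (Suc n) * G \<omega>) / real (Suc n)\<bar> \<le> inverse (real (Suc n))"
        using divide_right_mono[of _ 1 "real (Suc n)"] by (simp add: abs_divide inverse_eq_divide del: of_nat_Suc)
      moreover have "(of_int \<lfloor>real (Suc n) * G \<omega>\<rfloor> - real (Suc n) * G \<omega>) / real (Suc n) = Gn n \<omega> - G \<omega>"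
        by (simp add: Gn_def diff_divide_distrib)
      moreover have "inverse (real (Suc n)) \<le> inverse (real (Suc N))" using that by (simp add: field_simps)
      ultimately show ?thesis using N unfolding real_norm_def by (metis order_le_less_trans order_trans)
    qed
    then show "\<exists>N. \<forall>n\<ge>N. norm (Gn n \<omega> - G \<omega>) < r" by blast
  qed
  have step: "(\<integral>\<^sup>+ \<omega>. Z \<omega> * ennreal (exp (e \<omega> * Gn n \<omega> - (Gn n \<omega>)\<^sup>2 / 2)) \<partial>M) \<le> (\<integral>\<^sup>+ \<omega>. Z \<omega> \<partial>M)" for n
  proof -
    \<comment> \<open>\<open>int_decode\<close> enumerates the possible numerators by natural
      numbers, so that the splitting over level sets is an ordinary series.\<close>
    define q where "q m = of_int (int_decode m) / real (Suc n)" for m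
    define Am where "Am m = {\<omega>. \<lfloor>real (Suc n) * G \<omega>\<rfloor> = int_decode m}" for m
    have disj: "disjoint_family Am"
      by (auto simp: disjoint_family_on_def Am_def int_decode_eq)
    have mem: "\<omega> \<in> Am (int_encode \<lfloor>real (Suc n) * G \<omega>\<rfloor>)" for \<omega> by (simp add: Am_def)
    have ind: "(\<lambda>\<omega>. indicator (Am m) \<omega> :: ennreal) \<in> borel_measurable F" for m
    proof -
      have "(\<lambda>\<omega>. if \<lfloor>real (Suc n) * G \<omega>\<rfloor> = int_decode m then 1 else 0 :: ennreal) \<in> borel_measurable F"
        using G by measurable
      then show ?thesis unfolding indicator_def of_bool_def Am_def mem_Collect_eq .
    qed
    have "(\<integral>\<^sup>+ \<omega>. Z \<omega> * ennreal (exp (e \<omega> * Gn n \<omega> - (Gn n \<omega>)\<^sup>2 / 2)) \<partial>M)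
      = (\<integral>\<^sup>+ \<omega>. (\<Sum>m. (Z \<omega> * ennreal (exp (e \<omega> * q m - (q m)\<^sup>2 / 2))) * indicator (Am m) \<omega>) \<partial>M)"
    proof (intro nn_integral_cong)
      fix \<omega>
      show "Z \<omega> * ennreal (exp (e \<omega> * Gn n \<omega> - (Gn n \<omega>)\<^sup>2 / 2))
        = (\<Sum>m. (Z \<omega> * ennreal (exp (e \<omega> * q m - (q m)\<^sup>2 / 2))) * indicator (Am m) \<omega>)"
        by (subst suminf_cmult_indicator[OF disj mem]) (simp add: q_def Gn_def)
    qed
    also have "\<dots> = (\<Sum>m. \<integral>\<^sup>+ \<omega>. (Z \<omega> * ennreal (exp (e \<omega> * q m - (q m)\<^sup>2 / 2))) * indicator (Am m) \<omega> \<partial>M)"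
      using fm[OF Z] fm[OF ind] by (intro nn_integral_suminf) auto
    also have "\<dots> = (\<Sum>m. \<integral>\<^sup>+ \<omega>. (Z \<omega> * indicator (Am m) \<omega>) * ennreal (exp (e \<omega> * q m - (q m)\<^sup>2 / 2)) \<partial>M)"
      by (simp add: ac_simps)
    also have "\<dots> \<le> (\<Sum>m. \<integral>\<^sup>+ \<omega>. Z \<omega> * indicator (Am m) \<omega> \<partial>M)"
      using Z ind by (intro suminf_le det) auto
    also have "\<dots> = (\<integral>\<^sup>+ \<omega>. (\<Sum>m. Z \<omega> * indicator (Am m) \<omega>) \<partial>M)"
      using fm[OF Z] fm[OF ind] by (intro nn_integral_suminf[symmetric]) auto
    also have "\<dots> = (\<integral>\<^sup>+ \<omega>. Z \<omega> \<partial>M)"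
      by (intro nn_integral_cong) (subst suminf_cmult_indicator[OF disj mem], simp)
    finally show ?thesis .
  qed
  have "(\<integral>\<^sup>+ \<omega>. Z \<omega> * ennreal (exp (e \<omega> * G \<omega> - (G \<omega>)\<^sup>2 / 2)) \<partial>M)
    = (\<integral>\<^sup>+ \<omega>. liminf (\<lambda>n. Z \<omega> * ennreal (exp (e \<omega> * Gn n \<omega> - (Gn n \<omega>)\<^sup>2 / 2))) \<partial>M)"
  proof (intro nn_integral_cong)
    fix \<omega>
    have "(\<lambda>n. Z \<omega> * ennreal (exp (e \<omega> * Gn n \<omega> - (Gn n \<omega>)\<^sup>2 / 2))) \<longlonglongrightarrow> Z \<omega> * ennreal (exp (e \<omega> * G \<omega> - (G \<omega>)\<^sup>2 / 2))"
      by (intro tendsto_mult_ennreal tendsto_const tendsto_ennrealI tendsto_intros lim) auto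
    from lim_imp_Liminf[OF _ this] show "Z \<omega> * ennreal (exp (e \<omega> * G \<omega> - (G \<omega>)\<^sup>2 / 2))
      = liminf (\<lambda>n. Z \<omega> * ennreal (exp (e \<omega> * Gn n \<omega> - (Gn n \<omega>)\<^sup>2 / 2)))" by simp
  qed
  also have "\<dots> \<le> liminf (\<lambda>n. \<integral>\<^sup>+ \<omega>. Z \<omega> * ennreal (exp (e \<omega> * Gn n \<omega> - (Gn n \<omega>)\<^sup>2 / 2)) \<partial>M)"
    using fm[OF Z] fm[OF Gn] by (intro nn_integral_liminf) auto
  also have "\<dots> \<le> (\<integral>\<^sup>+ \<omega>. Z \<omega> \<partial>M)"
    using step by (intro order_trans[OF Liminf_le_Limsup Limsup_bounded]) (auto intro!: always_eventually)
  finally show ?thesis .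
qed

text \<open>One step of the method of mixtures: the conjugate Gaussian prior is integrated out in the
  single direction played, so no multivariate integral is needed.\<close>

lemma nn_integral_mixture_step:
  fixes e y v :: "'w \<Rightarrow> real"
  assumes "prob_space M" and sub: "subalgebra M F"
    and e: "e \<in> borel_measurable M"
    and sg: "\<And>\<alpha>. AE \<omega> in M. nn_cond_exp M F (\<lambda>\<omega>. ennreal (exp (\<alpha> * e \<omega>))) \<omega> \<le> ennreal (exp (\<alpha>\<^sup>2 / 2))"
    and Z: "Z \<in> borel_measurable F" and y: "y \<in> borel_measurable F" and v: "v \<in> borel_measurable F"
    and v0: "\<And>\<omega>. \<omega> \<in> space M \<Longrightarrow> 0 \<le> v \<omega>"
  shows "(\<integral>\<^sup>+ \<omega>. Z \<omega> * ennreal (exp ((2 * e \<omega> * y \<omega> + (e \<omega>)\<^sup>2 * v \<omega> - (y \<omega>)\<^sup>2) / (2 * (1 + v \<omega>))) / sqrt (1 + v \<omega>)) \<partial>M)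
    \<le> (\<integral>\<^sup>+ \<omega>. Z \<omega> \<partial>M)"
proof -
  interpret prob_space M by fact
  interpret P: pair_sigma_finite lborel M
    unfolding pair_sigma_finite_def by (auto simp: sigma_finite_lborel) unfold_locales
  have ZM[measurable]: "Z \<in> borel_measurable M" and yM[measurable]: "y \<in> borel_measurable M"
    and vM[measurable]: "v \<in> borel_measurable M" and eM[measurable]: "e \<in> borel_measurable M"
    using measurable_from_subalg[OF sub] Z y v e by auto
  let ?f = "\<lambda>z \<omega>. Z \<omega> * (ennreal (normal_density 0 1 z) * ennreal (exp (e \<omega> * (y \<omega> + sqrt (v \<omega>) * z) - (y \<omega> + sqrt (v \<omega>) * z)\<^sup>2 / 2)))"
  have "(\<integral>\<^sup>+ \<omega>. Z \<omega> * ennreal (exp ((2 * e \<omega> * y \<omega> + (e \<omega>)\<^sup>2 * v \<omega> - (y \<omega>)\<^sup>2) / (2 * (1 + v \<omega>))) / sqrt (1 + v \<omega>)) \<partial>M)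
    = (\<integral>\<^sup>+ \<omega>. \<integral>\<^sup>+ z. ?f z \<omega> \<partial>lborel \<partial>M)"
    using v0 by (intro nn_integral_cong) (simp add: nn_integral_cmult nn_integral_gaussian_mixture)
  \<comment> \<open>After the exchange \<open>z\<close> is a constant, and the exponent
    \<open>y + sqrt v * z\<close> is measurable in \<open>F\<close>, as the bound for random
    exponents demands.\<close>
  also have "\<dots> = (\<integral>\<^sup>+ z. \<integral>\<^sup>+ \<omega>. ?f z \<omega> \<partial>M \<partial>lborel)"
    by (rule P.Fubini') measurable
  also have "\<dots> \<le> (\<integral>\<^sup>+ z. ennreal (normal_density 0 1 z) * (\<integral>\<^sup>+ \<omega>. Z \<omega> \<partial>M) \<partial>lborel)"
  proof (intro nn_integral_mono)
    fix z :: real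
    have "(\<integral>\<^sup>+ \<omega>. ?f z \<omega> \<partial>M) = ennreal (normal_density 0 1 z) *
       (\<integral>\<^sup>+ \<omega>. Z \<omega> * ennreal (exp (e \<omega> * (y \<omega> + sqrt (v \<omega>) * z) - (y \<omega> + sqrt (v \<omega>) * z)\<^sup>2 / 2)) \<partial>M)"
      by (subst nn_integral_cmult[symmetric]) (auto simp: ac_simps)
    also have "\<dots> \<le> ennreal (normal_density 0 1 z) * (\<integral>\<^sup>+ \<omega>. Z \<omega> \<partial>M)"
      using y v by (intro mult_left_mono nn_integral_subgaussian_random_exponent[OF assms(1) sub e sg Z]) auto
    finally show "(\<integral>\<^sup>+ \<omega>. ?f z \<omega> \<partial>M) \<le> ennreal (normal_density 0 1 z) * (\<integral>\<^sup>+ \<omega>. Z \<omega> \<partial>M)" .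
  qed
  also have "\<dots> = (\<integral>\<^sup>+ z. ennreal (normal_density 0 1 z) \<partial>lborel) * (\<integral>\<^sup>+ \<omega>. Z \<omega> \<partial>M)"
    by (rule nn_integral_multc) simp
  also have "(\<integral>\<^sup>+ z. ennreal (normal_density 0 1 z) \<partial>lborel) = 1"
    by (subst nn_integral_eq_integral) auto
  finally show ?thesis by simp
qed

text \<open>The hypothesis says that, restricted to \<open>F\<close>, the measure with density
  \<open>indicator N\<close> is at most \<open>c\<close> times \<open>M\<close>, and integrals are
  monotone in the measure. No conditional expectation is formed.\<close>

lemma nn_integral_indicator_le:
  assumes sub: "subalgebra M F" and N: "N \<in> sets M" and U: "U \<in> borel_measurable F"
    and le: "\<And>B. B \<in> sets F \<Longrightarrow> emeasure M (B \<inter> N) \<le> c * emeasure M B"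
  shows "(\<integral>\<^sup>+ \<omega>. U \<omega> * indicator N \<omega> \<partial>M) \<le> c * (\<integral>\<^sup>+ \<omega>. U \<omega> \<partial>M)"
proof -
  let ?D = "density M (indicator N)"
  have subD: "subalgebra ?D F" using sub by (simp add: subalgebra_def)
  have UM: "U \<in> borel_measurable M" by (rule measurable_from_subalg[OF sub U])
  have "(\<integral>\<^sup>+ \<omega>. U \<omega> * indicator N \<omega> \<partial>M) = (\<integral>\<^sup>+ \<omega>. U \<omega> \<partial>?D)"
    using UM N by (subst nn_integral_density) (auto simp: mult.commute)
  also have "\<dots> = (\<integral>\<^sup>+ \<omega>. U \<omega> \<partial>(restr_to_subalg ?D F))"
    by (rule nn_integral_subalgebra2[OF subD U, symmetric])
  also have "\<dots> \<le> (\<integral>\<^sup>+ \<omega>. U \<omega> \<partial>(scale_measure c (restr_to_subalg M F)))"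
  proof (rule nn_integral_mono_measure)
    show s: "sets (restr_to_subalg ?D F) = sets (scale_measure c (restr_to_subalg M F))"
      by (simp add: sets_restr_to_subalg[OF sub] sets_restr_to_subalg[OF subD])
    show "restr_to_subalg ?D F \<le> scale_measure c (restr_to_subalg M F)"
      unfolding le_measure[OF s]
    proof
      fix B assume "B \<in> sets (restr_to_subalg ?D F)"
      then have B: "B \<in> sets F" by (simp add: sets_restr_to_subalg[OF subD])
      then have BM: "B \<in> sets M" using sub by (auto simp: subalgebra_def)
      have "emeasure ?D B = emeasure M (B \<inter> N)"
        using BM N by (subst emeasure_density) (auto simp: indicator_inter_arith[symmetric] Int_commute)
      then show "emeasure (restr_to_subalg ?D F) B \<le> emeasure (scale_measure c (restr_to_subalg M F)) B"
        using le[OF B] by (simp add: emeasure_restr_to_subalg[OF subD B] emeasure_restr_to_subalg[OF sub B])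
    qed
  qed
  also have "\<dots> = c * (\<integral>\<^sup>+ \<omega>. U \<omega> \<partial>(restr_to_subalg M F))"
    using U by (intro nn_integral_scale_measure measurable_in_subalg[OF sub])
  also have "(\<integral>\<^sup>+ \<omega>. U \<omega> \<partial>(restr_to_subalg M F)) = (\<integral>\<^sup>+ \<omega>. U \<omega> \<partial>M)"
    by (rule nn_integral_subalgebra2[OF sub U])
  finally show ?thesis .
qed

text \<open>If \<open>Ev\<close> has conditional probability at least \<open>q\<close>, the part of \<open>\<Sum> \<Delta>\<close> seen when \<open>Ev\<close>
  happens controls the full sum.\<close>

lemma nn_integral_sampled_step:
  fixes \<Delta> :: "'w \<Rightarrow> real"
  assumes sub: "subalgebra M F" and Ev: "Ev \<in> sets M" and q: "0 \<le> q" "q \<le> 1"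
    and le: "\<And>B. B \<in> sets F \<Longrightarrow> emeasure M (B \<inter> (space M - Ev)) \<le> ennreal (1 - q) * emeasure M B"
    and Z: "Z \<in> borel_measurable F" and D: "\<Delta> \<in> borel_measurable F"
    and D01: "\<And>\<omega>. \<omega> \<in> space M \<Longrightarrow> 0 \<le> \<Delta> \<omega> \<and> \<Delta> \<omega> \<le> 1"
  shows "(\<integral>\<^sup>+ \<omega>. Z \<omega> * ennreal (exp (q / 2 * \<Delta> \<omega> - indicator Ev \<omega> * \<Delta> \<omega>)) \<partial>M) \<le> (\<integral>\<^sup>+ \<omega>. Z \<omega> \<partial>M)"
proof -
  define Y where "Y \<omega> = Z \<omega> * ennreal (exp (q / 2 * \<Delta> \<omega>))" for \<omega>
  have Y: "Y \<in> borel_measurable F" unfolding Y_def using Z D by measurable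
  let ?N = "space M - Ev"
  have YM[measurable]: "Y \<in> borel_measurable M" and DM[measurable]: "\<Delta> \<in> borel_measurable M"
    using measurable_from_subalg[OF sub] Y D by auto
  have N[measurable]: "?N \<in> sets M" using Ev by auto
  \<comment> \<open>The decreasing factor exp (- 1_Ev \<Delta>) is rewritten as exp (- \<Delta>)
    plus 1 - exp (- \<Delta>) off \<open>Ev\<close>. Now the complement of \<open>Ev\<close>
    multiplies a nonnegative function measurable in \<open>F\<close>, which is the shape of
    \<open>nn_integral_indicator_le\<close>.\<close>
  have "(\<integral>\<^sup>+ \<omega>. Z \<omega> * ennreal (exp (q / 2 * \<Delta> \<omega> - indicator Ev \<omega> * \<Delta> \<omega>)) \<partial>M)
    = (\<integral>\<^sup>+ \<omega>. Y \<omega> * ennreal (exp (- \<Delta> \<omega>)) + Y \<omega> * ennreal (1 - exp (- \<Delta> \<omega>)) * indicator ?N \<omega> \<partial>M)"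
  proof (intro nn_integral_cong)
    fix \<omega> assume w: "\<omega> \<in> space M"
    show "Z \<omega> * ennreal (exp (q / 2 * \<Delta> \<omega> - indicator Ev \<omega> * \<Delta> \<omega>))
      = Y \<omega> * ennreal (exp (- \<Delta> \<omega>)) + Y \<omega> * ennreal (1 - exp (- \<Delta> \<omega>)) * indicator ?N \<omega>"
    proof (cases "\<omega> \<in> Ev")
      case True
      then show ?thesis
        by (simp add: Y_def mult.assoc ennreal_mult'[symmetric] exp_add[symmetric])
    next
      case False
      have "Y \<omega> * ennreal (exp (- \<Delta> \<omega>)) + Y \<omega> * ennreal (1 - exp (- \<Delta> \<omega>)) = Y \<omega> * ennreal (exp (- \<Delta> \<omega>) + (1 - exp (- \<Delta> \<omega>)))"
        using D01[OF w] by (subst ennreal_plus) (auto simp: distrib_left)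
      then show ?thesis using False w by (simp add: Y_def)
    qed
  qed
  also have "\<dots> = (\<integral>\<^sup>+ \<omega>. Y \<omega> * ennreal (exp (- \<Delta> \<omega>)) \<partial>M) + (\<integral>\<^sup>+ \<omega>. Y \<omega> * ennreal (1 - exp (- \<Delta> \<omega>)) * indicator ?N \<omega> \<partial>M)"
    by (rule nn_integral_add) measurable
  also have "\<dots> \<le> (\<integral>\<^sup>+ \<omega>. Y \<omega> * ennreal (exp (- \<Delta> \<omega>)) \<partial>M) + ennreal (1 - q) * (\<integral>\<^sup>+ \<omega>. Y \<omega> * ennreal (1 - exp (- \<Delta> \<omega>)) \<partial>M)"
    using Y D by (intro add_left_mono nn_integral_indicator_le[OF sub N _ le]) auto
  also have "\<dots> = (\<integral>\<^sup>+ \<omega>. Y \<omega> * ennreal (exp (- \<Delta> \<omega>)) + ennreal (1 - q) * (Y \<omega> * ennreal (1 - exp (- \<Delta> \<omega>))) \<partial>M)"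
    by (subst nn_integral_add) (auto simp: nn_integral_cmult)
  also have "\<dots> \<le> (\<integral>\<^sup>+ \<omega>. Z \<omega> \<partial>M)"
  proof (intro nn_integral_mono)
    fix \<omega> assume w: "\<omega> \<in> space M"
    define D where "D = \<Delta> \<omega>"
    have D: "0 \<le> D" "D \<le> 1" using D01[OF w] by (auto simp: D_def)
    \<comment> \<open>Here \<Delta> \<le> 1 enters, and here the factor 1/2 is lost that turns
      \<open>q\<close> into \<open>q / 2\<close>.\<close>
    have "exp (- D) \<le> 1 - D / 2"
    proof -
      have "exp D * (1 - D / 2) \<ge> (1 + D) * (1 - D / 2)"
        using D by (intro mult_right_mono exp_ge_add_one_self) auto
      also have "(1 + D) * (1 - D / 2) = 1 + D * (1 - D) / 2" by (simp add: field_simps)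
      finally have "1 \<le> exp D * (1 - D / 2)" using D by (smt (verit) divide_nonneg_nonneg mult_nonneg_nonneg)
      then show ?thesis by (simp add: exp_minus field_simps)
    qed
    then have "q * (D / 2) \<le> q * (1 - exp (- D))" using q by (intro mult_left_mono) auto
    then have "exp (- D) + (1 - q) * (1 - exp (- D)) \<le> 1 - q / 2 * D" by (simp add: algebra_simps)
    also have "\<dots> \<le> exp (- (q / 2 * D))" using exp_ge_add_one_self[of "- (q / 2 * D)"] by simp
    finally have le: "exp (- D) + (1 - q) * (1 - exp (- D)) \<le> exp (- (q / 2 * D))" .
    have "Y \<omega> * ennreal (exp (- D)) + ennreal (1 - q) * (Y \<omega> * ennreal (1 - exp (- D)))
      = Y \<omega> * ennreal (exp (- D) + (1 - q) * (1 - exp (- D)))"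
      using D q by (simp add: ennreal_plus ennreal_mult distrib_left ac_simps)
    also have "\<dots> \<le> Y \<omega> * ennreal (exp (- (q / 2 * D)))"
      by (intro mult_left_mono ennreal_leI le) auto
    also have "\<dots> = Z \<omega>"
      by (simp add: Y_def D_def mult.assoc ennreal_mult'[symmetric] exp_add[symmetric])
    finally show "Y \<omega> * ennreal (exp (- \<Delta> \<omega>)) + ennreal (1 - q) * (Y \<omega> * ennreal (1 - exp (- \<Delta> \<omega>))) \<le> Z \<omega>"
      by (simp add: D_def)
  qed
  finally show ?thesis .
qed

text \<open>A random subset of a finite set is a discrete random variable, so every function of it
  is measurable, including choices by \<open>SOME\<close>. This serves the nearest grid point and
  the tables of solver answers.\<close>

lemma measurable_finite_set_function:
  assumes "finite \<Gamma>" and sub: "\<And>\<omega>. \<omega> \<in> space G \<Longrightarrow> U \<omega> \<subseteq> \<Gamma>"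
    and meas: "\<And>g. g \<in> \<Gamma> \<Longrightarrow> {\<omega> \<in> space G. g \<in> U \<omega>} \<in> sets G"
  shows "(\<lambda>\<omega>. \<phi> (U \<omega>)) \<in> measurable G (count_space UNIV)"
proof (rule measurableI)
  fix X
  have "(\<lambda>\<omega>. \<phi> (U \<omega>)) -` X \<inter> space G
    = (\<Union>W \<in> {W \<in> Pow \<Gamma>. \<phi> W \<in> X}. {\<omega> \<in> space G. \<forall>g\<in>\<Gamma>. g \<in> U \<omega> \<longleftrightarrow> g \<in> W})"
  proof (intro Set.set_eqI iffI)
    fix \<omega> assume "\<omega> \<in> (\<lambda>\<omega>. \<phi> (U \<omega>)) -` X \<inter> space G"
    then show "\<omega> \<in> (\<Union>W \<in> {W \<in> Pow \<Gamma>. \<phi> W \<in> X}. {\<omega> \<in> space G. \<forall>g\<in>\<Gamma>. g \<in> U \<omega> \<longleftrightarrow> g \<in> W})"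
      using sub by (intro UN_I[of "U \<omega>"]) auto
  next
    fix \<omega> assume "\<omega> \<in> (\<Union>W \<in> {W \<in> Pow \<Gamma>. \<phi> W \<in> X}. {\<omega> \<in> space G. \<forall>g\<in>\<Gamma>. g \<in> U \<omega> \<longleftrightarrow> g \<in> W})"
    then obtain W where W: "W \<subseteq> \<Gamma>" "\<phi> W \<in> X" "\<omega> \<in> space G" "\<forall>g\<in>\<Gamma>. g \<in> U \<omega> \<longleftrightarrow> g \<in> W" by auto
    then have "U \<omega> = W" using sub[OF W(3)] by blast
    then show "\<omega> \<in> (\<lambda>\<omega>. \<phi> (U \<omega>)) -` X \<inter> space G" using W by auto
  qed
  also have "\<dots> \<in> sets G"
  proof (intro sets.finite_UN)
    fix W assume "W \<in> {W \<in> Pow \<Gamma>. \<phi> W \<in> X}"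
    have "{\<omega> \<in> space G. g \<in> U \<omega> \<longleftrightarrow> g \<in> W} \<in> sets G" if "g \<in> \<Gamma>" for g
    proof (cases "g \<in> W")
      case False
      have "{\<omega> \<in> space G. g \<in> U \<omega> \<longleftrightarrow> g \<in> W} = space G - {\<omega> \<in> space G. g \<in> U \<omega>}" using False by auto
      then show ?thesis using meas[OF that] by auto
    qed (use meas[OF that] in simp)
    then show "{\<omega> \<in> space G. \<forall>g\<in>\<Gamma>. g \<in> U \<omega> \<longleftrightarrow> g \<in> W} \<in> sets G"
      using assms(1) by (intro sets.sets_Collect_finite_All) auto
  qed (use assms(1) in auto)
  finally show "(\<lambda>\<omega>. \<phi> (U \<omega>)) -` X \<inter> space G \<in> sets G" .
qed auto

section \<open>Perturbed estimates and normalized queries\<close>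

lemma vnorm_smult: "vnorm (c \<cdot>\<^sub>v v) = \<bar>c\<bar> * vnorm v"
proof -
  have "(c \<cdot>\<^sub>v v) \<bullet> (c \<cdot>\<^sub>v v) = c\<^sup>2 * (v \<bullet> v)"
    by (simp add: scalar_prod_def sum_distrib_left power2_eq_square algebra_simps)
  then show ?thesis by (simp add: vnorm_def real_sqrt_mult)
qed

lemma vnorm_eq_0: "v \<in> carrier_vec n \<Longrightarrow> vnorm v = 0 \<Longrightarrow> v = 0\<^sub>v n"
  using scalar_prod_self_eq_0[of v n] vnorm_sq[of v] by simp

text \<open>Division by zero sends the zero vector to itself, so both claims include it.\<close>

lemma normalize_unit_ball:
  assumes "v \<in> carrier_vec d"
  shows "(1 / vnorm v) \<cdot>\<^sub>v v \<in> unit_ball d" "v = vnorm v \<cdot>\<^sub>v ((1 / vnorm v) \<cdot>\<^sub>v v)"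
proof -
  show "(1 / vnorm v) \<cdot>\<^sub>v v \<in> unit_ball d"
    using assms by (auto simp: unit_ball_def vnorm_smult)
  show "v = vnorm v \<cdot>\<^sub>v ((1 / vnorm v) \<cdot>\<^sub>v v)"
    using vnorm_eq_0[OF assms] assms by (cases "vnorm v = 0") (auto simp: smult_smult_assoc intro!: eq_vecI)
qed

lemma inv_sqrt_gram:
  assumes "features d x acts t" "\<And>k. k < t \<Longrightarrow> vnorm (x (acts (Suc k))) \<le> 1"
  shows "inv_sqrt_mat d (gram_mat d x acts t) \<in> carrier_mat d d"
    "(inv_sqrt_mat d (gram_mat d x acts t))\<^sup>T = inv_sqrt_mat d (gram_mat d x acts t)"
    "u \<in> carrier_vec d \<Longrightarrow> vnorm (inv_sqrt_mat d (gram_mat d x acts t) *\<^sub>v u) = sqrt (width d x acts t u)"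
proof -
  let ?B = "inv_sqrt_mat d (gram_mat d x acts t)"
  note B = inv_sqrt_mat[OF ge_one_gram[OF assms(1)] gram_form_le[OF assms]]
  show "?B \<in> carrier_mat d d" "?B\<^sup>T = ?B" using B by auto
  assume u: "u \<in> carrier_vec d"
  have Bu: "?B *\<^sub>v u \<in> carrier_vec d" using B(1) u by simp
  have "(?B *\<^sub>v u) \<bullet> (?B *\<^sub>v u) = u \<bullet> (?B *\<^sub>v (?B *\<^sub>v u))" by (rule sym_move[OF B(1,2) u Bu])
  also have "\<dots> = width d x acts t u"
    using assoc_mult_mat_vec[OF B(1,1) u] B(3) by (simp add: width_def)
  finally show "vnorm (?B *\<^sub>v u) = sqrt (width d x acts t u)" by (simp add: vnorm_def)
qed

definition sampled_param ::
  "nat \<Rightarrow> nat \<Rightarrow> real \<Rightarrow> (nat \<Rightarrow> rvec) \<Rightarrow> (nat \<Rightarrow> nat) \<Rightarrow> (nat \<Rightarrow> real) \<Rightarrow> nat \<Rightarrow> (nat \<Rightarrow> real) \<Rightarrow> rvec" where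
  "sampled_param d T delta x acts rew t z = theta_hat d x acts rew (t - 1) +
     conf_radius d T (delta / (4 * real T)) \<cdot>\<^sub>v
       (inv_sqrt_mat d (gram_mat d x acts (t - 1)) *\<^sub>v Matrix.vec d z)"

lemma ts_query_eq:
  "ts_query d T delta x acts rew t z
    = (1 / vnorm (sampled_param d T delta x acts rew t z)) \<cdot>\<^sub>v sampled_param d T delta x acts rew t z"
  by (simp add: ts_query_def sampled_param_def Let_def)

lemma theta_hat_carrier:
  assumes "features d x acts t"
  shows "theta_hat d x acts rew t \<in> carrier_vec d"
  unfolding theta_hat_eq[OF assms]
  using minv(1)[OF ge_one_gram[OF assms]] weighted_sum_carrier[OF assms] by simp

lemma sampled_param_carrier:
  assumes "features d x acts (t - 1)" "\<And>k. k < t - 1 \<Longrightarrow> vnorm (x (acts (Suc k))) \<le> 1"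
  shows "sampled_param d T delta x acts rew t z \<in> carrier_vec d"
  using theta_hat_carrier[OF assms(1)] inv_sqrt_gram(1)[OF assms] by (simp add: sampled_param_def)

text \<open>Moving the symmetric root from the sample to \<open>u\<close> turns the randomness into
  an inner product of the sample with one direction, which is what anti-concentration speaks
  about.\<close>

lemma sampled_param_form:
  assumes f: "features d x acts (t - 1)" "\<And>k. k < t - 1 \<Longrightarrow> vnorm (x (acts (Suc k))) \<le> 1"
    and u: "u \<in> carrier_vec d"
  shows "u \<bullet> sampled_param d T delta x acts rew t z = u \<bullet> theta_hat d x acts rew (t - 1) +
    conf_radius d T (delta / (4 * real T)) *
      ((inv_sqrt_mat d (gram_mat d x acts (t - 1)) *\<^sub>v u) \<bullet> Matrix.vec d z)"
proof -
  note B = inv_sqrt_gram[OF f]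
  have z: "Matrix.vec d z \<in> carrier_vec d" by simp
  show ?thesis
    unfolding sampled_param_def
    using theta_hat_carrier[OF f(1)] u B(1) sym_move[OF B(1,2) u z] by (simp add: scalar_prod_add_distrib[of _ d])
qed

section \<open>Rounding of queries\<close>

lemma abs_index_le_vnorm:
  assumes "v \<in> carrier_vec d" "i < d"
  shows "\<bar>v $ i\<bar> \<le> vnorm v"
proof -
  have "(v $ i)\<^sup>2 \<le> (\<Sum>i<d. v $ i * v $ i)"
    using assms member_le_sum[of i "{..<d}" "\<lambda>i. v $ i * v $ i"] by (simp add: power2_eq_square)
  also have "\<dots> = v \<bullet> v" using assms by (simp add: scalar_prod_def atLeast0LessThan)
  finally have "sqrt ((v $ i)\<^sup>2) \<le> sqrt (v \<bullet> v)" by (rule real_sqrt_le_mono)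
  then show ?thesis unfolding real_sqrt_abs vnorm_def .
qed

lemma query_grid_finite:
  assumes "0 < e" "1 \<le> d"
  shows "finite (query_grid d e)" "real (card (query_grid d e)) \<le> (2 * real d / e + 1) ^ d"
proof -
  \<comment> \<open>Coordinates of vectors in the unit ball are at most 1 in absolute value, so as
    multiples of \<open>e / d\<close> their integer factors lie between \<open>- m\<close> and
    \<open>m\<close>.\<close>
  define m where "m = \<lfloor>real d / e\<rfloor>"
  have m0: "0 \<le> m" using assms by (simp add: m_def)
  let ?F = "PiE {..<d} (\<lambda>_. {-m..m})"
  let ?g = "\<lambda>f. Matrix.vec d (\<lambda>i. of_int (f i) * (e / real d))"
  have sub: "query_grid d e \<subseteq> ?g ` ?F"
  proof
    fix v assume "v \<in> query_grid d e"
    then have v: "v \<in> carrier_vec d" "vnorm v \<le> 1" "\<forall>i<d. \<exists>k::int. v $ i = of_int k * (e / real d)"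
      by (auto simp: query_grid_def unit_ball_def)
    then obtain f where f: "\<And>i. i < d \<Longrightarrow> v $ i = of_int (f i) * (e / real d)" by metis
    have "f i \<in> {-m..m}" if i: "i < d" for i
    proof -
      have "\<bar>of_int (f i) * (e / real d)\<bar> \<le> 1" using abs_index_le_vnorm[OF v(1) i] v(2) f[OF i] by simp
      then have "\<bar>real_of_int (f i)\<bar> \<le> real d / e" using assms by (simp add: abs_mult field_simps)
      then have "\<bar>f i\<bar> \<le> m" unfolding m_def le_floor_iff by simp
      then show ?thesis by auto
    qed
    then have "restrict f {..<d} \<in> ?F" by auto
    moreover have "v = ?g (restrict f {..<d})" using v(1) f by (intro eq_vecI) auto
    ultimately show "v \<in> ?g ` ?F" by blast
  qed
  have fin: "finite ?F" by (intro finite_PiE) auto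
  then show "finite (query_grid d e)" using sub finite_surj by blast
  have "card (query_grid d e) \<le> card ?F" by (rule surj_card_le[OF fin sub])
  also have "card ?F = nat (2 * m + 1) ^ d" by (simp add: card_PiE)
  finally have "real (card (query_grid d e)) \<le> real (nat (2 * m + 1) ^ d)" by (rule of_nat_mono)
  also have "\<dots> = (2 * real_of_int m + 1) ^ d" using m0 by simp
  also have "\<dots> \<le> (2 * real d / e + 1) ^ d"
  proof (intro power_mono)
    have "of_int m \<le> real d / e" by (simp add: m_def)
    moreover have "2 * real d / e = 2 * (real d / e)" by simp
    ultimately show "2 * real_of_int m + 1 \<le> 2 * real d / e + 1" by linarith
  qed (use m0 in simp)
  finally show "real (card (query_grid d e)) \<le> (2 * real d / e + 1) ^ d" .
qed

lemma zero_in_query_grid: "0\<^sub>v d \<in> query_grid d e"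
  by (auto simp: query_grid_def unit_ball_def vnorm_def intro!: exI[of _ 0])

lemma round_query_in_grid:
  assumes "0 < e" "1 \<le> d"
  shows "round_query d e q \<in> query_grid d e"
  unfolding round_query_def
  using arg_min_if_finite(1)[OF query_grid_finite(1)[OF assms]] zero_in_query_grid[of d e] by blast

text \<open>Rounding coordinates to the nearest multiple could leave the unit ball; rounding them
  towards zero cannot, and its error is at most \<open>e / d\<close> per coordinate. The nearest
  grid point is at least as close as this candidate.\<close>

lemma round_query_close:
  assumes "0 < e" "1 \<le> d" and q: "q \<in> unit_ball d"
  shows "vnorm (q - round_query d e q) \<le> e"
proof -
  have qc: "q \<in> carrier_vec d" "vnorm q \<le> 1" using q by (auto simp: unit_ball_def)
  define h where "h = e / real d"
  have h: "h > 0" using assms by (simp add: h_def)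
  define k where "k i = (if 0 \<le> q $ i then \<lfloor>q $ i / h\<rfloor> else \<lceil>q $ i / h\<rceil>)" for i
  define v where "v = Matrix.vec d (\<lambda>i. of_int (k i) * h)"
  have vc: "v \<in> carrier_vec d" by (simp add: v_def)
  have kk: "\<bar>of_int (k i) * h\<bar> \<le> \<bar>q $ i\<bar> \<and> \<bar>q $ i - of_int (k i) * h\<bar> \<le> h" for i
  proof (cases "0 \<le> q $ i")
    case True
    have 1: "of_int (k i) \<le> q $ i / h" "q $ i / h \<le> of_int (k i) + 1" "0 \<le> k i"
      using True h by (auto simp: k_def)
    then have "of_int (k i) * h \<le> q $ i" "q $ i \<le> (of_int (k i) + 1) * h" "0 \<le> of_int (k i) * h"
      using h by (auto simp: field_simps)
    then show ?thesis using True by (auto simp: algebra_simps)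
  next
    case False
    have 1: "q $ i / h \<le> of_int (k i)" "of_int (k i) - 1 \<le> q $ i / h" "k i \<le> 0"
      using False h by (auto simp: k_def ceiling_le_zero divide_le_0_iff)
    then have "q $ i \<le> of_int (k i) * h" "(of_int (k i) - 1) * h \<le> q $ i" "of_int (k i) * h \<le> 0"
      using h by (auto simp: field_simps mult_nonneg_nonpos)
    then show ?thesis using False by (auto simp: algebra_simps)
  qed
  have "v \<bullet> v \<le> q \<bullet> q"
  proof -
    have "(of_int (k i) * h) * (of_int (k i) * h) \<le> q $ i * q $ i" for i
      using kk[of i] by (metis abs_le_square_iff power2_eq_square)
    then show ?thesis using qc by (auto simp: scalar_prod_def v_def intro!: sum_mono)
  qed
  then have "vnorm v \<le> 1" using qc(2) unfolding vnorm_def by (meson order_trans real_sqrt_le_mono)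
  then have vg: "v \<in> query_grid d e" using vc by (auto simp: query_grid_def unit_ball_def v_def h_def)
  have "(q - v) \<bullet> (q - v) \<le> e\<^sup>2"
  proof -
    have "(q - v) \<bullet> (q - v) = (\<Sum>i<d. (q $ i - of_int (k i) * h)\<^sup>2)"
      using qc vc by (simp add: scalar_prod_def v_def atLeast0LessThan power2_eq_square)
    also have "\<dots> \<le> (\<Sum>i<d. h\<^sup>2)"
    proof (intro sum_mono)
      fix i
      show "(q $ i - of_int (k i) * h)\<^sup>2 \<le> h\<^sup>2" using kk[of i] h by (intro abs_le_square_iff[THEN iffD1]) auto
    qed
    also have "\<dots> = e\<^sup>2 / real d" using assms by (simp add: h_def power2_eq_square)
    also have "\<dots> \<le> e\<^sup>2" using assms by (simp add: divide_le_eq mult_le_cancel_left1)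
    finally show ?thesis .
  qed
  then have "vnorm (q - v) \<le> e" using assms(1) unfolding vnorm_def by (simp add: real_le_lsqrt)
  moreover have "vnorm (q - round_query d e q) \<le> vnorm (q - v)"
    unfolding round_query_def
    using arg_min_least[OF query_grid_finite(1)[OF assms(1,2)] _ vg, of "\<lambda>v. vnorm (q - v)"] vg by auto
  ultimately show ?thesis by simp
qed

section \<open>Binary search without monotonicity\<close>

text \<open>The invariant: the lower end is the initial one or a success, the upper end is the
  initial one or a failure. On termination the ends are adjacent.\<close>

lemma bsearch_result:
  assumes "lo < hi"
  shows "lo \<le> bsearch f lo hi \<and> bsearch f lo hi < hi \<and> (bsearch f lo hi = lo \<or> f (bsearch f lo hi))
    \<and> (Suc (bsearch f lo hi) = hi \<or> \<not> f (Suc (bsearch f lo hi)))"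
  using assms
proof (induction f lo hi rule: bsearch.induct)
  case (1 f lo hi)
  show ?case
  proof (cases "hi \<le> Suc lo")
    case True
    then show ?thesis using 1 by (subst (1 2 3 4 5 6) bsearch.simps) auto
  next
    case False
    define m where "m = (lo + hi) div 2"
    have m: "lo < m" "m < hi" using False by (simp_all add: m_def)
    have step: "bsearch f lo hi = (if f m then bsearch f m hi else bsearch f lo m)"
      using False by (subst bsearch.simps) (simp add: m_def Let_def)
    show ?thesis
    proof (cases "f m")
      case True
      show ?thesis using "1.IH"(1)[OF False m_def True m(2)] m True step by auto
    next
      case nf: False
      show ?thesis using "1.IH"(2)[OF False m_def nf m(1)] m nf step by auto
    qed
  qed
qed

text \<open>For measurability of the arm, the answers are tabulated for the indices of actual
  solvers; the search looks at no others.\<close>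

lemma bsearch_cong:
  assumes "\<And>i. lo < i \<Longrightarrow> i < hi \<Longrightarrow> f i = g i"
  shows "bsearch f lo hi = bsearch g lo hi"
  using assms
proof (induction f lo hi rule: bsearch.induct)
  case (1 f lo hi)
  show ?case
  proof (cases "hi \<le> Suc lo")
    case True
    then show ?thesis by (simp add: bsearch.simps)
  next
    case False
    define m where "m = (lo + hi) div 2"
    have m: "lo < m" "m < hi" using False by (simp_all add: m_def)
    have step: "bsearch f lo hi = (if f m then bsearch f m hi else bsearch f lo m)" for f
      using False by (subst bsearch.simps) (simp add: m_def Let_def)
    have "f m = g m" using "1.prems" m by simp
    show ?thesis
    proof (cases "f m")
      case True
      have "bsearch f m hi = bsearch g m hi"
        by (rule "1.IH"(1)[OF False m_def True]) (use "1.prems" m in auto)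
      then show ?thesis using True \<open>f m = g m\<close> step by simp
    next
      case nf: False
      have "bsearch f lo m = bsearch g lo m"
        by (rule "1.IH"(2)[OF False m_def nf]) (use "1.prems" m in auto)
      then show ?thesis using nf \<open>f m = g m\<close> step by simp
    qed
  qed
qed

lemma bsearch_probes_subset: "bsearch_probes f lo hi \<subseteq> {lo<..<hi}"
proof (induction f lo hi rule: bsearch_probes.induct)
  case (1 f lo hi)
  show ?case
  proof (cases "hi \<le> Suc lo")
    case True
    then show ?thesis by (simp add: bsearch_probes.simps)
  next
    case False
    define m where "m = (lo + hi) div 2"
    have m: "lo < m" "m < hi" using False by (simp_all add: m_def)
    have step: "bsearch_probes f lo hi = insert m (if f m then bsearch_probes f m hi else bsearch_probes f lo m)"
      using False by (subst bsearch_probes.simps) (simp add: m_def Let_def)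
    show ?thesis
    proof (cases "f m")
      case True
      show ?thesis using "1.IH"(1)[OF False m_def True] m True step by auto
    next
      case nf: False
      show ?thesis using "1.IH"(2)[OF False m_def nf] m nf step by auto
    qed
  qed
qed

text \<open>The source of the lower bound on the running time: each step pays for at least one
  query.\<close>

lemma bsearch_probes_nonempty:
  assumes "Suc lo < hi"
  shows "bsearch_probes f lo hi \<noteq> {}"
  using assms by (subst bsearch_probes.simps) (simp add: Let_def)

section \<open>Runs\<close>

lemma num_solvers_bounds:
  assumes "1 \<le> d" "0 < eta"
  shows "1 \<le> num_solvers d eta" "real d / eta \<le> real (num_solvers d eta)"
    "real (num_solvers d eta) < real d / eta + 1"
proof -
  have "0 < real d / eta" using assms by simp
  then have "0 < \<lceil>real d / eta\<rceil>" by simp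
  then have "real (num_solvers d eta) = of_int \<lceil>real d / eta\<rceil>" "0 < num_solvers d eta"
    by (simp_all add: num_solvers_def)
  then show "1 \<le> num_solvers d eta" "real d / eta \<le> real (num_solvers d eta)"
    "real (num_solvers d eta) < real d / eta + 1" by linarith+
qed

text \<open>Rounding up the number of solvers lets the last \<open>par_r\<close> exceed 1, but by at
  most \<open>eta / d\<close>. The bound 2 stays away from 3, where \<open>rho_q\<close>
  degenerates.\<close>

lemma solver_par_range:
  assumes "1 \<le> d" "0 < eta" "eta \<le> 1" "i \<in> {1..num_solvers d eta}"
  shows "0 < par_c i" "par_c i < 1" "0 < par_r d eta i" "par_r d eta i \<le> 2"
proof -
  let ?e = "eta / real d"
  show "0 < par_c i" "par_c i < 1" using assms(4) by (auto simp: par_c_def field_simps)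
  show "0 < par_r d eta i" using assms by (simp add: par_r_def)
  have e: "0 < ?e" "?e \<le> 1" using assms by (auto simp: divide_le_eq)
  have "par_r d eta i \<le> real (num_solvers d eta) * ?e" using assms by (simp add: par_r_def divide_right_mono)
  also have "\<dots> \<le> (real d / eta + 1) * ?e"
    using num_solvers_bounds[OF assms(1,2)] e by (intro mult_right_mono) auto
  also have "\<dots> = 1 + ?e" using assms by (simp add: field_simps)
  finally show "par_r d eta i \<le> 2" using e by simp
qed

lemma gram_cong: "(\<And>k. k \<in> {1..t} \<Longrightarrow> acts k = acts' k) \<Longrightarrow> gram_mat d x acts t = gram_mat d x acts' t"
  by (induction t) auto

lemma weighted_sum_cong:
  "(\<And>k. k \<in> {1..t} \<Longrightarrow> acts k = acts' k) \<Longrightarrow> (\<And>k. k \<in> {1..t} \<Longrightarrow> c k = c' k) \<Longrightarrow>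
    weighted_sum d x acts c t = weighted_sum d x acts' c' t"
  by (induction t) auto

lemma width_cong: "(\<And>k. k \<in> {1..t} \<Longrightarrow> acts k = acts' k) \<Longrightarrow> width d x acts t v = width d x acts' t v"
  using gram_cong[of t acts acts' d x] by (simp add: width_def)

lemma theta_hat_cong:
  assumes "\<And>k. k \<in> {1..t} \<Longrightarrow> acts k = acts' k"
  shows "theta_hat d x acts rew t = theta_hat d x acts' rew t"
proof -
  have "design_mat d x acts t = design_mat d x acts' t"
    using assms unfolding design_mat_def by (intro eq_matI) auto
  then show ?thesis by (simp add: theta_hat_def)
qed

lemma sampled_param_cong:
  assumes "\<And>k. k \<in> {1..t - 1} \<Longrightarrow> acts k = acts' k"
  shows "sampled_param d T delta x acts rew t z = sampled_param d T delta x acts' rew t z"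
proof -
  have "theta_hat d x acts rew (t - 1) = theta_hat d x acts' rew (t - 1)"
    by (rule theta_hat_cong) (rule assms)
  moreover have "gram_mat d x acts (t - 1) = gram_mat d x acts' (t - 1)"
    by (rule gram_cong) (rule assms)
  ultimately show ?thesis by (simp only: sampled_param_def)
qed

text \<open>The left side is the value of the right side at \<open>K = 1\<close>, so the number of
  copies has a lower bound uniform in \<open>K\<close>.\<close>

lemma copies_arg_gt:
  assumes "1 \<le> d" "0 < eta" "eta \<le> 1" "0 < delta" "delta < 1" "1 \<le> K"
  shows "2 * real d ^ 3 / (eta\<^sup>2 * delta) \<le> real K * real d / (par_eps d eta * par_delta d eta delta)"
proof -
  have "real K * real d / (par_eps d eta * par_delta d eta delta) = real K * (2 * real d ^ 3 / (eta\<^sup>2 * delta))"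
    using assms by (simp add: par_eps_def par_delta_def field_simps power2_eq_square power3_eq_cube)
  moreover have "1 * (2 * real d ^ 3 / (eta\<^sup>2 * delta)) \<le> real K * (2 * real d ^ 3 / (eta\<^sup>2 * delta))"
    using assms by (intro mult_right_mono) auto
  ultimately show ?thesis by simp
qed

locale ts_run = sublinear_ts_run +
  assumes spec: "mips_solver_spec S"
begin

abbreviation "nn \<equiv> num_solvers d eta"
abbreviation "kap \<equiv> num_copies d K eta delta"
abbreviation "ep \<equiv> par_eps d eta"
abbreviation "grd \<equiv> query_grid d ep"
abbreviation "ans t i j v \<omega> \<equiv> answer S d (par_c i) (par_r d eta i) K (s i j \<omega>) (point_history A x t) v"
abbreviation "qry t \<omega> \<equiv> ts_query d T delta x (\<lambda>k. a k \<omega>) (\<lambda>k. r k \<omega>) t (\<xi> t \<omega>)"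
abbreviation "rq t \<omega> \<equiv> round_query d ep (qry t \<omega>)"

text \<open>The answer as a function of the rounded query, which ranges over a finite grid fixed
  before the run; probabilities are bounded for each fixed grid point.\<close>

definition res :: "nat \<Rightarrow> nat \<Rightarrow> rvec \<Rightarrow> 'a \<Rightarrow> rvec option" where
  "res t i v \<omega> = (let R = {p. \<exists>j<kap. ans t i j v \<omega> = Some p} in if R = {} then None else Some (SOME p. p \<in> R))"

lemma ts_answer_eq:
  "ts_answer S d K eta delta A x (\<lambda>i j. s i j \<omega>) t q i = res t i (round_query d ep q) \<omega>"
  by (simp add: ts_answer_def adaptive_answer_def res_def num_copies_def)

lemma ep_pos: "0 < ep" using params by (simp add: par_eps_def)

lemmas nn_pos = num_solvers_bounds(1)[OF params(1,6)]
lemmas nn_bounds = num_solvers_bounds(2,3)[OF params(1,6)]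

lemma par_r_eq: "par_r d eta i = real i * ep" by (simp add: par_r_def par_eps_def)

lemma nn_ep: "1 \<le> real nn * ep" "real nn * ep < 3"
proof -
  have "real d / eta * ep = 1" using params by (simp add: par_eps_def)
  moreover have "ep \<le> 1" using params by (simp add: par_eps_def divide_le_eq)
  moreover have "real d / eta * ep \<le> real nn * ep" using nn_bounds(1) ep_pos by (intro mult_right_mono) auto
  moreover have "real nn * ep \<le> (real d / eta + 1) * ep" using nn_bounds(2) ep_pos by (intro mult_right_mono) auto
  ultimately show "1 \<le> real nn * ep" "real nn * ep < 3" by (simp_all add: algebra_simps)
qed

lemma par_range:
  assumes "i \<in> {1..nn}"
  shows "0 < par_c i" "par_c i < 1" "0 < par_r d eta i" "par_r d eta i < 3"
  using solver_par_range[OF params(1,6,7) assms] by auto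

lemma history:
  assumes "t \<le> T"
  shows "solver_history d K (point_history A x t)" "last (point_history A x t) = x ` A t"
proof -
  show "last (point_history A x t) = x ` A t" by (simp add: point_history_def last_map)
  show "solver_history d K (point_history A x t)"
    unfolding solver_history_def
  proof (intro conjI ballI)
    show "point_history A x t \<noteq> []" by (simp add: point_history_def)
    fix P assume "P \<in> set (point_history A x t)"
    then have "P \<in> (\<lambda>k. x ` A k) ` {..<Suc t}" by (auto simp: point_history_def simp del: upt_Suc)
    then obtain k where "k < Suc t" "P = x ` A k" by blast
    with assms have k: "k \<le> T" "P = x ` A k" by auto
    show "finite P" "card P \<le> K" using arms[OF k(1)] k(2) card_image_le[of "A k" x] by auto
    show "P \<subseteq> unit_ball d" using features[OF k(1)] k(2) by (auto simp: unit_ball_def)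
  qed
qed

lemma solver_facts:
  assumes "i \<in> {1..nn}" "t \<le> T" "v \<in> grd"
  defines "Sd \<equiv> seed S d (par_c i) (par_r d eta i) K"
  shows "prob_space Sd"
    "(\<lambda>w. answer S d (par_c i) (par_r d eta i) K w (point_history A x t) v) \<in> measurable Sd (count_space UNIV)"
    "measure Sd {w \<in> space Sd. solves_mips (par_c i) (par_r d eta i) 0 (x ` A t) v
        (answer S d (par_c i) (par_r d eta i) K w (point_history A x t) v)} \<ge> 0.9"
    "w \<in> space Sd \<Longrightarrow> answer S d (par_c i) (par_r d eta i) K w (point_history A x t) v = Some q \<Longrightarrow>
       q \<in> x ` A t \<and> v \<bullet> q \<ge> par_c i * par_r d eta i"
proof -
  have v: "v \<in> unit_ball d" using assms(3) by (simp add: query_grid_def)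
  note * = spec[unfolded mips_solver_spec_def, rule_format, OF params(1) par_range[OF assms(1)], THEN conjunct1, rule_format, OF params(3)]
  note ** = conjunct2[OF *, rule_format, OF history(1)[OF assms(2)] v, unfolded history(2)[OF assms(2)]]
  show "prob_space Sd" using conjunct1[OF *] by (simp add: Sd_def)
  show "(\<lambda>w. answer S d (par_c i) (par_r d eta i) K w (point_history A x t) v) \<in> measurable Sd (count_space UNIV)"
    "measure Sd {w \<in> space Sd. solves_mips (par_c i) (par_r d eta i) 0 (x ` A t) v
        (answer S d (par_c i) (par_r d eta i) K w (point_history A x t) v)} \<ge> 0.9"
    "w \<in> space Sd \<Longrightarrow> answer S d (par_c i) (par_r d eta i) K w (point_history A x t) v = Some q \<Longrightarrow>
       q \<in> x ` A t \<and> v \<bullet> q \<ge> par_c i * par_r d eta i"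
    using ** unfolding Sd_def by blast+
qed

lemma seed_space:
  assumes "i \<in> {1..nn}" "j < kap" "\<omega> \<in> space M"
  shows "s i j \<omega> \<in> space (seed S d (par_c i) (par_r d eta i) K)"
proof -
  have "(i, j) \<in> I" using assms by (simp add: I_def)
  from seeds[OF this] have "s i j \<in> measurable M (N (i, j))" by simp
  from measurable_space[OF this assms(3)] show ?thesis by (simp add: N_def)
qed

lemma res_sound:
  assumes "i \<in> {1..nn}" "t \<le> T" "v \<in> grd" "\<omega> \<in> space M" "res t i v \<omega> = Some q"
  shows "q \<in> x ` A t \<and> v \<bullet> q \<ge> par_c i * par_r d eta i"
proof -
  let ?R = "{p. \<exists>j<kap. ans t i j v \<omega> = Some p}"
  have ne: "?R \<noteq> {}" and q: "q = (SOME p. p \<in> ?R)"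
    using assms(5) by (auto simp: res_def Let_def split: if_splits)
  have "(SOME p. p \<in> ?R) \<in> ?R" by (rule iffD2[OF some_in_eq ne])
  then have "q \<in> ?R" by (simp only: q[symmetric])
  then obtain j where "j < kap" "ans t i j v \<omega> = Some q" by blast
  then show ?thesis using solver_facts(4)[OF assms(1-3) seed_space[OF assms(1) _ assms(4)]] by blast
qed

definition idx :: "nat \<Rightarrow> rvec \<Rightarrow> 'a \<Rightarrow> nat" where
  "idx t v \<omega> = bsearch (\<lambda>i. res t i v \<omega> \<noteq> None) 0 (Suc nn)"

lemma idx_facts:
  "idx t v \<omega> \<le> nn" "idx t v \<omega> = 0 \<or> res t (idx t v \<omega>) v \<omega> \<noteq> None"
  "idx t v \<omega> = nn \<or> res t (Suc (idx t v \<omega>)) v \<omega> = None"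
  using bsearch_result[of 0 "Suc nn" "\<lambda>i. res t i v \<omega> \<noteq> None"] unfolding idx_def by auto

lemma arm_eq:
  assumes "t \<in> {1..T}" "\<omega> \<in> space M"
  shows "a t \<omega> = (if idx t (rq t \<omega>) \<omega> = 0 then dflt t
     else SOME e. e \<in> A t \<and> Some (x e) = res t (idx t (rq t \<omega>) \<omega>) (rq t \<omega>) \<omega>)"
  using arm_played[OF assms] by (simp add: ts_arm_def ts_index_def ts_answer_eq idx_def Let_def)

lemma rq_grd: "rq t \<omega> \<in> grd"
  by (rule round_query_in_grid[OF ep_pos params(1)])

lemma arm_found:
  assumes "t \<in> {1..T}" "\<omega> \<in> space M" "idx t (rq t \<omega>) \<omega> \<noteq> 0"
  shows "a t \<omega> \<in> A t \<and> res t (idx t (rq t \<omega>) \<omega>) (rq t \<omega>) \<omega> = Some (x (a t \<omega>))"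
proof -
  let ?i = "idx t (rq t \<omega>) \<omega>"
  have i: "?i \<in> {1..nn}" using idx_facts(1)[of t "rq t \<omega>" \<omega>] assms(3) by auto
  obtain q where q: "res t ?i (rq t \<omega>) \<omega> = Some q" using idx_facts(2)[of t "rq t \<omega>" \<omega>] assms(3) by blast
  have "q \<in> x ` A t" using res_sound[OF i _ rq_grd assms(2) q] assms(1) by auto
  then have ex: "\<exists>e. e \<in> A t \<and> Some (x e) = res t ?i (rq t \<omega>) \<omega>" using q by auto
  have "a t \<omega> = (SOME e. e \<in> A t \<and> Some (x e) = res t ?i (rq t \<omega>) \<omega>)"
    using arm_eq[OF assms(1,2)] assms(3) by simp
  then show ?thesis using someI_ex[OF ex] by metis
qed

lemma arm_in:
  assumes "t \<in> {1..T}" "\<omega> \<in> space M"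
  shows "a t \<omega> \<in> A t"
  using arm_found[OF assms] arm_eq[OF assms] dflt[OF assms(1)] by (cases "idx t (rq t \<omega>) \<omega> = 0") auto

lemma arm_feature:
  assumes "t \<in> {1..T}" "\<omega> \<in> space M"
  shows "x (a t \<omega>) \<in> carrier_vec d" "vnorm (x (a t \<omega>)) \<le> 1"
  using features[OF _ arm_in[OF assms]] assms by auto

lemma features_run: "t \<le> T \<Longrightarrow> \<omega> \<in> space M \<Longrightarrow> features d x (\<lambda>k. a k \<omega>) t"
  by unfold_locales (rule arm_feature, auto)

lemma features_norm: "t \<le> T \<Longrightarrow> \<omega> \<in> space M \<Longrightarrow> k < t \<Longrightarrow> vnorm (x (a (Suc k) \<omega>)) \<le> 1"
  by (rule arm_feature) auto

section \<open>Quality of the arm found\<close>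

text \<open>One successful copy per solver suffices, since any point returned by another copy has
  passed the check in \<open>mips_solver_spec\<close>.\<close>

definition solved :: "nat \<Rightarrow> rvec \<Rightarrow> 'a \<Rightarrow> bool" where
  "solved t v \<omega> \<longleftrightarrow> (\<forall>i\<in>{1..nn}. \<exists>j<kap. solves_mips (par_c i) (par_r d eta i) 0 (x ` A t) v (ans t i j v \<omega>))"

lemma solved_None:
  assumes "solved t v \<omega>" "i \<in> {1..nn}" "res t i v \<omega> = None" "e \<in> A t"
  shows "v \<bullet> x e < real i * ep"
proof (rule ccontr)
  assume "\<not> v \<bullet> x e < real i * ep"
  then have "\<exists>p' \<in> x ` A t. v \<bullet> p' \<ge> par_r d eta i + 0"
    using assms(4) by (intro bexI[of _ "x e"]) (auto simp: par_r_eq)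
  moreover obtain j where j: "j < kap" "solves_mips (par_c i) (par_r d eta i) 0 (x ` A t) v (ans t i j v \<omega>)"
    using assms(1,2) unfolding solved_def by blast
  ultimately obtain p where "ans t i j v \<omega> = Some p" unfolding solves_mips_def by blast
  then show False using assms(3) j(1) by (auto simp: res_def Let_def split: if_splits)
qed

text \<open>In units of \<open>ep\<close>, success at \<open>i\<close> gives the arm played at least
  \<open>i\<^sup>2 / (i + 1)\<close>, hence at least \<open>i - 1\<close>. A null result at
  \<open>i + 1\<close> keeps all arms below \<open>i + 1\<close>; at the last index the threshold
  already reaches 1, which no product in the unit ball exceeds. The difference is 2, and rounding
  the query costs 1 for each of the two arms compared. The first alternative covers a search that
  ends at index 0: the first solver answers null and the default arm is played.\<close>

lemma arm_quality:
  assumes t: "t \<in> {1..T}" and w: "\<omega> \<in> space M" and sol: "solved t (rq t \<omega>) \<omega>"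
  shows "(0 \<le> x (a t \<omega>) \<bullet> theta \<and> (\<forall>e\<in>A t. x e \<bullet> qry t \<omega> \<le> 4 * ep)) \<or>
    (\<forall>e\<in>A t. x e \<bullet> qry t \<omega> \<le> x (a t \<omega>) \<bullet> qry t \<omega> + 4 * ep)"
proof -
  define v where "v = rq t \<omega>"
  define i where "i = idx t v \<omega>"
  have tT: "t \<le> T" "t - 1 \<le> T" using t by auto
  have vg: "v \<in> grd" unfolding v_def by (rule rq_grd)
  have vc: "v \<in> carrier_vec d" "vnorm v \<le> 1" using vg by (auto simp: query_grid_def unit_ball_def)
  have th: "sampled_param d T delta x (\<lambda>k. a k \<omega>) (\<lambda>k. r k \<omega>) t (\<xi> t \<omega>) \<in> carrier_vec d"
    by (rule sampled_param_carrier[OF features_run[OF tT(2) w]]) (rule features_norm[OF tT(2) w])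
  have q: "qry t \<omega> \<in> unit_ball d" unfolding ts_query_eq by (rule normalize_unit_ball(1)[OF th])
  then have qc: "qry t \<omega> \<in> carrier_vec d" by (simp add: unit_ball_def)
  have close: "\<bar>x e \<bullet> qry t \<omega> - v \<bullet> x e\<bar> \<le> ep" if e: "e \<in> A t" for e
  proof -
    have xe: "x e \<in> carrier_vec d" "vnorm (x e) \<le> 1" using features[OF tT(1) e] by auto
    have "x e \<bullet> qry t \<omega> - v \<bullet> x e = x e \<bullet> (qry t \<omega> - v)"
      using xe vc qc comm_scalar_prod[OF xe(1) vc(1)] by (simp add: scalar_prod_minus_distrib[of _ d])
    also have "\<bar>\<dots>\<bar> \<le> vnorm (x e) * vnorm (qry t \<omega> - v)" using xe vc qc by (intro abs_scalar_prod_le_vnorm) auto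
    also have "\<dots> \<le> 1 * ep"
      using xe round_query_close[OF ep_pos params(1) q] ep_pos by (intro mult_mono) (auto simp: v_def)
    finally show ?thesis by simp
  qed
  show ?thesis
  proof (cases "i = 0")
    case True
    then have "res t 1 v \<omega> = None" using idx_facts(3)[of t v \<omega>] nn_pos by (auto simp: i_def)
    then have lt: "v \<bullet> x e < ep" if "e \<in> A t" for e
      using solved_None[OF sol, of 1 e] that nn_pos by (simp add: v_def)
    have "a t \<omega> = dflt t" using arm_eq[OF t w] True by (simp add: i_def v_def)
    then have "0 \<le> x (a t \<omega>) \<bullet> theta" using dflt[OF t] by simp
    moreover have "x e \<bullet> qry t \<omega> \<le> 4 * ep" if "e \<in> A t" for e
      using close[OF that] lt[OF that] ep_pos by linarith
    ultimately show ?thesis by blast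
  next
    case False
    then have i: "i \<in> {1..nn}" using idx_facts(1)[of t v \<omega>] by (auto simp: i_def)
    have found: "a t \<omega> \<in> A t" "res t i v \<omega> = Some (x (a t \<omega>))"
      using arm_found[OF t w] False by (auto simp: i_def v_def)
    have lower: "par_c i * par_r d eta i \<le> v \<bullet> x (a t \<omega>)"
      using res_sound[OF i tT(1) vg w found(2)] by simp
    have slack: "(real i - 1) * ep \<le> par_c i * par_r d eta i"
    proof -
      have "real i - 1 \<le> par_c i * real i" by (simp add: par_c_def field_simps)
      then show ?thesis unfolding par_r_eq using ep_pos by (simp add: mult_right_mono mult.assoc[symmetric])
    qed
    have upper: "v \<bullet> x e \<le> (real i + 1) * ep" if e: "e \<in> A t" for e
    proof (cases "i = nn")
      case True
      have "v \<bullet> x e \<le> vnorm v * vnorm (x e)"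
        using abs_scalar_prod_le_vnorm[OF vc(1), of "x e"] features[OF tT(1) e] by simp
      also have "\<dots> \<le> 1 * 1" using vc features[OF tT(1) e] by (intro mult_mono) auto
      also have "\<dots> \<le> real i * ep" using nn_ep(1) True by simp
      finally show ?thesis using ep_pos by (simp add: algebra_simps)
    next
      case False
      then have "res t (Suc i) v \<omega> = None" using idx_facts(3)[of t v \<omega>] by (auto simp: i_def)
      then have "v \<bullet> x e < real (Suc i) * ep"
        using solved_None[OF sol _ _ e, of "Suc i"] False i by (auto simp: v_def)
      then show ?thesis by (simp add: algebra_simps)
    qed
    have "x e \<bullet> qry t \<omega> \<le> x (a t \<omega>) \<bullet> qry t \<omega> + 4 * ep" if e: "e \<in> A t" for e
    proof -
      have "(real i + 1) * ep = (real i - 1) * ep + 2 * ep" by (simp add: algebra_simps)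
      then have "v \<bullet> x e \<le> v \<bullet> x (a t \<omega>) + 2 * ep" using lower slack upper[OF e] by linarith
      then show ?thesis using close[OF e] close[OF found(1)] by linarith
    qed
    then show ?thesis by blast
  qed
qed

section \<open>Measurability\<close>

text \<open>Lists of arms form a countable type, so functions of the past can be treated one list at
  a time, with all matrices constant.\<close>

definition past_arms :: "nat \<Rightarrow> 'a \<Rightarrow> nat list" where
  "past_arms t \<omega> = map (\<lambda>k. a k \<omega>) [1..<Suc t]"

definition good_list :: "nat \<Rightarrow> nat list \<Rightarrow> bool" where
  "good_list t l \<longleftrightarrow> length l = t \<and> (\<forall>e\<in>set l. x e \<in> carrier_vec d \<and> vnorm (x e) \<le> 1)"

definition list_acts :: "nat list \<Rightarrow> nat \<Rightarrow> nat" where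
  "list_acts l k = l ! (k - 1)"

lemma past_arms_acts: "k \<in> {1..t} \<Longrightarrow> list_acts (past_arms t \<omega>) k = a k \<omega>"
  by (auto simp: list_acts_def past_arms_def nth_append simp del: upt_Suc)

lemma good_past: "t \<le> T \<Longrightarrow> \<omega> \<in> space M \<Longrightarrow> good_list t (past_arms t \<omega>)"
  using arm_feature by (auto simp: good_list_def past_arms_def)

lemma features_list: "good_list t l \<Longrightarrow> features d x (list_acts l) t"
  by unfold_locales (auto simp: good_list_def list_acts_def)

lemma features_list_norm: "good_list t l \<Longrightarrow> k < t \<Longrightarrow> vnorm (x (list_acts l (Suc k))) \<le> 1"
  by (auto simp: good_list_def list_acts_def)

lemma past_arms_measurable:
  assumes "\<And>k. k \<in> {1..t} \<Longrightarrow> a k \<in> measurable G (count_space UNIV)"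
  shows "past_arms t \<in> measurable G (count_space UNIV)"
  using assms
proof (induction t)
  case 0
  have "past_arms 0 = (\<lambda>\<omega>. [])" by (auto simp: past_arms_def fun_eq_iff)
  then show ?case by simp
next
  case (Suc t)
  have IH: "past_arms t \<in> measurable G (count_space UNIV)" using Suc by auto
  have aS: "a (Suc t) \<in> measurable G (count_space UNIV)" using Suc.prems by auto
  have "(\<lambda>\<omega>. (\<lambda>l \<omega>. l @ [a (Suc t) \<omega>]) (past_arms t \<omega>) \<omega>) \<in> measurable G (count_space UNIV)"
  proof (rule measurable_compose_countable[OF _ IH])
    fix l :: "nat list"
    show "(\<lambda>\<omega>. l @ [a (Suc t) \<omega>]) \<in> measurable G (count_space UNIV)"
      by (rule measurable_compose[OF aS]) simp
  qed
  then show ?case by (simp add: past_arms_def)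
qed

lemma measurable_past_fun:
  fixes f :: "'a \<Rightarrow> real"
  assumes "space G = space M" "t \<le> T" "\<And>k. k \<in> {1..t} \<Longrightarrow> a k \<in> measurable G (count_space UNIV)"
    and "\<And>l. good_list t l \<Longrightarrow> g l \<in> borel_measurable G"
    and "\<And>\<omega>. \<omega> \<in> space M \<Longrightarrow> f \<omega> = g (past_arms t \<omega>) \<omega>"
  shows "f \<in> borel_measurable G"
proof -
  \<comment> \<open>Outside \<open>good_list\<close> the vectors may have the wrong dimension. No
    run produces such a list, so the value 0 there is harmless.\<close>
  let ?h = "\<lambda>l \<omega>. if good_list t l then g l \<omega> else 0"
  have "(\<lambda>\<omega>. ?h (past_arms t \<omega>) \<omega>) \<in> borel_measurable G"
  proof (rule measurable_compose_countable[OF _ past_arms_measurable[OF assms(3)]])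
    fix l show "?h l \<in> borel_measurable G" using assms(4)[of l] by (cases "good_list t l") auto
  qed
  note m = this
  have "f \<omega> = ?h (past_arms t \<omega>) \<omega>" if "\<omega> \<in> space G" for \<omega>
    using that assms(1,2,5) good_past by auto
  from iffD2[OF measurable_cong[OF this] m] show ?thesis .
qed

lemma weighted_sum_measurable:
  assumes "good_list t l" "\<And>k. k \<in> {1..t} \<Longrightarrow> c k \<in> borel_measurable G" "i < d"
  shows "(\<lambda>\<omega>. weighted_sum d x (list_acts l) (\<lambda>k. c k \<omega>) t $ i) \<in> borel_measurable G"
  unfolding weighted_sum_index[OF features_list[OF assms(1)] assms(3)]
  using assms(2) by (intro borel_measurable_sum borel_measurable_times) auto

lemma mult_vec_index:
  fixes B :: rmat
  assumes "B \<in> carrier_mat d d" "v \<in> carrier_vec d" "i < d"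
  shows "(B *\<^sub>v v) $ i = (\<Sum>j<d. B $$ (i, j) * v $ j)"
  using assms by (simp add: scalar_prod_def atLeast0LessThan)

lemma sampled_param_measurable:
  assumes l: "good_list (t - 1) l" and r: "\<And>k. k \<in> {1..<t} \<Longrightarrow> r k \<in> borel_measurable G"
    and xi: "\<And>i. i < d \<Longrightarrow> (\<lambda>\<omega>. \<xi> t \<omega> i) \<in> borel_measurable G" and i: "i < d"
  shows "(\<lambda>\<omega>. sampled_param d T delta x (list_acts l) (\<lambda>k. r k \<omega>) t (\<xi> t \<omega>) $ i) \<in> borel_measurable G"
proof -
  let ?V = "gram_mat d x (list_acts l) (t - 1)"
  note f = features_list[OF l]
  note W = minv(1)[OF ge_one_gram[OF f]] and B = inv_sqrt_gram(1)[OF f features_list_norm[OF l]]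
  have ws: "weighted_sum d x (list_acts l) (\<lambda>k. r k \<omega>) (t - 1) \<in> carrier_vec d" for \<omega>
    by (rule weighted_sum_carrier[OF f])
  have "sampled_param d T delta x (list_acts l) (\<lambda>k. r k \<omega>) t (\<xi> t \<omega>) $ i
     = (\<Sum>j<d. minv ?V $$ (i, j) * weighted_sum d x (list_acts l) (\<lambda>k. r k \<omega>) (t - 1) $ j)
       + conf_radius d T (delta / (4 * real T)) * (\<Sum>j<d. inv_sqrt_mat d ?V $$ (i, j) * \<xi> t \<omega> j)" for \<omega>
    unfolding sampled_param_def theta_hat_eq[OF f]
    using i W B ws[of \<omega>] mult_vec_index[OF W ws i] mult_vec_index[OF B, of "Matrix.vec d (\<xi> t \<omega>)" i]
    by simp
  moreover have "(\<lambda>\<omega>. weighted_sum d x (list_acts l) (\<lambda>k. r k \<omega>) (t - 1) $ j) \<in> borel_measurable G"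
    if "j < d" for j
    by (rule weighted_sum_measurable[OF l _ that]) (rule r, auto)
  ultimately show ?thesis
    using xi
    by (simp only:) (intro borel_measurable_add borel_measurable_times borel_measurable_sum borel_measurable_const, auto)
qed

lemma sqrt_measurable: "f \<in> borel_measurable G \<Longrightarrow> (\<lambda>\<omega>. sqrt (f \<omega>)) \<in> borel_measurable G"
  by measurable

lemma query_dist_measurable:
  assumes G: "space G = space M" and t: "t \<in> {1..T}"
    and am: "\<And>k. k \<in> {1..<t} \<Longrightarrow> a k \<in> measurable G (count_space UNIV)"
    and r: "\<And>k. k \<in> {1..<t} \<Longrightarrow> r k \<in> borel_measurable G"
    and xi: "\<And>i. i < d \<Longrightarrow> (\<lambda>\<omega>. \<xi> t \<omega> i) \<in> borel_measurable G"
    and v: "v \<in> carrier_vec d"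
  shows "(\<lambda>\<omega>. vnorm (qry t \<omega> - v)) \<in> borel_measurable G"
proof (rule measurable_past_fun[OF G, where t="t - 1" and
      g="\<lambda>l \<omega>. vnorm (ts_query d T delta x (list_acts l) (\<lambda>k. r k \<omega>) t (\<xi> t \<omega>) - v)"])
  fix l assume l: "good_list (t - 1) l"
  let ?p = "\<lambda>\<omega>. sampled_param d T delta x (list_acts l) (\<lambda>k. r k \<omega>) t (\<xi> t \<omega>)"
  have c: "?p \<omega> \<in> carrier_vec d" for \<omega>
    by (rule sampled_param_carrier[OF features_list[OF l] features_list_norm[OF l]])
  have pm: "(\<lambda>\<omega>. ?p \<omega> $ i) \<in> borel_measurable G" if "i < d" for i
    by (rule sampled_param_measurable[OF l r xi that])
  have nm: "vnorm u = sqrt (\<Sum>i<d. u $ i * u $ i)" if "u \<in> carrier_vec d" for u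
    using that by (simp add: vnorm_def scalar_prod_def atLeast0LessThan)
  have vm: "(\<lambda>\<omega>. vnorm (?p \<omega>)) \<in> borel_measurable G"
    unfolding nm[OF c]
    by (intro sqrt_measurable borel_measurable_sum borel_measurable_times pm) auto
  have "vnorm ((1 / vnorm (?p \<omega>)) \<cdot>\<^sub>v ?p \<omega> - v)
     = sqrt (\<Sum>i<d. (1 / vnorm (?p \<omega>) * ?p \<omega> $ i - v $ i) * (1 / vnorm (?p \<omega>) * ?p \<omega> $ i - v $ i))" for \<omega>
    using c[of \<omega>] v by (subst nm) (auto intro!: sum.cong)
  then show "(\<lambda>\<omega>. vnorm (ts_query d T delta x (list_acts l) (\<lambda>k. r k \<omega>) t (\<xi> t \<omega>) - v)) \<in> borel_measurable G"
    unfolding ts_query_eq using pm vm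
    by (simp only:) (intro sqrt_measurable borel_measurable_sum borel_measurable_times borel_measurable_diff
        borel_measurable_divide borel_measurable_const, auto)
next
  fix \<omega>
  have "sampled_param d T delta x (\<lambda>k. a k \<omega>) (\<lambda>k. r k \<omega>) t (\<xi> t \<omega>)
     = sampled_param d T delta x (list_acts (past_arms (t - 1) \<omega>)) (\<lambda>k. r k \<omega>) t (\<xi> t \<omega>)"
    by (rule sampled_param_cong) (use past_arms_acts in auto)
  then show "vnorm (qry t \<omega> - v)
    = vnorm (ts_query d T delta x (list_acts (past_arms (t - 1) \<omega>)) (\<lambda>k. r k \<omega>) t (\<xi> t \<omega>) - v)"
    unfolding ts_query_eq by simp
qed (use t am in auto)

text \<open>The nearest grid points form a random subset of the finite grid, decided by finitely
  many comparisons of measurable distances, and rounding is a choice from that subset.\<close>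

lemma rq_measurable:
  assumes "space G = space M" "t \<in> {1..T}"
    "\<And>k. k \<in> {1..<t} \<Longrightarrow> a k \<in> measurable G (count_space UNIV)"
    "\<And>k. k \<in> {1..<t} \<Longrightarrow> r k \<in> borel_measurable G"
    "\<And>i. i < d \<Longrightarrow> (\<lambda>\<omega>. \<xi> t \<omega> i) \<in> borel_measurable G"
  shows "(\<lambda>\<omega>. rq t \<omega>) \<in> measurable G (count_space grd)"
proof -
  note fin = query_grid_finite(1)[OF ep_pos params(1)]
  have m: "(\<lambda>\<omega>. vnorm (qry t \<omega> - v)) \<in> borel_measurable G" if "v \<in> grd" for v
    using that by (intro query_dist_measurable assms) (auto simp: query_grid_def unit_ball_def)
  let ?U = "\<lambda>\<omega>. {v. is_arg_min (\<lambda>v. vnorm (qry t \<omega> - v)) (\<lambda>v. v \<in> grd) v}"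
  have "(\<lambda>\<omega>. (\<lambda>U. SOME v. v \<in> U) (?U \<omega>)) \<in> measurable G (count_space UNIV)"
  proof (rule measurable_finite_set_function[OF fin])
    fix v assume v: "v \<in> grd"
    have "{\<omega> \<in> space G. v \<in> ?U \<omega>} = {\<omega> \<in> space G. \<forall>u\<in>grd. \<not> vnorm (qry t \<omega> - u) < vnorm (qry t \<omega> - v)}"
      using v by (auto simp: is_arg_min_def)
    also have "\<dots> \<in> sets G"
    proof (intro sets.sets_Collect_finite_All fin)
      fix u assume u: "u \<in> grd"
      have "{\<omega> \<in> space G. vnorm (qry t \<omega> - v) \<le> vnorm (qry t \<omega> - u)} \<in> sets G"
        by (rule borel_measurable_le[OF m[OF v] m[OF u]])
      then show "{\<omega> \<in> space G. \<not> vnorm (qry t \<omega> - u) < vnorm (qry t \<omega> - v)} \<in> sets G" by (simp add: not_less)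
    qed
    finally show "{\<omega> \<in> space G. v \<in> ?U \<omega>} \<in> sets G" .
  qed (auto simp: is_arg_min_def)
  then have "(\<lambda>\<omega>. rq t \<omega>) \<in> measurable G (count_space UNIV)"
    by (simp add: round_query_def arg_min_on_def arg_min_def)
  then show ?thesis
    using rq_grd by (auto simp: measurable_def)
qed

text \<open>At a fixed grid point, the answers of all copies make up a random finite table that
  determines the arm. The grid point is itself random, but takes finitely many values.\<close>

lemma arm_measurable_step:
  assumes G: "space G = space M" and t: "t \<in> {1..T}"
    and sm: "\<And>i j. i \<in> {1..nn} \<Longrightarrow> j < kap \<Longrightarrow> s i j \<in> measurable G (seed S d (par_c i) (par_r d eta i) K)"
    and rest: "\<And>k. k \<in> {1..<t} \<Longrightarrow> a k \<in> measurable G (count_space UNIV)"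
    "\<And>k. k \<in> {1..<t} \<Longrightarrow> r k \<in> borel_measurable G"
    "\<And>i. i < d \<Longrightarrow> (\<lambda>\<omega>. \<xi> t \<omega> i) \<in> borel_measurable G"
  shows "a t \<in> measurable G (count_space UNIV)"
proof -
  define Tab where "Tab v \<omega> = {(i, j, q). i \<in> {1..nn} \<and> j < kap \<and> ans t i j v \<omega> = Some q}" for v \<omega>
  define rs where "rs U i = (let R = {q. \<exists>j<kap. (i, j, q) \<in> U} in if R = {} then None else Some (SOME q. q \<in> R))"
    for U :: "(nat \<times> nat \<times> rvec) set" and i
  define ix where "ix U = bsearch (\<lambda>i. rs U i \<noteq> None) 0 (Suc nn)" for U
  define arm where "arm U = (if ix U = 0 then dflt t else SOME e. e \<in> A t \<and> Some (x e) = rs U (ix U))" for U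
  have tT: "t \<le> T" using t by simp
  have rs: "rs (Tab v \<omega>) i = res t i v \<omega>" if "i \<in> {1..nn}" for v \<omega> i
    using that by (simp add: rs_def res_def Tab_def)
  have ix: "ix (Tab v \<omega>) = idx t v \<omega>" for v \<omega>
    unfolding ix_def idx_def by (rule bsearch_cong) (simp add: rs)
  have eq: "a t \<omega> = arm (Tab (rq t \<omega>) \<omega>)" if "\<omega> \<in> space G" for \<omega>
    using arm_eq[OF t, of \<omega>] that idx_facts(1)[of t "rq t \<omega>" \<omega>] rs[of "idx t (rq t \<omega>) \<omega>" "rq t \<omega>" \<omega>]
    by (cases "idx t (rq t \<omega>) \<omega> = 0") (auto simp: arm_def ix G)
  have "(\<lambda>\<omega>. (\<lambda>v \<omega>. arm (Tab v \<omega>)) (rq t \<omega>) \<omega>) \<in> measurable G (count_space UNIV)"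
  proof (rule measurable_compose_countable'[OF _ rq_measurable[OF G t rest]])
    show "countable grd" by (rule countable_finite[OF query_grid_finite(1)[OF ep_pos params(1)]])
    fix v assume v: "v \<in> grd"
    show "(\<lambda>\<omega>. arm (Tab v \<omega>)) \<in> measurable G (count_space UNIV)"
    proof (rule measurable_finite_set_function[where \<Gamma>="{1..nn} \<times> {..<kap} \<times> x ` A t"])
      show "finite ({1..nn} \<times> {..<kap} \<times> x ` A t)" using arms[OF tT] by auto
      show "Tab v \<omega> \<subseteq> {1..nn} \<times> {..<kap} \<times> x ` A t" if "\<omega> \<in> space G" for \<omega>
        using solver_facts(4)[OF _ tT v seed_space] that by (auto simp: Tab_def G)
      fix g assume "g \<in> {1..nn} \<times> {..<kap} \<times> x ` A t"
      then obtain i j q where g: "g = (i, j, q)" "i \<in> {1..nn}" "j < kap" by auto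
      have "(\<lambda>\<omega>. ans t i j v \<omega>) \<in> measurable G (count_space UNIV)"
        by (rule measurable_compose[OF sm[OF g(2,3)] solver_facts(2)[OF g(2) tT v]])
      then have "(\<lambda>\<omega>. ans t i j v \<omega>) -` {Some q} \<inter> space G \<in> sets G"
        by (rule measurable_sets) simp
      moreover have "(\<lambda>\<omega>. ans t i j v \<omega>) -` {Some q} \<inter> space G = {\<omega> \<in> space G. g \<in> Tab v \<omega>}"
        using g by (auto simp: Tab_def)
      ultimately show "{\<omega> \<in> space G. g \<in> Tab v \<omega>} \<in> sets G" by simp
    qed
  qed
  from iffD2[OF measurable_cong[OF eq] this] show ?thesis .
qed

text \<open>The sigma-algebra \<open>sampling_past\<close> is generated by seeds, samples and
  rewards without the arms; these are reconstructed step by step from the earlier ones.\<close>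

lemma arms_measurable:
  assumes G: "space G = space M"
    and sm: "\<And>i j. i \<in> {1..nn} \<Longrightarrow> j < kap \<Longrightarrow> s i j \<in> measurable G (seed S d (par_c i) (par_r d eta i) K)"
    and r: "\<And>k. k \<in> {1..<t} \<Longrightarrow> r k \<in> borel_measurable G"
    and xi: "\<And>k i. k \<in> {1..t} \<Longrightarrow> i < d \<Longrightarrow> (\<lambda>\<omega>. \<xi> k \<omega> i) \<in> borel_measurable G"
    and t: "t \<le> T" and k: "k \<in> {1..t}"
  shows "a k \<in> measurable G (count_space UNIV)"
  using k
proof (induction k rule: less_induct)
  case (less k)
  show ?case
    by (rule arm_measurable_step[OF G _ sm]) (use less t r xi in auto)
qed

end

section \<open>Generated sigma-algebras and Markov's inequality\<close>

lemma subalgebra_vimage: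
  assumes f: "f \<in> measurable M N"
  shows "subalgebra M (vimage_algebra (space M) f N)"
proof -
  have "f \<in> space M \<rightarrow> space N" using measurable_space[OF f] by auto
  from sets_vimage_algebra2[OF this] show ?thesis
    using measurable_sets[OF f] by (auto simp: subalgebra_def)
qed

lemma measurable_vimage_comp:
  assumes f: "f \<in> measurable M N" and h: "h \<in> measurable N B"
    and eq: "\<And>\<omega>. \<omega> \<in> space M \<Longrightarrow> g \<omega> = h (f \<omega>)"
  shows "g \<in> measurable (vimage_algebra (space M) f N) B"
proof -
  have "f \<in> space M \<rightarrow> space N" using measurable_space[OF f] by auto
  from measurable_compose[OF measurable_vimage_algebra1[OF this] h]
  have m: "(\<lambda>\<omega>. h (f \<omega>)) \<in> measurable (vimage_algebra (space M) f N) B" .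
  have "g \<omega> = h (f \<omega>)" if "\<omega> \<in> space (vimage_algebra (space M) f N)" for \<omega> using that eq by simp
  from iffD2[OF measurable_cong[OF this] m] show ?thesis .
qed

lemma form_eq_sum:
  fixes X :: rmat
  assumes "u \<in> carrier_vec n" "v \<in> carrier_vec n" "X \<in> carrier_mat n n"
  shows "u \<bullet> (X *\<^sub>v v) = (\<Sum>i<n. \<Sum>j<n. u $ i * X $$ (i, j) * v $ j)"
  using assms by (auto simp: scalar_prod_def sum_distrib_left atLeast0LessThan mult.assoc intro!: sum.cong)

lemma (in prob_space) prob_ge_le_of_nn_integral:
  assumes m: "(\<lambda>\<omega>. ennreal (u \<omega>)) \<in> borel_measurable M" and le: "(\<integral>\<^sup>+ \<omega>. ennreal (u \<omega>) \<partial>M) \<le> 1" and c: "0 < c"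
  shows "{\<omega> \<in> space M. 1 \<le> c * u \<omega>} \<in> events" "prob {\<omega> \<in> space M. 1 \<le> c * u \<omega>} \<le> c"
proof -
  have eq: "{\<omega> \<in> space M. 1 \<le> c * u \<omega>} = {\<omega> \<in> space M. 1 \<le> ennreal c * ennreal (u \<omega>)}"
    using c by (auto simp: ennreal_mult'[symmetric])
  have "(\<lambda>\<omega>. ennreal c * ennreal (u \<omega>)) \<in> borel_measurable M" using m by measurable
  then show "{\<omega> \<in> space M. 1 \<le> c * u \<omega>} \<in> events" unfolding eq by measurable
  have "emeasure M {\<omega> \<in> space M. 1 \<le> ennreal c * ennreal (u \<omega>)} \<le> ennreal c * (\<integral>\<^sup>+ \<omega>. ennreal (u \<omega>) * indicator (space M) \<omega> \<partial>M)"
    using m by (intro nn_integral_Markov_inequality) auto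
  also have "(\<integral>\<^sup>+ \<omega>. ennreal (u \<omega>) * indicator (space M) \<omega> \<partial>M) = (\<integral>\<^sup>+ \<omega>. ennreal (u \<omega>) \<partial>M)"
    by (intro nn_integral_cong) simp
  also have "ennreal c * \<dots> \<le> ennreal c * 1" by (intro mult_left_mono le) simp
  finally have "ennreal (prob {\<omega> \<in> space M. 1 \<le> c * u \<omega>}) \<le> ennreal c" by (simp add: eq emeasure_eq_measure)
  then show "prob {\<omega> \<in> space M. 1 \<le> c * u \<omega>} \<le> c" using c by simp
qed

context ts_run
begin

section \<open>Confidence ellipsoids\<close>

lemma noise_M: "t \<in> {1..T} \<Longrightarrow> noise t \<in> borel_measurable M"
  using noise_mean by blast

lemma mean_arm_measurable:
  "a t \<in> measurable G (count_space UNIV) \<Longrightarrow> (\<lambda>\<omega>. theta \<bullet> x (a t \<omega>)) \<in> borel_measurable G"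
  by (rule measurable_compose[where N="count_space UNIV" and g="\<lambda>e. theta \<bullet> x e"]) auto

lemma reward_M:
  assumes "t \<in> {1..T}"
  shows "r t \<in> borel_measurable M"
proof -
  have "(\<lambda>\<omega>. theta \<bullet> x (a t \<omega>) + noise t \<omega>) \<in> borel_measurable M"
    by (intro borel_measurable_add mean_arm_measurable arm_measurable noise_M assms)
  from iffD2[OF measurable_cong[OF rewards[OF assms]] this] show ?thesis .
qed

lemma filtration_map:
  assumes "t \<le> T"
  shows "(\<lambda>\<omega>. (\<lambda>k\<in>{1..t}. a k \<omega>, \<lambda>k\<in>{1..<t}. r k \<omega>)) \<in> measurable M
    ((\<Pi>\<^sub>M k\<in>{1..t}. count_space UNIV) \<Otimes>\<^sub>M (\<Pi>\<^sub>M k\<in>{1..<t}. borel))"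
  using assms by (intro measurable_Pair measurable_restrict arm_measurable reward_M) auto

lemma filtration_subalgebra:
  assumes "t \<le> T"
  shows "subalgebra M (noise_filtration M a r t)"
  unfolding noise_filtration_def by (rule subalgebra_vimage[OF filtration_map[OF assms]])

lemma filtration_space [simp]: "space (noise_filtration M a r t) = space M"
  by (simp add: noise_filtration_def)

lemma filtration_arm:
  assumes "t \<le> T" "k \<in> {1..t}"
  shows "a k \<in> measurable (noise_filtration M a r t) (count_space UNIV)"
  unfolding noise_filtration_def
  by (rule measurable_vimage_comp[OF filtration_map[OF assms(1)]
        measurable_compose[OF measurable_fst measurable_component_singleton[OF assms(2)]]])
    (use assms in auto)

lemma filtration_reward:
  assumes "t \<le> T" "k \<in> {1..<t}"
  shows "r k \<in> borel_measurable (noise_filtration M a r t)"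
  unfolding noise_filtration_def
  by (rule measurable_vimage_comp[OF filtration_map[OF assms(1)]
        measurable_compose[OF measurable_snd measurable_component_singleton[OF assms(2)]]])
    (use assms in auto)

text \<open>The filtration is generated by arms and rewards, and the noise is the reward minus the
  mean of the arm played.\<close>

lemma filtration_noise:
  assumes "t \<le> T" "k \<in> {1..<t}"
  shows "noise k \<in> borel_measurable (noise_filtration M a r t)"
proof -
  have "(\<lambda>\<omega>. r k \<omega> - theta \<bullet> x (a k \<omega>)) \<in> borel_measurable (noise_filtration M a r t)"
    using assms by (intro borel_measurable_diff filtration_reward mean_arm_measurable filtration_arm) auto
  note m = this
  have "noise k \<omega> = r k \<omega> - theta \<bullet> x (a k \<omega>)" if "\<omega> \<in> space (noise_filtration M a r t)" for \<omega>
    using rewards[of k \<omega>] that assms by simp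
  from iffD2[OF measurable_cong[OF this] m] show ?thesis .
qed

definition noise_width :: "nat \<Rightarrow> 'a \<Rightarrow> real" where
  "noise_width t \<omega> = width d x (\<lambda>k. a k \<omega>) t (weighted_sum d x (\<lambda>k. a k \<omega>) (\<lambda>k. noise k \<omega>) t)"

text \<open>The closed form of the integral of exp (\<lambda> . S - \<lambda> . (V - 1) \<lambda> /
  2) over a standard Gaussian vector \<lambda>, where S is the noise vector and V the Gram
  matrix.\<close>

definition mixture :: "nat \<Rightarrow> 'a \<Rightarrow> real" where
  "mixture t \<omega> = exp (noise_width t \<omega> / 2) / sqrt (Determinant.det (gram_mat d x (\<lambda>k. a k \<omega>) t))"

lemma gram_past: "gram_mat d x (\<lambda>k. a k \<omega>) t = gram_mat d x (list_acts (past_arms t \<omega>)) t"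
  by (rule gram_cong) (simp add: past_arms_acts)

lemma mixture_measurable:
  assumes G: "space G = space M" and t: "t \<le> T"
    and am: "\<And>k. k \<in> {1..t} \<Longrightarrow> a k \<in> measurable G (count_space UNIV)"
    and nm: "\<And>k. k \<in> {1..t} \<Longrightarrow> noise k \<in> borel_measurable G"
  shows "mixture t \<in> borel_measurable G"
proof (rule measurable_past_fun[OF G t am, where g="\<lambda>l \<omega>.
    exp (width d x (list_acts l) t (weighted_sum d x (list_acts l) (\<lambda>k. noise k \<omega>) t) / 2) /
    sqrt (Determinant.det (gram_mat d x (list_acts l) t))"])
  fix l assume l: "good_list t l"
  note f = features_list[OF l]
  have w: "(\<lambda>\<omega>. weighted_sum d x (list_acts l) (\<lambda>k. noise k \<omega>) t $ i) \<in> borel_measurable G" if "i < d" for i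
    by (rule weighted_sum_measurable[OF l nm that])
  have "(\<lambda>\<omega>. width d x (list_acts l) t (weighted_sum d x (list_acts l) (\<lambda>k. noise k \<omega>) t)) \<in> borel_measurable G"
    unfolding width_def form_eq_sum[OF weighted_sum_carrier[OF f] weighted_sum_carrier[OF f] minv(1)[OF ge_one_gram[OF f]]]
    using w by (intro borel_measurable_sum borel_measurable_times borel_measurable_const) auto
  then show "(\<lambda>\<omega>. exp (width d x (list_acts l) t (weighted_sum d x (list_acts l) (\<lambda>k. noise k \<omega>) t) / 2) /
    sqrt (Determinant.det (gram_mat d x (list_acts l) t))) \<in> borel_measurable G"
    by measurable
next
  fix \<omega>
  have "weighted_sum d x (\<lambda>k. a k \<omega>) (\<lambda>k. noise k \<omega>) t = weighted_sum d x (list_acts (past_arms t \<omega>)) (\<lambda>k. noise k \<omega>) t"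
    by (rule weighted_sum_cong) (simp_all add: past_arms_acts)
  then show "mixture t \<omega> = exp (width d x (list_acts (past_arms t \<omega>)) t
      (weighted_sum d x (list_acts (past_arms t \<omega>)) (\<lambda>k. noise k \<omega>) t) / 2) /
    sqrt (Determinant.det (gram_mat d x (list_acts (past_arms t \<omega>)) t))"
    by (simp add: mixture_def noise_width_def width_def gram_past)
qed

text \<open>Both the exponent and the determinant change by a rank-one formula; together the
  quotient is the value of the one-dimensional Gaussian integral.\<close>

lemma mixture_Suc:
  assumes t: "t < T" and w: "\<omega> \<in> space M"
  defines "e \<equiv> noise (Suc t) \<omega>"
    and "y \<equiv> x (a (Suc t) \<omega>) \<bullet> (minv (gram_mat d x (\<lambda>k. a k \<omega>) t) *\<^sub>v weighted_sum d x (\<lambda>k. a k \<omega>) (\<lambda>k. noise k \<omega>) t)"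
    and "v \<equiv> width d x (\<lambda>k. a k \<omega>) t (x (a (Suc t) \<omega>))"
  shows "mixture (Suc t) \<omega> = mixture t \<omega> * (exp ((2 * e * y + e\<^sup>2 * v - y\<^sup>2) / (2 * (1 + v))) / sqrt (1 + v))"
proof -
  have f: "features d x (\<lambda>k. a k \<omega>) (Suc t)" by (rule features_run[OF _ w]) (use t in simp)
  show ?thesis
    unfolding mixture_def noise_width_def width_weighted_sum_Suc[OF f] det_gram_Suc[OF f] e_def y_def v_def
    by (simp add: add_divide_distrib exp_add real_sqrt_mult)
qed

lemma nn_integral_mixture_le: "t \<le> T \<Longrightarrow> (\<integral>\<^sup>+ \<omega>. ennreal (mixture t \<omega>) \<partial>M) \<le> 1"
proof (induction t)
  case 0
  have "features d x (\<lambda>_. 0) 0" by unfold_locales simp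
  from minv(1)[OF ge_one_gram[OF this]] have "minv (1\<^sub>m d) *\<^sub>v 0\<^sub>v d \<in> carrier_vec d" by simp
  then have "ennreal (mixture 0 \<omega>) = 1" for \<omega>
    by (simp add: mixture_def noise_width_def width_def Determinant.det_one)
  then show ?case by (simp add: emeasure_space_1)
next
  case (Suc t)
  \<comment> \<open>Generated by the arms up to step \<open>Suc t\<close> and the rewards up to step
    \<open>t\<close>: the new direction and its width are known, the new noise is not.\<close>
  let ?F = "noise_filtration M a r (Suc t)"
  let ?y = "\<lambda>\<omega>. x (a (Suc t) \<omega>) \<bullet> (minv (gram_mat d x (\<lambda>k. a k \<omega>) t) *\<^sub>v weighted_sum d x (\<lambda>k. a k \<omega>) (\<lambda>k. noise k \<omega>) t)"
  let ?v = "\<lambda>\<omega>. width d x (\<lambda>k. a k \<omega>) t (x (a (Suc t) \<omega>))"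
  have tT: "t < T" "t \<le> T" using Suc by auto
  have am: "a k \<in> measurable ?F (count_space UNIV)" if "k \<in> {1..Suc t}" for k
    by (rule filtration_arm[OF Suc.prems that])
  have nm: "noise k \<in> borel_measurable ?F" if "k \<in> {1..t}" for k
    by (rule filtration_noise[OF Suc.prems]) (use that in auto)
  have features_t: "features d x (list_acts l) t" if "good_list (Suc t) l" for l
    using features.feat_mono[OF features_list[OF that], of t] by simp
  have Z: "mixture t \<in> borel_measurable ?F" using am nm by (intro mixture_measurable tT) auto
  have last: "x (list_acts l (Suc t)) \<in> carrier_vec d" if "good_list (Suc t) l" for l
    using features.feat_Suc[OF features_list[OF that] lessI] .
  have past: "list_acts (past_arms (Suc t) \<omega>) k = a k \<omega>" if "k \<in> {1..Suc t}" for k \<omega>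
    by (rule past_arms_acts[OF that])
  have gp: "gram_mat d x (\<lambda>k. a k \<omega>) t = gram_mat d x (list_acts (past_arms (Suc t) \<omega>)) t" for \<omega>
    by (rule gram_cong) (simp add: past)
  have y: "?y \<in> borel_measurable ?F"
  proof (rule measurable_past_fun[OF filtration_space Suc.prems am, where g="\<lambda>l \<omega>. x (list_acts l (Suc t)) \<bullet>
      (minv (gram_mat d x (list_acts l) t) *\<^sub>v weighted_sum d x (list_acts l) (\<lambda>k. noise k \<omega>) t)"])
    fix l assume l: "good_list (Suc t) l"
    note f = features_t[OF l]
    have w: "(\<lambda>\<omega>. weighted_sum d x (list_acts l) (\<lambda>k. noise k \<omega>) t $ i) \<in> borel_measurable ?F" if i: "i < d" for i
      unfolding weighted_sum_index[OF f i] by (intro borel_measurable_sum borel_measurable_times nm) auto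
    show "(\<lambda>\<omega>. x (list_acts l (Suc t)) \<bullet> (minv (gram_mat d x (list_acts l) t) *\<^sub>v
        weighted_sum d x (list_acts l) (\<lambda>k. noise k \<omega>) t)) \<in> borel_measurable ?F"
      unfolding form_eq_sum[OF last[OF l] weighted_sum_carrier[OF f] minv(1)[OF ge_one_gram[OF f]]]
      using w by (intro borel_measurable_sum borel_measurable_times borel_measurable_const) auto
  next
    fix \<omega>
    have "weighted_sum d x (\<lambda>k. a k \<omega>) (\<lambda>k. noise k \<omega>) t = weighted_sum d x (list_acts (past_arms (Suc t) \<omega>)) (\<lambda>k. noise k \<omega>) t"
      by (rule weighted_sum_cong) (simp_all add: past)
    then show "?y \<omega> = x (list_acts (past_arms (Suc t) \<omega>) (Suc t)) \<bullet> (minv (gram_mat d x (list_acts (past_arms (Suc t) \<omega>)) t) *\<^sub>v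
        weighted_sum d x (list_acts (past_arms (Suc t) \<omega>)) (\<lambda>k. noise k \<omega>) t)"
      by (simp add: gp past)
  qed
  have v: "?v \<in> borel_measurable ?F"
    by (rule measurable_past_fun[OF filtration_space Suc.prems am, where
          g="\<lambda>l \<omega>. width d x (list_acts l) t (x (list_acts l (Suc t)))"])
      (simp_all add: width_def gp past)
  have v0: "0 \<le> ?v \<omega>" if "\<omega> \<in> space M" for \<omega>
    by (rule width_bounds(1)[OF features_run[OF tT(2) that] arm_feature(1)[OF _ that]]) (use tT in auto)
  have "(\<integral>\<^sup>+ \<omega>. ennreal (mixture (Suc t) \<omega>) \<partial>M)
    = (\<integral>\<^sup>+ \<omega>. ennreal (mixture t \<omega>) * ennreal (exp ((2 * noise (Suc t) \<omega> * ?y \<omega> + (noise (Suc t) \<omega>)\<^sup>2 * ?v \<omega> - (?y \<omega>)\<^sup>2) /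
         (2 * (1 + ?v \<omega>))) / sqrt (1 + ?v \<omega>)) \<partial>M)"
  proof (intro nn_integral_cong)
    fix \<omega> assume w: "\<omega> \<in> space M"
    show "ennreal (mixture (Suc t) \<omega>) = ennreal (mixture t \<omega>) * ennreal (exp ((2 * noise (Suc t) \<omega> * ?y \<omega> + (noise (Suc t) \<omega>)\<^sup>2 * ?v \<omega> - (?y \<omega>)\<^sup>2) /
         (2 * (1 + ?v \<omega>))) / sqrt (1 + ?v \<omega>))"
      unfolding mixture_Suc[OF tT(1) w] using v0[OF w] by (intro ennreal_mult'') simp
  qed
  also have "\<dots> \<le> (\<integral>\<^sup>+ \<omega>. ennreal (mixture t \<omega>) \<partial>M)"
  proof -
    have St: "Suc t \<in> {1..T}" using Suc.prems by simp
    have "(\<lambda>\<omega>. ennreal (mixture t \<omega>)) \<in> borel_measurable ?F" using Z by measurable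
    from nn_integral_mixture_step[OF prob_space_axioms filtration_subalgebra[OF Suc.prems] noise_M[OF St]
        noise_subgaussian[OF St] this y v v0]
    show ?thesis .
  qed
  also have "\<dots> \<le> 1" using Suc.IH tT by simp
  finally show ?case .
qed

text \<open>Markov's inequality is applied at each time separately, at the level
  \<open>delta / (4 T)\<close> that enters the confidence radius. A union bound over the steps takes
  the place of a maximal inequality.\<close>

definition conf_bad :: "nat \<Rightarrow> 'a set" where
  "conf_bad t = {\<omega> \<in> space M. 1 \<le> delta / (4 * real T) * mixture t \<omega>}"

lemma conf_bad:
  assumes "t \<le> T"
  shows "conf_bad t \<in> events" "prob (conf_bad t) \<le> delta / (4 * real T)"
proof -
  have "mixture t \<in> borel_measurable M"
    using assms by (intro mixture_measurable arm_measurable noise_M) auto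
  then have "(\<lambda>\<omega>. ennreal (mixture t \<omega>)) \<in> borel_measurable M" by measurable
  moreover have "0 < delta / (4 * real T)" using params by simp
  ultimately show "conf_bad t \<in> events" "prob (conf_bad t) \<le> delta / (4 * real T)"
    unfolding conf_bad_def using prob_ge_le_of_nn_integral[OF _ nn_integral_mixture_le[OF assms]] by blast+
qed

abbreviation "beta \<equiv> conf_radius d T (delta / (4 * real T))"

text \<open>Taking logarithms of \<open>mixture\<close> < 4 T / delta bounds
  \<open>noise_width\<close> by 2 ln (4 T / delta) plus the logarithm of the determinant, which is
  at most d ln (1 + T / d). The summand 1 accounts for the bias of the estimate.\<close>

lemma noise_width_le:
  assumes t: "t \<le> T" and w: "\<omega> \<in> space M" "\<omega> \<notin> conf_bad t"
  shows "1 + sqrt (noise_width t \<omega>) \<le> beta"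
proof -
  let ?D = "Determinant.det (gram_mat d x (\<lambda>k. a k \<omega>) t)"
  note f = features_run[OF t w(1)]
  have D: "0 < ?D" by (rule det_gram_pos[OF f])
  have "?D \<le> (1 + real t / real d) ^ d"
    by (rule det_gram_le[OF f]) (use features_norm[OF t w(1)] params in auto)
  also have "\<dots> \<le> (1 + real T / real d) ^ d" using t by (intro power_mono add_left_mono divide_right_mono) auto
  finally have "ln ?D \<le> ln ((1 + real T / real d) ^ d)" using D by simp
  also have "\<dots> = real d * ln (1 + real T / real d)" by (subst ln_realpow) (auto simp: add_pos_nonneg)
  finally have lnD: "ln ?D \<le> real d * ln (1 + real T / real d)" .
  have q: "0 < delta / (4 * real T)" using params by simp
  have mp: "0 < mixture t \<omega>" using D by (simp add: mixture_def)
  have "delta / (4 * real T) * mixture t \<omega> < 1" using w by (auto simp: conf_bad_def)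
  then have "ln (delta / (4 * real T) * mixture t \<omega>) < 0"
    using mult_pos_pos[OF q mp] by (subst ln_less_zero_iff) auto
  moreover have "ln (delta / (4 * real T) * mixture t \<omega>) = ln (delta / (4 * real T)) + (noise_width t \<omega> / 2 - ln ?D / 2)"
  proof -
    have "ln (delta / (4 * real T) * mixture t \<omega>) = ln (delta / (4 * real T)) + ln (mixture t \<omega>)"
      by (rule ln_mult_pos[OF q mp])
    moreover have "ln (mixture t \<omega>) = noise_width t \<omega> / 2 - ln ?D / 2"
      using D by (simp add: mixture_def ln_div ln_sqrt)
    ultimately show ?thesis by simp
  qed
  moreover have "ln (1 / (delta / (4 * real T))) = - ln (delta / (4 * real T))" using q params by (subst ln_div) auto
  ultimately have "noise_width t \<omega> \<le> 2 * ln (1 / (delta / (4 * real T))) + real d * ln (1 + real T / real d)"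
    using lnD by linarith
  then show ?thesis by (simp add: conf_radius_def)
qed


section \<open>Failure probability of the adaptive solvers\<close>

definition fail_at :: "nat \<Rightarrow> nat \<Rightarrow> rvec \<Rightarrow> 'a set" where
  "fail_at t i v = {\<omega> \<in> space M. \<forall>j<kap. \<not> solves_mips (par_c i) (par_r d eta i) 0 (x ` A t) v (ans t i j v \<omega>)}"

text \<open>For a fixed point \<open>v\<close> and fixed arm sets the success probability of a
  single copy applies, and independence of the seeds multiplies the failure probabilities.\<close>

lemma fail_at:
  assumes "t \<le> T" "i \<in> {1..nn}" "v \<in> grd"
  shows "fail_at t i v \<in> events" "prob (fail_at t i v) \<le> 0.1 ^ kap"
proof -
  let ?Sd = "seed S d (par_c i) (par_r d eta i) K"
  let ?Y = "{w \<in> space ?Sd. solves_mips (par_c i) (par_r d eta i) 0 (x ` A t) v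
     (answer S d (par_c i) (par_r d eta i) K w (point_history A x t) v)}"
  let ?X = "\<lambda>ij. s (fst ij) (snd ij)"
  let ?J = "{i} \<times> {..<kap}"
  note sf = solver_facts[OF assms(2,1,3)]
  interpret Sd: prob_space ?Sd by (rule sf(1))
  have J: "?J \<subseteq> I" using assms(2) by (auto simp: I_def)
  have NJ: "N ij = ?Sd" if "ij \<in> ?J" for ij using that by (auto simp: N_def)
  have Y: "?Y \<in> sets ?Sd"
  proof -
    have "?Y = (\<lambda>w. answer S d (par_c i) (par_r d eta i) K w (point_history A x t) v) -`
        {res. solves_mips (par_c i) (par_r d eta i) 0 (x ` A t) v res} \<inter> space ?Sd" by auto
    also have "\<dots> \<in> sets ?Sd" by (rule measurable_sets[OF sf(2)]) simp
    finally show ?thesis .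
  qed
  have cY: "space ?Sd - ?Y \<in> sets ?Sd" using Y by auto
  have Xm: "?X ij \<in> measurable M ?Sd" "distr M ?Sd (?X ij) = ?Sd" if "ij \<in> ?J" for ij
    using seeds[of ij] J that NJ[OF that] by auto
  have single: "prob (?X ij -` (space ?Sd - ?Y) \<inter> space M) \<le> 0.1" if "ij \<in> ?J" for ij
  proof -
    have "prob (?X ij -` (space ?Sd - ?Y) \<inter> space M) = measure (distr M ?Sd (?X ij)) (space ?Sd - ?Y)"
      by (rule measure_distr[OF Xm(1)[OF that] cY, symmetric])
    also have "\<dots> = 1 - measure ?Sd ?Y" unfolding Xm(2)[OF that] by (rule Sd.prob_compl[OF Y])
    also have "\<dots> \<le> 0.1" using sf(3) by simp
    finally show ?thesis .
  qed
  \<comment> \<open>Without copies the intersection would be the whole type and not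
    \<open>space M\<close>.\<close>
  have eq: "fail_at t i v = (if kap = 0 then space M else (\<Inter>ij\<in>?J. ?X ij -` (space ?Sd - ?Y) \<inter> space M))"
    using seed_space[OF assms(2)] by (auto simp: fail_at_def)
  show "fail_at t i v \<in> events"
    unfolding eq using Xm(1) cY by (auto intro!: sets.finite_INT measurable_sets)
  show "prob (fail_at t i v) \<le> 0.1 ^ kap"
  proof (cases "kap = 0")
    case True
    then show ?thesis by simp
  next
    case False
    then have ne: "?J \<noteq> {}" by auto
    have "prob (fail_at t i v) = prob (\<Inter>ij\<in>?J. ?X ij -` (space ?Sd - ?Y) \<inter> space M)" using False by (simp add: eq)
    also have "\<dots> = (\<Prod>ij\<in>?J. prob (?X ij -` (space ?Sd - ?Y) \<inter> space M))"
      by (rule indep_varsD[OF seeds_indep ne _ J]) (use NJ cY in auto)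
    also have "\<dots> \<le> (\<Prod>ij\<in>?J. 0.1)" using single by (intro prod_mono) auto
    also have "\<dots> = 0.1 ^ kap" by (simp add: card_cartesian_product)
    finally show ?thesis .
  qed
qed

definition solver_bad :: "'a set" where
  "solver_bad = (\<Union>tiv \<in> {1..T} \<times> {1..nn} \<times> grd. fail_at (fst tiv) (fst (snd tiv)) (snd (snd tiv)))"

lemma solver_bad:
  "solver_bad \<in> events"
  "prob solver_bad \<le> real T * real nn * (2 * real d / ep + 1) ^ d * 0.1 ^ kap"
proof -
  note g = query_grid_finite[OF ep_pos params(1)]
  let ?J = "{1..T} \<times> {1..nn} \<times> grd"
  have fin: "finite ?J" using g by auto
  show "solver_bad \<in> events" unfolding solver_bad_def using fail_at(1) fin by (intro sets.finite_UN) auto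
  have "prob solver_bad \<le> (\<Sum>tiv\<in>?J. prob (fail_at (fst tiv) (fst (snd tiv)) (snd (snd tiv))))"
    unfolding solver_bad_def using fail_at(1) fin by (intro finite_measure_subadditive_finite) auto
  also have "\<dots> \<le> (\<Sum>tiv\<in>?J. 0.1 ^ kap)" using fail_at(2) by (intro sum_mono) auto
  also have "\<dots> = real T * real nn * real (card grd) * 0.1 ^ kap" by (simp add: card_cartesian_product)
  also have "\<dots> \<le> real T * real nn * (2 * real d / ep + 1) ^ d * 0.1 ^ kap"
    using g(2) by (intro mult_right_mono mult_left_mono) auto
  finally show "prob solver_bad \<le> real T * real nn * (2 * real d / ep + 1) ^ d * 0.1 ^ kap" .
qed

lemma solved_outside:
  assumes "t \<in> {1..T}" "\<omega> \<in> space M" "\<omega> \<notin> solver_bad" "v \<in> grd"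
  shows "solved t v \<omega>"
  unfolding solved_def
proof
  fix i assume i: "i \<in> {1..nn}"
  have "\<omega> \<notin> fail_at t i v"
  proof
    assume "\<omega> \<in> fail_at t i v"
    then have "\<omega> \<in> solver_bad" unfolding solver_bad_def using assms i
      by (intro UN_I[of "(t, i, v)"]) auto
    then show False using assms(3) by simp
  qed
  then show "\<exists>j<kap. solves_mips (par_c i) (par_r d eta i) 0 (x ` A t) v (ans t i j v \<omega>)"
    using assms(2) by (auto simp: fail_at_def)
qed

lemma kap_ge: "real d * ln (2 * real d ^ 3 / (eta\<^sup>2 * delta)) \<le> real kap"
proof -
  have pos: "0 < 2 * real d ^ 3 / (eta\<^sup>2 * delta)" using params by simp
  have "ln (2 * real d ^ 3 / (eta\<^sup>2 * delta)) \<le> ln (real K * real d / (ep * par_delta d eta delta))"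
    using copies_arg_gt[OF params(1,6,7,4,5,3)] pos by (subst ln_le_cancel_iff) auto
  then have "real d * ln (2 * real d ^ 3 / (eta\<^sup>2 * delta)) \<le> real d * ln (real K * real d / (ep * par_delta d eta delta))"
    by (intro mult_left_mono) auto
  also have "\<dots> \<le> real kap" unfolding num_copies_def copies_def by linarith
  finally show ?thesis .
qed

text \<open>As \<open>kap\<close> \<ge> \<open>d * ln Y\<close> and 10 \<ge> exp (9/4), all copies
  fail at a fixed query with probability at most \<open>1 / Z ^ d\<close>. The grid has at most
  \<open>?g ^ d\<close> points with \<open>?g\<close> \<le> \<open>Z\<close>, so
  \<open>d - 1\<close> factors \<open>Z\<close> absorb as many factors \<open>?g\<close>; the last
  \<open>Z\<close> pays for the steps, the solvers and the remaining \<open>?g\<close>.\<close>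

lemma solver_bad_le:
  assumes eta: "eta = 1 / sqrt (real T)" and T: "256 \<le> T"
  shows "prob solver_bad \<le> delta / 2"
proof -
  define q where "q = sqrt (real T)"
  define Y where "Y = 2 * real d ^ 3 * real T / delta"
  \<comment> \<open>The exponent 9/4 lies between 2 and ln 10. A square of \<open>Y\<close> is
    consumed by steps, solvers and one grid factor; the surplus \<open>Y powr (1/4)\<close> is at
    least 4 because \<open>Y\<close> \<ge> 256.\<close>
  define Z where "Z = Y powr (9 / 4)"
  have q: "q * q = real T" "1 \<le> q" "eta = 1 / q" using T by (auto simp: q_def eta)
  have d1: "1 \<le> real d" using params(1) by simp
  have d3: "1 \<le> real d ^ 3" using d1 by simp
  have Yl: "2 * real d ^ 3 * real T \<le> Y"
  proof -
    have "2 * real d ^ 3 * real T * delta \<le> 2 * real d ^ 3 * real T * 1" using params by (intro mult_left_mono) auto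
    then show ?thesis using params by (simp add: Y_def le_divide_eq)
  qed
  have "1 * 256 \<le> 2 * real d ^ 3 * real T" using d3 T by (intro mult_mono) auto
  then have Y: "256 \<le> Y" using Yl by linarith
  have "(256 :: real) powr (1 / 4) = (4 ^ 4) powr (1 / 4)" by simp
  also have "\<dots> = 4" by (subst powr_realpow[symmetric]) (simp_all add: powr_powr)
  finally have "4 \<le> Y powr (1 / 4)" using powr_mono2[of "1 / 4" 256 Y] Y by simp
  then have "Y ^ 2 * 4 \<le> Y ^ 2 * Y powr (1 / 4)" by (intro mult_left_mono) auto
  also have "\<dots> = Z" using Y by (simp add: Z_def powr_add[symmetric] flip: powr_numeral)
  finally have Z: "4 * Y\<^sup>2 \<le> Z" by simp
  have Z0: "0 < Z" using Y by (simp add: Z_def)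
  have fail: "0.1 ^ kap \<le> 1 / Z ^ d"
  proof -
    \<comment> \<open>Fourth powers reduce the claim to 2.72^9 \<le> 10^4.\<close>
    have "exp (9 / 4 :: real) ^ 4 = exp 1 ^ 9" by (simp flip: exp_of_nat_mult)
    also have "\<dots> \<le> (272 / 100) ^ 9" using e_less_272 by (intro power_mono) auto
    also have "\<dots> \<le> 10 ^ 4" by (simp add: power_divide divide_le_eq)
    finally have e: "exp (9 / 4 :: real) \<le> 10" by (rule power_le_imp_le_base[of _ 3, simplified]) simp
    have "0.1 ^ kap = 1 / (10 :: real) ^ kap" by (simp add: power_divide)
    also have "\<dots> \<le> 1 / exp (9 / 4) ^ kap" using e by (intro divide_left_mono power_mono) auto
    also have "exp (9 / 4 :: real) ^ kap = exp (9 / 4 * real kap)" by (simp add: exp_of_nat_mult[symmetric] mult.commute)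
    also have "1 / \<dots> \<le> 1 / exp (9 / 4 * (real d * ln Y))"
      using kap_ge q params by (intro divide_left_mono) (auto simp: Y_def power_divide power2_eq_square)
    also have "exp (9 / 4 * (real d * ln Y)) = exp (9 / 4 * ln Y) ^ d"
      by (simp add: exp_of_nat_mult[symmetric] mult.commute mult.left_commute)
    also have "exp (9 / 4 * ln Y) = Z" using Y by (simp add: Z_def powr_def)
    finally show ?thesis .
  qed
  have n: "real nn \<le> 2 * real d * q"
  proof -
    have "real nn \<le> real d * q + 1" using nn_bounds(2) q by simp
    moreover have "1 \<le> real d * q" using mult_mono[of 1 "real d" 1 q] d1 q by simp
    ultimately show ?thesis by simp
  qed
  let ?g = "3 * real d ^ 2 * q"
  have g: "2 * real d / ep + 1 \<le> ?g"
  proof -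
    have "1 * 1 \<le> real d ^ 2 * q" using d1 q by (intro mult_mono) auto
    moreover have "2 * real d / ep = 2 * real d ^ 2 * q"
      using d1 q by (simp add: par_eps_def power2_eq_square)
    ultimately show ?thesis by linarith
  qed
  have gZ: "?g \<le> Z"
  proof -
    have "real d ^ 2 \<le> real d ^ 3" using d1 by (intro power_increasing) auto
    moreover have "q \<le> real T" using mult_left_mono[OF q(2), of q] q by simp
    ultimately have "real d ^ 2 * q \<le> real d ^ 3 * real T" using q by (intro mult_mono) auto
    then have "?g \<le> 2 * Y" using Yl Y by linarith
    also have "\<dots> \<le> 4 * Y\<^sup>2" using Y by (simp add: power2_eq_square)
    finally show ?thesis using Z by simp
  qed
  have first: "real T * (2 * real d * q) * ?g \<le> delta / 2 * Z"
  proof -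
    have "real T * (2 * real d * q) * ?g = 6 * real d ^ 3 * real T ^ 2"
      unfolding q(1)[symmetric] by (simp add: power2_eq_square power3_eq_cube)
    also have "\<dots> \<le> 8 * (real d ^ 3 * real d ^ 3) * real T ^ 2"
      using mult_mono[of 1 "real d ^ 3" "real d ^ 3" "real d ^ 3"] d3 by (intro mult_right_mono) auto
    also have "\<dots> = 2 * (2 * real d ^ 3 * real T) * (2 * real d ^ 3 * real T)" by (simp add: power2_eq_square)
    also have "\<dots> \<le> 2 * (2 * real d ^ 3 * real T) * Y" using Yl by (intro mult_left_mono) auto
    also have "2 * real d ^ 3 * real T = delta * Y" using params by (simp add: Y_def)
    also have "2 * (delta * Y) * Y = delta / 2 * (4 * Y\<^sup>2)" by (simp add: power2_eq_square)
    also have "\<dots> \<le> delta / 2 * Z" using Z params by (intro mult_left_mono) auto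
    finally show ?thesis .
  qed
  obtain m where m: "d = Suc m" using params(1) by (cases d) auto
  have ep0: "0 \<le> 2 * real d / ep + 1" using ep_pos by simp
  have "prob solver_bad \<le> real T * real nn * (2 * real d / ep + 1) ^ d * 0.1 ^ kap" by (rule solver_bad(2))
  also have "\<dots> \<le> real T * (2 * real d * q) * ?g ^ d * (1 / Z ^ d)"
    using n g fail ep0 q(2) by (intro mult_mono power_mono mult_nonneg_nonneg) auto
  also have "\<dots> = real T * (2 * real d * q) * ?g * ?g ^ m / Z ^ d" unfolding m by simp
  also have "\<dots> \<le> delta / 2 * Z * Z ^ m / Z ^ d"
  proof (intro divide_right_mono mult_mono[OF first])
    show "?g ^ m \<le> Z ^ m" using gZ q(2) by (intro power_mono) auto
  qed (use Z0 q(2) params in auto)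
  also have "\<dots> = delta / 2" unfolding m using Z0 by simp
  finally show ?thesis .
qed


section \<open>The sampling distribution\<close>

lemma p_range: "p \<le> 1"
proof -
  have D: "prob_space D" using distribution by (simp add: ts_distribution_def)
  have "vnorm (unit_vec d 0) = 1" using params(1) by (simp add: vnorm_def)
  then have "p \<le> measure D {z \<in> space D. unit_vec d 0 \<bullet> Matrix.vec d z \<ge> 1}"
    using distribution by (simp add: ts_distribution_def)
  also have "\<dots> \<le> 1" by (rule prob_space.prob_le_1[OF D])
  finally show ?thesis .
qed

lemma sets_D: "sets D = sets (\<Pi>\<^sub>M i\<in>{..<d}. borel)" and prob_D: "prob_space D"
  using distribution by (simp_all add: ts_distribution_def)

lemma sample_coord_measurable:
  assumes "f \<in> measurable G D" "i < d"
  shows "(\<lambda>\<omega>. f \<omega> i) \<in> borel_measurable G"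
proof -
  have "f \<in> measurable G (\<Pi>\<^sub>M i\<in>{..<d}. borel)" using assms(1) measurable_cong_sets[OF refl sets_D] by blast
  from measurable_compose[OF this measurable_component_singleton[of i "{..<d}"]] assms(2) show ?thesis by simp
qed

lemma scalar_sum_measurable:
  assumes u: "u \<in> carrier_vec d"
  shows "(\<lambda>z. u \<bullet> Matrix.vec d z) \<in> borel_measurable D"
proof -
  have id: "(\<lambda>z. z) \<in> measurable D D" by (rule measurable_ident_sets) simp
  have "u \<bullet> Matrix.vec d z = (\<Sum>i<d. u $ i * z i)" for z
    by (simp add: scalar_prod_def atLeast0LessThan)
  then show ?thesis
    using sample_coord_measurable[OF id]
    by (simp only:) (intro borel_measurable_sum borel_measurable_times borel_measurable_const, auto)
qed

lemma sample_norm_measurable: "(\<lambda>z. vnorm (Matrix.vec d z)) \<in> borel_measurable D"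
proof -
  have id: "(\<lambda>z. z) \<in> measurable D D" by (rule measurable_ident_sets) simp
  have "vnorm (Matrix.vec d z) = sqrt (\<Sum>i<d. z i * z i)" for z
    by (simp add: vnorm_def scalar_prod_def atLeast0LessThan)
  then show ?thesis
    using sample_coord_measurable[OF id]
    by (simp only:) (intro sqrt_measurable borel_measurable_sum borel_measurable_times, auto)
qed

text \<open>Small enough for a union bound over the steps, and at most \<open>p / 2\<close>, so that
  anti-concentration survives the restriction to bounded samples.\<close>

definition tail :: real where "tail = delta * p / (16 * real T)"
definition rad :: real where "rad = sqrt (b * real d * ln (b' * real d / tail))"

text \<open>A sample with inner product at least \<open>1\<close> with this direction makes the sampled parameter
  overestimate the value of the optimal arm.\<close>

definition dir :: "nat \<Rightarrow> nat list \<Rightarrow> rvec" where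
  "dir t l = (let bv = inv_sqrt_mat d (gram_mat d x (list_acts l) (t - 1)) *\<^sub>v x (opt_arm A x theta t)
     in if vnorm bv = 0 then unit_vec d 0 else (1 / vnorm bv) \<cdot>\<^sub>v bv)"

definition good_samples :: "nat \<Rightarrow> nat list \<Rightarrow> (nat \<Rightarrow> real) set" where
  "good_samples t l = {z \<in> space D. dir t l \<bullet> Matrix.vec d z \<ge> 1} \<inter> {z \<in> space D. vnorm (Matrix.vec d z) \<le> rad}"

lemma opt_arm:
  assumes "t \<in> {1..T}"
  shows "opt_arm A x theta t \<in> A t" "e \<in> A t \<Longrightarrow> x e \<bullet> theta \<le> x (opt_arm A x theta t) \<bullet> theta"
proof -
  let ?f = "\<lambda>e. x e \<bullet> theta"
  have fin: "finite (A t)" "A t \<noteq> {}" using arms[of t] assms by auto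
  have "Max (?f ` A t) \<in> ?f ` A t" using fin by simp
  then obtain e0 where "e0 \<in> A t" "?f e0 = Max (?f ` A t)" by auto
  then have "is_arg_max ?f (\<lambda>e. e \<in> A t) e0" using fin by (auto simp: is_arg_max_linorder)
  then have "is_arg_max ?f (\<lambda>e. e \<in> A t) (opt_arm A x theta t)"
    unfolding opt_arm_def arg_max_on_def arg_max_def by (rule someI)
  then show "opt_arm A x theta t \<in> A t" "e \<in> A t \<Longrightarrow> x e \<bullet> theta \<le> x (opt_arm A x theta t) \<bullet> theta"
    by (auto simp: is_arg_max_linorder)
qed

lemma opt_feature:
  assumes "t \<in> {1..T}"
  shows "x (opt_arm A x theta t) \<in> carrier_vec d" "vnorm (x (opt_arm A x theta t)) \<le> 1"
  using features[OF _ opt_arm(1)[OF assms]] assms by auto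

lemma dir_unit:
  assumes t: "t \<in> {1..T}" and l: "good_list (t - 1) l"
  shows "dir t l \<in> carrier_vec d" "vnorm (dir t l) = 1"
proof -
  have c: "inv_sqrt_mat d (gram_mat d x (list_acts l) (t - 1)) *\<^sub>v x (opt_arm A x theta t) \<in> carrier_vec d"
    using inv_sqrt_gram(1)[OF features_list[OF l] features_list_norm[OF l]] opt_feature[OF t] by simp
  then show "dir t l \<in> carrier_vec d" by (auto simp: dir_def Let_def)
  have "vnorm (unit_vec d 0) = 1" using params(1) by (simp add: vnorm_def)
  then show "vnorm (dir t l) = 1" by (simp add: dir_def Let_def vnorm_smult)
qed

lemma good_samples_sets:
  assumes "t \<in> {1..T}" "good_list (t - 1) l"
  shows "good_samples t l \<in> sets D"
  unfolding good_samples_def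
  using scalar_sum_measurable[OF dir_unit(1)[OF assms]] sample_norm_measurable
  by (intro sets.Int borel_measurable_le) auto

context
  assumes p_pos: "0 < p" and b_pos: "0 < b"
begin

lemma tail_range: "0 < tail" "tail < 1" "tail \<le> p / 2"
proof -
  show "0 < tail" using params p_pos by (simp add: tail_def)
  have "delta * p \<le> 1 * p" using params p_pos by (intro mult_right_mono) auto
  moreover have "1 \<le> real T" using params by simp
  ultimately have "delta * p \<le> p * real T" using p_pos mult_left_mono[of 1 "real T" p] by simp
  then have le: "tail \<le> p / 16" using params by (simp add: tail_def divide_le_eq)
  then show "tail < 1" "tail \<le> p / 2" using p_range p_pos by linarith+
qed

lemma norm_tail: "measure D {z \<in> space D. vnorm (Matrix.vec d z) \<le> rad} \<ge> 1 - tail"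
  using distribution tail_range by (auto simp: ts_distribution_def rad_def)

lemma rad_nonneg: "0 \<le> rad"
proof (rule ccontr)
  assume "\<not> 0 \<le> rad"
  then have "\<not> vnorm (Matrix.vec d z) \<le> rad" for z
    using vnorm_nonneg[of "Matrix.vec d z"] by linarith
  then have "measure D {z \<in> space D. vnorm (Matrix.vec d z) \<le> rad} = 0" by simp
  then show False using norm_tail tail_range by simp
qed

lemma good_samples_prob:
  assumes "t \<in> {1..T}" "good_list (t - 1) l"
  shows "p / 2 \<le> measure D (good_samples t l)"
proof -
  interpret D: prob_space D by (rule prob_D)
  let ?E1 = "{z \<in> space D. dir t l \<bullet> Matrix.vec d z \<ge> 1}" and ?E2 = "{z \<in> space D. vnorm (Matrix.vec d z) \<le> rad}"
  have s1: "?E1 \<in> sets D"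
    using scalar_sum_measurable[OF dir_unit(1)[OF assms]] by (intro borel_measurable_le) auto
  have s2: "?E2 \<in> sets D" using sample_norm_measurable by (intro borel_measurable_le) auto
  have "p \<le> measure D ?E1" using distribution dir_unit[OF assms] by (simp add: ts_distribution_def)
  moreover have "measure D ?E1 \<le> measure D (good_samples t l) + measure D (space D - ?E2)"
  proof -
    have "measure D ?E1 \<le> measure D (good_samples t l \<union> (space D - ?E2))"
      using s1 s2 by (intro D.finite_measure_mono) (auto simp: good_samples_def)
    also have "\<dots> \<le> measure D (good_samples t l) + measure D (space D - ?E2)"
      using s1 s2 by (intro measure_Un_le) (auto simp: good_samples_def)
    finally show ?thesis .
  qed
  moreover have "measure D (space D - ?E2) \<le> p / 2"
    using D.prob_compl[OF s2] norm_tail tail_range(3) by simp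
  ultimately show ?thesis by simp
qed

definition norm_bad :: "nat \<Rightarrow> 'a set" where
  "norm_bad t = {\<omega> \<in> space M. \<not> vnorm (Matrix.vec d (\<xi> t \<omega>)) \<le> rad}"

lemma norm_bad:
  assumes t: "t \<in> {1..T}"
  shows "norm_bad t \<in> events" "prob (norm_bad t) \<le> tail"
proof -
  interpret D: prob_space D by (rule prob_D)
  let ?E2 = "{z \<in> space D. vnorm (Matrix.vec d z) \<le> rad}"
  have xi: "\<xi> t \<in> measurable M D" "distr M D (\<xi> t) = D" using samples[OF t] by auto
  have s2: "space D - ?E2 \<in> sets D" using sample_norm_measurable by (intro sets.compl_sets borel_measurable_le) auto
  have eq: "norm_bad t = \<xi> t -` (space D - ?E2) \<inter> space M"
    using measurable_space[OF xi(1)] by (auto simp: norm_bad_def)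
  show "norm_bad t \<in> events" unfolding eq by (rule measurable_sets[OF xi(1) s2])
  have "prob (norm_bad t) = measure (distr M D (\<xi> t)) (space D - ?E2)"
    unfolding eq by (rule measure_distr[OF xi(1) s2, symmetric])
  also have "\<dots> \<le> tail"
    unfolding xi(2) using norm_tail sample_norm_measurable by (subst D.prob_compl) (auto intro!: borel_measurable_le)
  finally show "prob (norm_bad t) \<le> tail" .
qed

section \<open>Optimism given the past\<close>

abbreviation "past t \<equiv> sampling_past M d I N s \<xi> r t"

lemma past_map:
  assumes "t \<in> {1..T}"
  shows "(\<lambda>\<omega>. (\<lambda>ij\<in>I. s (fst ij) (snd ij) \<omega>, \<lambda>k\<in>{1..<t}. \<xi> k \<omega>, \<lambda>k\<in>{1..<t}. r k \<omega>)) \<in> measurable M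
    ((\<Pi>\<^sub>M ij\<in>I. N ij) \<Otimes>\<^sub>M ((\<Pi>\<^sub>M k\<in>{1..<t}. \<Pi>\<^sub>M i\<in>{..<d}. borel) \<Otimes>\<^sub>M (\<Pi>\<^sub>M k\<in>{1..<t}. borel)))"
proof -
  have "\<xi> k \<in> measurable M (\<Pi>\<^sub>M i\<in>{..<d}. borel)" if "k \<in> {1..<t}" for k
    using samples[of k] that assms measurable_cong_sets[OF refl sets_D] by auto
  moreover have "s (fst ij) (snd ij) \<in> measurable M (N ij)" if "ij \<in> I" for ij
    using seeds[OF that] by blast
  ultimately show ?thesis
    using assms by (intro measurable_Pair measurable_restrict reward_M) auto
qed

lemma past_subalgebra: "t \<in> {1..T} \<Longrightarrow> subalgebra M (past t)"
  unfolding sampling_past_def by (rule subalgebra_vimage[OF past_map])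

lemma past_space [simp]: "space (past t) = space M"
  by (simp add: sampling_past_def)

lemma past_seed:
  assumes "t \<in> {1..T}" "i \<in> {1..nn}" "j < kap"
  shows "s i j \<in> measurable (past t) (seed S d (par_c i) (par_r d eta i) K)"
proof -
  have ij: "(i, j) \<in> I" using assms by (simp add: I_def)
  have "s i j \<in> measurable (past t) (N (i, j))"
    unfolding sampling_past_def
    by (rule measurable_vimage_comp[OF past_map[OF assms(1)]
          measurable_compose[OF measurable_fst measurable_component_singleton[OF ij]]])
      (use ij in auto)
  then show ?thesis by (simp add: N_def)
qed

lemma past_sample:
  assumes "t \<in> {1..T}" "k \<in> {1..<t}"
  shows "\<xi> k \<in> measurable (past t) D"
proof -
  have "\<xi> k \<in> measurable (past t) (\<Pi>\<^sub>M i\<in>{..<d}. borel)"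
    unfolding sampling_past_def
    by (rule measurable_vimage_comp[OF past_map[OF assms(1)]
          measurable_compose[OF measurable_snd measurable_compose[OF measurable_fst measurable_component_singleton[OF assms(2)]]]])
      (use assms in auto)
  then show ?thesis using measurable_cong_sets[OF refl sets_D] by blast
qed

lemma past_reward:
  assumes "t \<in> {1..T}" "k \<in> {1..<t}"
  shows "r k \<in> borel_measurable (past t)"
  unfolding sampling_past_def
  by (rule measurable_vimage_comp[OF past_map[OF assms(1)]
        measurable_compose[OF measurable_snd measurable_compose[OF measurable_snd measurable_component_singleton[OF assms(2)]]]])
    (use assms in auto)

lemma past_arm:
  assumes t: "t \<in> {1..T}" and k: "k \<in> {1..t - 1}"
  shows "a k \<in> measurable (past t) (count_space UNIV)"
proof (rule arms_measurable[where t="t - 1", OF past_space past_seed[OF t]])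
  show "r k \<in> borel_measurable (past t)" if "k \<in> {1..<t - 1}" for k
    by (rule past_reward[OF t]) (use that in auto)
  show "(\<lambda>\<omega>. \<xi> k \<omega> i) \<in> borel_measurable (past t)" if "k \<in> {1..t - 1}" "i < d" for k i
    by (rule sample_coord_measurable[OF past_sample[OF t] that(2)]) (use that in auto)
qed (use t k in auto)

lemma past_history:
  assumes t: "t \<in> {1..T}" and k: "k \<le> t - 1"
  shows "past_arms k \<in> measurable (past t) (count_space UNIV)"
  by (rule past_arms_measurable[OF past_arm[OF t]]) (use k in auto)

definition optimistic :: "nat \<Rightarrow> 'a set" where
  "optimistic t = {\<omega> \<in> space M. \<xi> t \<omega> \<in> good_samples t (past_arms (t - 1) \<omega>)}"

lemma optimistic_sets:
  assumes G: "space G = space M" and t: "t \<in> {1..T}" and xi: "\<xi> t \<in> measurable G D"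
    and h: "past_arms (t - 1) \<in> measurable G (count_space UNIV)"
  shows "optimistic t \<in> sets G"
proof -
  let ?P = "\<lambda>l \<omega>. good_list (t - 1) l \<and> \<xi> t \<omega> \<in> good_samples t l"
  have "(\<lambda>\<omega>. ?P (past_arms (t - 1) \<omega>) \<omega>) \<in> measurable G (count_space UNIV)"
  proof (rule measurable_compose_countable[OF _ h])
    fix l
    show "?P l \<in> measurable G (count_space UNIV)"
    proof (cases "good_list (t - 1) l")
      case True
      then show ?thesis using pred_sets2[OF good_samples_sets[OF t True] xi] by simp
    qed simp
  qed
  then have "{\<omega> \<in> space G. ?P (past_arms (t - 1) \<omega>) \<omega>} \<in> sets G" by (simp add: pred_def)
  moreover have "optimistic t = {\<omega> \<in> space G. ?P (past_arms (t - 1) \<omega>) \<omega>}"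
    using good_past[of "t - 1"] t by (auto simp: optimistic_def G)
  ultimately show ?thesis by simp
qed

lemma optimistic_events: "t \<in> {1..T} \<Longrightarrow> optimistic t \<in> events"
  using samples[of t] by (intro optimistic_sets past_arms_measurable arm_measurable) auto

text \<open>Where the list of past arms is fixed, the good samples form a fixed set, so the
  independence of the sample from the past gives a product. The countably many pieces of
  \<open>B\<close> are then summed.\<close>

lemma not_optimistic_le:
  assumes t: "t \<in> {1..T}" and B: "B \<in> sets (past t)"
  shows "emeasure M (B \<inter> (space M - optimistic t)) \<le> ennreal (1 - p / 2) * emeasure M B"
proof -
  interpret D: prob_space D by (rule prob_D)
  have xi: "\<xi> t \<in> measurable M D" "distr M D (\<xi> t) = D" using samples[OF t] by auto
  have sub: "sets (past t) \<subseteq> events" using past_subalgebra[OF t] by (simp add: subalgebra_def)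
  have Bsp: "B \<subseteq> space M" using sets.sets_into_space[OF B] by simp
  define C where "C l = B \<inter> (past_arms (t - 1) -` {l} \<inter> space M)" for l
  have C: "C l \<in> sets (past t)" for l
    using sets.Int[OF B measurable_sets[OF past_history[OF t order_refl], of "{l}"]] by (simp add: C_def)
  have nO: "space M - optimistic t \<in> events" using optimistic_events[OF t] by auto
  have disj: "disjoint_family_on C UNIV" "disjoint_family_on (\<lambda>l. C l \<inter> (space M - optimistic t)) UNIV"
    by (auto simp: disjoint_family_on_def C_def)
  have BC: "B = (\<Union>l. C l)" using Bsp by (auto simp: C_def)
  have each: "emeasure M (C l \<inter> (space M - optimistic t)) \<le> ennreal (1 - p / 2) * emeasure M (C l)" for l
  proof (cases "good_list (t - 1) l")
    case True
    let ?E = "space D - good_samples t l"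
    have E: "?E \<in> sets D" using good_samples_sets[OF t True] by auto
    let ?U = "\<xi> t -` ?E \<inter> space M"
    have eq: "C l \<inter> (space M - optimistic t) = ?U \<inter> C l"
      using measurable_space[OF xi(1)] by (auto simp: C_def optimistic_def)
    have "?U \<in> sets (vimage_algebra (space M) (\<xi> t) D)" by (rule in_vimage_algebra[OF E])
    then have "prob (?U \<inter> C l) = prob ?U * prob (C l)"
      by (rule indep_setD[OF samples_indep[OF t] _ C])
    moreover have "prob ?U \<le> 1 - p / 2"
    proof -
      have "prob ?U = measure (distr M D (\<xi> t)) ?E" by (rule measure_distr[OF xi(1) E, symmetric])
      also have "\<dots> = 1 - measure D (good_samples t l)"
        unfolding xi(2) by (rule D.prob_compl[OF good_samples_sets[OF t True]])
      finally show ?thesis using good_samples_prob[OF t True] by simp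
    qed
    ultimately have "prob (?U \<inter> C l) \<le> (1 - p / 2) * prob (C l)" by (simp add: mult_right_mono)
    then show ?thesis unfolding eq using p_range
      by (simp add: emeasure_eq_measure ennreal_mult'[symmetric])
  next
    case False
    then have "C l = {}" using good_past[of "t - 1"] t by (auto simp: C_def)
    then show ?thesis by simp
  qed
  have "emeasure M (B \<inter> (space M - optimistic t)) = emeasure M (\<Union>l. C l \<inter> (space M - optimistic t))"
    by (subst BC) (simp add: Int_UN_distrib2)
  also have "\<dots> = (\<integral>\<^sup>+ l. emeasure M (C l \<inter> (space M - optimistic t)) \<partial>count_space UNIV)"
    using C sub nO disj by (intro emeasure_UN_countable) auto
  also have "\<dots> \<le> (\<integral>\<^sup>+ l. ennreal (1 - p / 2) * emeasure M (C l) \<partial>count_space UNIV)"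
    by (intro nn_integral_mono each)
  also have "\<dots> = ennreal (1 - p / 2) * (\<integral>\<^sup>+ l. emeasure M (C l) \<partial>count_space UNIV)"
    by (rule nn_integral_cmult) simp
  also have "(\<integral>\<^sup>+ l. emeasure M (C l) \<partial>count_space UNIV) = emeasure M (\<Union>l. C l)"
    using C sub disj by (intro emeasure_UN_countable[symmetric]) auto
  finally show ?thesis by (simp add: BC[symmetric])
qed

text \<open>One \<open>beta\<close> covers the error of the estimate, and \<open>beta * rad\<close>
  the perturbation by a sample of norm at most \<open>rad\<close>.\<close>

definition gam :: real where "gam = beta * (1 + rad)"

lemma beta_ge: "1 \<le> beta"
proof -
  have "0 \<le> ln (1 / (delta / (4 * real T)))" using params by (intro ln_ge_zero) (auto simp: le_divide_eq)
  then show ?thesis by (simp add: conf_radius_def)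
qed

lemma gam_ge: "1 \<le> gam"
  unfolding gam_def using mult_mono[of 1 beta 1 "1 + rad"] beta_ge rad_nonneg by simp

text \<open>The gap is taken to a pessimistic value of the step and not to the arm played: it then depends
  on the past only, and conditioning on the past leaves the sample of the step untouched.\<close>

definition low :: "nat \<Rightarrow> (nat \<Rightarrow> nat) \<Rightarrow> real" where
  "low t acts = Max ((\<lambda>e. x e \<bullet> theta - gam * sqrt (width d x acts (t - 1) (x e))) ` A t)"

text \<open>Division by \<open>gam\<close> brings the gap into [0, 1], the range required by
  \<open>nn_integral_sampled_step\<close>.\<close>

definition lgap :: "nat \<Rightarrow> 'a \<Rightarrow> real" where
  "lgap t \<omega> = (x (opt_arm A x theta t) \<bullet> theta - low t (\<lambda>k. a k \<omega>)) / gam"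

lemma low_facts:
  assumes t: "t \<in> {1..T}"
  shows "\<exists>e\<in>A t. low t acts = x e \<bullet> theta - gam * sqrt (width d x acts (t - 1) (x e))"
    "e \<in> A t \<Longrightarrow> x e \<bullet> theta - gam * sqrt (width d x acts (t - 1) (x e)) \<le> low t acts"
proof -
  have fin: "finite (A t)" "A t \<noteq> {}" using arms[of t] t by auto
  let ?g = "\<lambda>e. x e \<bullet> theta - gam * sqrt (width d x acts (t - 1) (x e))"
  have "Max (?g ` A t) \<in> ?g ` A t" using fin by simp
  then show "\<exists>e\<in>A t. low t acts = ?g e" by (auto simp: low_def)
  show "e \<in> A t \<Longrightarrow> ?g e \<le> low t acts" using fin by (auto simp: low_def)
qed

text \<open>\<open>low\<close> is the true value of some arm minus its width, hence at most the
  optimum; and the optimal arm, with a width of at most \<open>gam\<close>, competes in the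
  maximum.\<close>

lemma lgap_range:
  assumes t: "t \<in> {1..T}" and w: "\<omega> \<in> space M"
  shows "0 \<le> lgap t \<omega>" "lgap t \<omega> \<le> 1"
proof -
  let ?o = "opt_arm A x theta t" and ?acts = "\<lambda>k. a k \<omega>"
  have f: "features d x ?acts (t - 1)" by (rule features_run[OF _ w]) (use t in auto)
  have wd: "0 \<le> width d x ?acts (t - 1) (x e)" "width d x ?acts (t - 1) (x e) \<le> 1" if "e \<in> A t" for e
  proof -
    have xe: "x e \<in> carrier_vec d" "vnorm (x e) \<le> 1" using features[OF _ that] t by auto
    have "x e \<bullet> x e \<le> 1" unfolding vnorm_sq[symmetric] using xe(2) by (simp add: power_le_one)
    then show "0 \<le> width d x ?acts (t - 1) (x e)" "width d x ?acts (t - 1) (x e) \<le> 1"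
      using width_bounds[OF f xe(1)] by auto
  qed
  obtain e where e: "e \<in> A t" "low t ?acts = x e \<bullet> theta - gam * sqrt (width d x ?acts (t - 1) (x e))"
    using low_facts(1)[OF t] by blast
  have "0 \<le> gam * sqrt (width d x ?acts (t - 1) (x e))" using wd[OF e(1)] gam_ge by simp
  then have "low t ?acts \<le> x ?o \<bullet> theta" using e(2) opt_arm(2)[OF t e(1)] by linarith
  then show "0 \<le> lgap t \<omega>" using gam_ge by (simp add: lgap_def)
  have "gam * sqrt (width d x ?acts (t - 1) (x ?o)) \<le> gam * 1"
    using wd[OF opt_arm(1)[OF t]] gam_ge by (intro mult_left_mono) auto
  then have "x ?o \<bullet> theta - low t ?acts \<le> gam" using low_facts(2)[OF t opt_arm(1)[OF t], of ?acts] by linarith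
  then show "lgap t \<omega> \<le> 1" using gam_ge by (simp add: lgap_def)
qed

lemma lgap_measurable:
  assumes G: "space G = space M" and t: "t \<in> {1..T}"
    and am: "\<And>k. k \<in> {1..t - 1} \<Longrightarrow> a k \<in> measurable G (count_space UNIV)"
  shows "lgap t \<in> borel_measurable G"
proof (rule measurable_past_fun[OF G _ am, where g="\<lambda>l \<omega>. (x (opt_arm A x theta t) \<bullet> theta - low t (list_acts l)) / gam"])
  fix \<omega>
  have "width d x (\<lambda>k. a k \<omega>) (t - 1) v = width d x (list_acts (past_arms (t - 1) \<omega>)) (t - 1) v" for v
    by (rule width_cong) (use past_arms_acts in auto)
  then show "lgap t \<omega> = (x (opt_arm A x theta t) \<bullet> theta - low t (list_acts (past_arms (t - 1) \<omega>))) / gam"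
    by (simp add: lgap_def low_def)
qed (use t in auto)

text \<open>The rate \<open>p / 4\<close> is half the lower bound \<open>p / 2\<close> on the
  conditional probability of optimism, as in \<open>nn_integral_sampled_step\<close>.\<close>

definition sampled :: "nat \<Rightarrow> 'a \<Rightarrow> real" where
  "sampled t \<omega> = exp (\<Sum>k = 1..t. p / 4 * lgap k \<omega> - indicator (optimistic k) \<omega> * lgap k \<omega>)"

lemma sampled_measurable:
  assumes G: "space G = space M" and t: "t \<le> T"
    and am: "\<And>k. k \<in> {1..t} \<Longrightarrow> a k \<in> measurable G (count_space UNIV)"
    and opt: "\<And>k. k \<in> {1..t} \<Longrightarrow> optimistic k \<in> sets G"
  shows "sampled t \<in> borel_measurable G"
proof -
  have "lgap k \<in> borel_measurable G" if "k \<in> {1..t}" for k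
    by (rule lgap_measurable[OF G]) (use that t am in auto)
  moreover have "(\<lambda>\<omega>. indicator (optimistic k) \<omega> :: real) \<in> borel_measurable G" if "k \<in> {1..t}" for k
    using opt[OF that] by (rule borel_measurable_indicator)
  ultimately have "(\<lambda>\<omega>. \<Sum>k = 1..t. p / 4 * lgap k \<omega> - indicator (optimistic k) \<omega> * lgap k \<omega>) \<in> borel_measurable G"
    by (intro borel_measurable_sum borel_measurable_diff borel_measurable_times borel_measurable_const) auto
  then show ?thesis unfolding sampled_def by measurable
qed

lemma nn_integral_sampled_le: "t \<le> T \<Longrightarrow> (\<integral>\<^sup>+ \<omega>. ennreal (sampled t \<omega>) \<partial>M) \<le> 1"
proof (induction t)
  case 0
  show ?case by (simp add: sampled_def emeasure_space_1)
next
  case (Suc t)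
  have St: "Suc t \<in> {1..T}" using Suc.prems by simp
  let ?G = "past (Suc t)"
  have am: "a k \<in> measurable ?G (count_space UNIV)" if "k \<in> {1..t}" for k
    by (rule past_arm[OF St]) (use that in auto)
  have opt: "optimistic k \<in> sets ?G" if "k \<in> {1..t}" for k
    by (rule optimistic_sets[OF past_space _ past_sample[OF St] past_history[OF St]]) (use that Suc.prems in auto)
  have Z: "(\<lambda>\<omega>. ennreal (sampled t \<omega>)) \<in> borel_measurable ?G"
    using sampled_measurable[OF past_space _ am opt] Suc.prems by (intro measurable_compose[OF _ measurable_ennreal]) auto
  have L: "lgap (Suc t) \<in> borel_measurable ?G" by (rule lgap_measurable[OF past_space St]) (use am in auto)
  have "(\<integral>\<^sup>+ \<omega>. ennreal (sampled (Suc t) \<omega>) \<partial>M)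
    = (\<integral>\<^sup>+ \<omega>. ennreal (sampled t \<omega>) * ennreal (exp ((p / 2) / 2 * lgap (Suc t) \<omega> - indicator (optimistic (Suc t)) \<omega> * lgap (Suc t) \<omega>)) \<partial>M)"
    by (intro nn_integral_cong) (simp add: sampled_def exp_add[symmetric] ennreal_mult'[symmetric])
  also have "\<dots> \<le> (\<integral>\<^sup>+ \<omega>. ennreal (sampled t \<omega>) \<partial>M)"
    by (rule nn_integral_sampled_step[OF past_subalgebra[OF St] optimistic_events[OF St] _ _ not_optimistic_le[OF St] Z L])
      (use p_pos p_range lgap_range[OF St] in auto)
  also have "\<dots> \<le> 1" using Suc by simp
  finally show ?case .
qed

definition sampled_bad :: "'a set" where
  "sampled_bad = {\<omega> \<in> space M. 1 \<le> delta / 16 * sampled T \<omega>}"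

lemma sampled_bad: "sampled_bad \<in> events" "prob sampled_bad \<le> delta / 16"
proof -
  have "sampled T \<in> borel_measurable M"
    by (intro sampled_measurable arm_measurable optimistic_events) auto
  then have "(\<lambda>\<omega>. ennreal (sampled T \<omega>)) \<in> borel_measurable M" by measurable
  moreover have "0 < delta / 16" using params by simp
  ultimately show "sampled_bad \<in> events" "prob sampled_bad \<le> delta / 16"
    unfolding sampled_bad_def using prob_ge_le_of_nn_integral[OF _ nn_integral_sampled_le[OF order_refl]] by blast+
qed

lemma sampled_outside:
  assumes "\<omega> \<in> space M" "\<omega> \<notin> sampled_bad"
  shows "p / 4 * (\<Sum>k = 1..T. lgap k \<omega>) \<le> (\<Sum>k = 1..T. indicator (optimistic k) \<omega> * lgap k \<omega>) + ln (16 / delta)"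
proof -
  let ?e = "\<Sum>k = 1..T. p / 4 * lgap k \<omega> - indicator (optimistic k) \<omega> * lgap k \<omega>"
  have "exp ?e < 16 / delta" using assms params by (auto simp: sampled_bad_def sampled_def field_simps)
  then have "ln (exp ?e) < ln (16 / delta)" using params by (subst ln_less_cancel_iff) auto
  then show ?thesis by (simp add: sum_subtractf sum_distrib_left)
qed

section \<open>Regret of one step\<close>

text \<open>The one-sided bound keeps the sample explicit and serves optimism, where a large inner
  product is an advantage. The two-sided bound replaces the sample by its norm.\<close>

lemma param_error:
  assumes t: "t \<in> {1..T}" and w: "\<omega> \<in> space M" "\<omega> \<notin> conf_bad (t - 1)" and u: "u \<in> carrier_vec d"
  defines "th \<equiv> sampled_param d T delta x (\<lambda>k. a k \<omega>) (\<lambda>k. r k \<omega>) t (\<xi> t \<omega>)"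
  shows "u \<bullet> theta - beta * sqrt (width d x (\<lambda>k. a k \<omega>) (t - 1) u) +
      beta * ((inv_sqrt_mat d (gram_mat d x (\<lambda>k. a k \<omega>) (t - 1)) *\<^sub>v u) \<bullet> Matrix.vec d (\<xi> t \<omega>)) \<le> u \<bullet> th"
    "\<omega> \<notin> norm_bad t \<Longrightarrow> \<bar>u \<bullet> th - u \<bullet> theta\<bar> \<le> gam * sqrt (width d x (\<lambda>k. a k \<omega>) (t - 1) u)"
proof -
  let ?acts = "\<lambda>k. a k \<omega>" and ?z = "Matrix.vec d (\<xi> t \<omega>)"
  let ?Bu = "inv_sqrt_mat d (gram_mat d x ?acts (t - 1)) *\<^sub>v u"
  let ?th = "theta_hat d x ?acts (\<lambda>k. r k \<omega>) (t - 1)"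
  let ?w = "sqrt (width d x ?acts (t - 1) u)"
  have tT: "t - 1 \<le> T" using t by auto
  note f = features_run[OF tT w(1)] and fn = features_norm[OF tT w(1)]
  have "\<bar>u \<bullet> ?th - u \<bullet> theta\<bar> \<le> ?w * (1 + sqrt (noise_width (t - 1) \<omega>))"
    unfolding noise_width_def
    by (rule theta_hat_error[OF f theta _ u]) (use rewards w(1) t in auto)
  also have "\<dots> \<le> ?w * beta"
    using width_bounds(1)[OF f u] noise_width_le[OF tT w] by (intro mult_left_mono) auto
  finally have e1: "\<bar>u \<bullet> ?th - u \<bullet> theta\<bar> \<le> beta * ?w" by (simp add: mult.commute)
  have form: "u \<bullet> th = u \<bullet> ?th + beta * (?Bu \<bullet> ?z)"
    unfolding th_def by (rule sampled_param_form[OF f fn u])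
  show "u \<bullet> theta - beta * ?w + beta * (?Bu \<bullet> ?z) \<le> u \<bullet> th" using e1 form by linarith
  assume "\<omega> \<notin> norm_bad t"
  then have z: "vnorm ?z \<le> rad" using w(1) by (simp add: norm_bad_def)
  have "\<bar>?Bu \<bullet> ?z\<bar> \<le> vnorm ?Bu * vnorm ?z"
    using inv_sqrt_gram(1)[OF f fn] u by (intro abs_scalar_prod_le_vnorm[of _ d]) auto
  also have "\<dots> = ?w * vnorm ?z" using inv_sqrt_gram(3)[OF f fn u] by simp
  also have "\<dots> \<le> ?w * rad" using z width_bounds(1)[OF f u] by (intro mult_left_mono) auto
  finally have "beta * \<bar>?Bu \<bullet> ?z\<bar> \<le> beta * (?w * rad)" using beta_ge by (intro mult_left_mono) auto
  then have "\<bar>beta * (?Bu \<bullet> ?z)\<bar> \<le> beta * (?w * rad)" using beta_ge by (simp add: abs_mult)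
  moreover have "gam * ?w = beta * ?w + beta * (?w * rad)" by (simp add: gam_def algebra_simps)
  ultimately show "\<bar>u \<bullet> th - u \<bullet> theta\<bar> \<le> gam * ?w" using e1 form by linarith
qed

text \<open>The search is exact up to \<open>4 * ep\<close> for the normalized query; undoing the
  normalization multiplies this by the norm of the sampled parameter, which is at most
  \<open>1 + gam\<close>.\<close>

definition slack :: real where "slack = 4 * ep * (1 + gam)"

text \<open>Everything rests on \<open>upper\<close>, which bounds the sampled value of every arm
  through the true value of the arm played. At the arm attaining \<open>low\<close> it gives the
  first claim; at the optimal arm, whose sampled value exceeds the optimum under optimism, it gives
  the second.\<close>

lemma step_regret:
  assumes t: "t \<in> {1..T}" and w: "\<omega> \<in> space M"
    and good: "\<omega> \<notin> conf_bad (t - 1)" "\<omega> \<notin> norm_bad t" "\<omega> \<notin> solver_bad"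
  defines "wt \<equiv> sqrt (width d x (\<lambda>k. a k \<omega>) (t - 1) (x (a t \<omega>)))"
  shows "x (opt_arm A x theta t) \<bullet> theta - x (a t \<omega>) \<bullet> theta \<le> gam * lgap t \<omega> + gam * wt + slack"
    "\<omega> \<in> optimistic t \<Longrightarrow> gam * lgap t \<omega> \<le> 2 * gam * wt + slack"
proof -
  let ?acts = "\<lambda>k. a k \<omega>" and ?o = "opt_arm A x theta t" and ?z = "Matrix.vec d (\<xi> t \<omega>)"
  define th where "th = sampled_param d T delta x ?acts (\<lambda>k. r k \<omega>) t (\<xi> t \<omega>)"
  have tT: "t - 1 \<le> T" "t \<le> T" using t by auto
  note f = features_run[OF tT(1) w] and fn = features_norm[OF tT(1) w]
  note err = param_error(2)[OF t w good(1) _ good(2), folded th_def]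
  have thc: "th \<in> carrier_vec d" unfolding th_def by (rule sampled_param_carrier[OF f fn])
  have thn: "vnorm th \<le> 1 + gam"
  proof -
    let ?u = "th - theta"
    have u: "?u \<in> carrier_vec d" by (rule minus_carrier_vec[OF thc theta(1)])
    \<comment> \<open>The error bound is applied in the direction of the error itself: the square of
      the norm is at most \<open>gam\<close> times the norm.\<close>
    have "?u \<bullet> ?u = ?u \<bullet> th - ?u \<bullet> theta" using u thc theta(1) by (simp add: scalar_prod_minus_distrib[of _ d])
    also have "\<dots> \<le> gam * sqrt (width d x ?acts (t - 1) ?u)" using err[OF u] by linarith
    also have "\<dots> \<le> gam * vnorm ?u"
      using gam_ge width_bounds(2)[OF f u] unfolding vnorm_def by (intro mult_left_mono) auto
    finally have "vnorm ?u * vnorm ?u \<le> gam * vnorm ?u" unfolding vnorm_sq[symmetric] power2_eq_square .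
    then have vu: "vnorm ?u \<le> gam" using vnorm_nonneg[of ?u] gam_ge by (cases "vnorm ?u = 0") auto
    have "vnorm th * vnorm th = th \<bullet> th" by (simp add: vnorm_sq[symmetric] power2_eq_square)
    also have "\<dots> = th \<bullet> theta + th \<bullet> ?u" using thc theta(1) by (simp add: scalar_prod_minus_distrib[of _ d])
    also have "\<dots> \<le> vnorm th * vnorm theta + vnorm th * vnorm ?u"
      using abs_scalar_prod_le_vnorm[OF thc theta(1)] abs_scalar_prod_le_vnorm[OF thc u] by linarith
    also have "\<dots> \<le> vnorm th * 1 + vnorm th * gam" using theta(2) vu by (intro add_mono mult_left_mono) auto
    finally have "vnorm th * vnorm th \<le> vnorm th * (1 + gam)" by (simp add: algebra_simps)
    then show ?thesis using vnorm_nonneg[of th] gam_ge by (cases "vnorm th = 0") auto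
  qed
  have scale: "x e \<bullet> th = vnorm th * (x e \<bullet> qry t \<omega>)" if "e \<in> A t" for e
  proof -
    have xe: "x e \<in> carrier_vec d" using features[OF tT(2) that] by simp
    have q: "qry t \<omega> = (1 / vnorm th) \<cdot>\<^sub>v th" unfolding ts_query_eq th_def ..
    have "x e \<bullet> th = x e \<bullet> (vnorm th \<cdot>\<^sub>v qry t \<omega>)"
      unfolding q by (subst normalize_unit_ball(2)[OF thc]) simp
    also have "\<dots> = vnorm th * (x e \<bullet> qry t \<omega>)"
      using xe thc q by (intro scalar_prod_smult_distrib[of _ d]) auto
    finally show ?thesis .
  qed
  have sl: "vnorm th * (4 * ep) \<le> slack"
    unfolding slack_def using thn ep_pos by (simp add: mult.commute)
  have ain: "a t \<omega> \<in> A t" by (rule arm_in[OF t w])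
  have xa: "x (a t \<omega>) \<in> carrier_vec d" by (rule arm_feature[OF t w])
  have wt: "0 \<le> wt" unfolding wt_def using width_bounds(1)[OF f xa] by simp
  have gwt: "0 \<le> gam * wt" using wt gam_ge by simp
  \<comment> \<open>In the default case the sampled values are small and the true value of the arm
    played is non-negative. Otherwise the arm played nearly maximizes the sampled value, and the
    error bound leads back to its true value.\<close>
  have upper: "x e \<bullet> th \<le> x (a t \<omega>) \<bullet> theta + gam * wt + slack" if e: "e \<in> A t" for e
    using arm_quality[OF t w solved_outside[OF t w good(3) rq_grd]]
  proof (elim disjE conjE)
    assume a: "0 \<le> x (a t \<omega>) \<bullet> theta" "\<forall>e\<in>A t. x e \<bullet> qry t \<omega> \<le> 4 * ep"
    have "x e \<bullet> th \<le> vnorm th * (4 * ep)" unfolding scale[OF e] using a(2) e by (intro mult_left_mono) auto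
    then show ?thesis using sl gwt a(1) by linarith
  next
    assume a: "\<forall>e\<in>A t. x e \<bullet> qry t \<omega> \<le> x (a t \<omega>) \<bullet> qry t \<omega> + 4 * ep"
    have "x e \<bullet> th \<le> vnorm th * (x (a t \<omega>) \<bullet> qry t \<omega> + 4 * ep)"
      unfolding scale[OF e] using a e by (intro mult_left_mono) auto
    also have "\<dots> = x (a t \<omega>) \<bullet> th + vnorm th * (4 * ep)" unfolding scale[OF ain] by (simp add: algebra_simps)
    finally show ?thesis using sl err[OF xa] by (simp add: wt_def)
  qed
  obtain e0 where e0: "e0 \<in> A t" "low t ?acts = x e0 \<bullet> theta - gam * sqrt (width d x ?acts (t - 1) (x e0))"
    using low_facts(1)[OF t] by blast
  have x0: "x e0 \<in> carrier_vec d" using features[OF tT(2) e0(1)] by simp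
  have "low t ?acts \<le> x e0 \<bullet> th" using err[OF x0] e0(2) by linarith
  then have lowle: "low t ?acts \<le> x (a t \<omega>) \<bullet> theta + gam * wt + slack" using upper[OF e0(1)] by linarith
  have lg: "gam * lgap t \<omega> = x ?o \<bullet> theta - low t ?acts" using gam_ge by (simp add: lgap_def)
  show "x ?o \<bullet> theta - x (a t \<omega>) \<bullet> theta \<le> gam * lgap t \<omega> + gam * wt + slack" using lg lowle by linarith
  assume opt: "\<omega> \<in> optimistic t"
  let ?bv = "inv_sqrt_mat d (gram_mat d x ?acts (t - 1)) *\<^sub>v x ?o"
  have xo: "x ?o \<in> carrier_vec d" by (rule opt_feature[OF t])
  have bvc: "?bv \<in> carrier_vec d" using inv_sqrt_gram(1)[OF f fn] xo by simp
  have nbv: "vnorm ?bv = sqrt (width d x ?acts (t - 1) (x ?o))" by (rule inv_sqrt_gram(3)[OF f fn xo])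
  have d1: "1 \<le> dir t (past_arms (t - 1) \<omega>) \<bullet> ?z" using opt by (auto simp: optimistic_def good_samples_def)
  \<comment> \<open>The optimistic event is stated for the normalized direction. If
    \<open>?bv\<close> is zero it concerns a substitute unit vector, but then both sides
    vanish.\<close>
  have "vnorm ?bv \<le> ?bv \<bullet> ?z"
  proof (cases "vnorm ?bv = 0")
    case True
    then have "?bv = 0\<^sub>v d" by (rule vnorm_eq_0[OF bvc])
    then show ?thesis using True by simp
  next
    case False
    then have "dir t (past_arms (t - 1) \<omega>) = (1 / vnorm ?bv) \<cdot>\<^sub>v ?bv"
      by (simp add: dir_def Let_def gram_past[symmetric])
    then have "1 \<le> (1 / vnorm ?bv) * (?bv \<bullet> ?z)" using d1 bvc by simp
    then have "1 \<le> (?bv \<bullet> ?z) / vnorm ?bv" by simp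
    moreover have "0 < vnorm ?bv" using False vnorm_nonneg[of ?bv] by linarith
    ultimately show ?thesis by (simp only: le_divide_eq_1_pos)
  qed
  then have "beta * sqrt (width d x ?acts (t - 1) (x ?o)) \<le> beta * (?bv \<bullet> ?z)"
    using beta_ge nbv by (intro mult_left_mono) auto
  then have "x ?o \<bullet> theta \<le> x ?o \<bullet> th"
    using param_error(1)[OF t w good(1) xo, folded th_def] by linarith
  also have "\<dots> \<le> x (a t \<omega>) \<bullet> theta + gam * wt + slack" by (rule upper[OF opt_arm(1)[OF t]])
  also have "x (a t \<omega>) \<bullet> theta \<le> low t ?acts + gam * wt"
    using low_facts(2)[OF t ain, of ?acts] by (simp add: wt_def)
  finally show "gam * lgap t \<omega> \<le> 2 * gam * wt + slack" using lg by (simp add: algebra_simps)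
qed

section \<open>The regret bound\<close>

text \<open>The intended budget is delta/4, delta/16, delta/2 and delta/16, in this order. The
  confidence events start at 0 because step \<open>t\<close> uses the estimate after
  \<open>t - 1\<close> steps.\<close>

definition bad :: "'a set" where
  "bad = (\<Union>t\<in>{..<T}. conf_bad t) \<union> (\<Union>t\<in>{1..T}. norm_bad t) \<union> solver_bad \<union> sampled_bad"

lemma bad:
  assumes "prob solver_bad \<le> delta / 2"
  shows "bad \<in> events" "prob bad \<le> delta"
proof -
  let ?C = "\<Union>t\<in>{..<T}. conf_bad t" and ?N = "\<Union>t\<in>{1..T}. norm_bad t"
  have C: "?C \<in> events" using conf_bad(1) by (intro sets.finite_UN) auto
  have N: "?N \<in> events" using norm_bad(1) by (intro sets.finite_UN) auto
  note sv = solver_bad(1) and sm = sampled_bad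
  show "bad \<in> events" unfolding bad_def using C N sv sm(1) by auto
  have "prob ?C \<le> (\<Sum>t<T. prob (conf_bad t))"
    using conf_bad(1) by (intro finite_measure_subadditive_finite) auto
  also have "\<dots> \<le> (\<Sum>t<T. delta / (4 * real T))" using conf_bad(2) by (intro sum_mono) auto
  also have "\<dots> = delta / 4" using params by simp
  finally have pC: "prob ?C \<le> delta / 4" .
  have "prob ?N \<le> (\<Sum>t\<in>{1..T}. prob (norm_bad t))"
    using norm_bad(1) by (intro finite_measure_subadditive_finite) auto
  also have "\<dots> \<le> (\<Sum>t\<in>{1..T}. tail)" using norm_bad(2) by (intro sum_mono) auto
  also have "\<dots> = delta * p / 16" using params by (simp add: tail_def)
  also have "\<dots> \<le> delta / 16" using p_range params by simp
  finally have pN: "prob ?N \<le> delta / 16" .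
  have "prob bad \<le> prob (?C \<union> ?N \<union> solver_bad) + prob sampled_bad"
    unfolding bad_def using C N sv sm(1) by (intro measure_Un_le) auto
  also have "prob (?C \<union> ?N \<union> solver_bad) \<le> prob (?C \<union> ?N) + prob solver_bad"
    using C N sv by (intro measure_Un_le) auto
  also have "prob (?C \<union> ?N) \<le> prob ?C + prob ?N" using C N by (intro measure_Un_le) auto
  finally show "prob bad \<le> delta" using pC pN sm(2) assms params by linarith
qed

text \<open>The regret is at most the gaps plus the widths plus the slack. The sum of all gaps is at
  most \<open>4 / p\<close> times its optimistic part, where each gap costs two widths, whence
  \<open>8 / p\<close>; the logarithm is the deviation of the supermartingale.\<close>

lemma regret_outside:
  assumes w: "\<omega> \<in> space M" "\<omega> \<notin> bad"
  shows "regret T A x theta (\<lambda>t. a t \<omega>) \<le>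
    gam * (1 + 8 / p) * sqrt (2 * real T * (real d * ln (1 + real T / real d)))
    + (1 + 4 / p) * real T * slack + 4 / p * gam * ln (16 / delta)"
proof -
  define wt where "wt t = sqrt (width d x (\<lambda>k. a k \<omega>) (t - 1) (x (a t \<omega>)))" for t
  define ind where "ind t = (indicator (optimistic t) \<omega> :: real)" for t
  define reg where "reg t = x (opt_arm A x theta t) \<bullet> theta - x (a t \<omega>) \<bullet> theta" for t
  have good: "\<omega> \<notin> conf_bad (t - 1)" "\<omega> \<notin> norm_bad t" "\<omega> \<notin> solver_bad" "\<omega> \<notin> sampled_bad" if "t \<in> {1..T}" for t
    using w(2) that unfolding bad_def by auto
  note g1 = gam_ge
  have slack: "0 \<le> slack" using ep_pos g1 by (simp add: slack_def)
  have one: "reg t \<le> gam * lgap t \<omega> + gam * wt t + slack"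
    and opt: "ind t * (gam * lgap t \<omega>) \<le> 2 * gam * wt t + slack" if t: "t \<in> {1..T}" for t
  proof -
    have wt0: "0 \<le> 2 * gam * wt t + slack"
      using t w g1 slack features_run[of "t - 1" \<omega>] arm_feature[OF t] by (auto simp: wt_def intro!: add_nonneg_nonneg mult_nonneg_nonneg width_bounds(1))
    show "reg t \<le> gam * lgap t \<omega> + gam * wt t + slack"
      unfolding wt_def reg_def by (rule step_regret(1)[OF t w(1) good(1-3)[OF t]])
    show "ind t * (gam * lgap t \<omega>) \<le> 2 * gam * wt t + slack"
      using step_regret(2)[OF t w(1) good(1-3)[OF t]] wt0
      by (cases "\<omega> \<in> optimistic t") (simp_all add: wt_def ind_def)
  qed
  let ?W = "\<Sum>t = 1..T. wt t" and ?L = "\<Sum>t = 1..T. lgap t \<omega>"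
  have W: "?W \<le> sqrt (2 * real T * (real d * ln (1 + real T / real d)))"
  proof -
    have "?W = (\<Sum>k<T. wt (Suc k))" by (simp add: sum.atLeast1_atMost_eq)
    also have "\<dots> \<le> sqrt (2 * real T * (real d * ln (1 + real T / real d)))"
      unfolding wt_def diff_Suc_1
      by (rule sum_sqrt_width_le[OF features_run[OF order_refl w(1)] features_norm[OF order_refl w(1)] params(1)])
    finally show ?thesis .
  qed
  have "(\<Sum>t = 1..T. ind t * (gam * lgap t \<omega>)) \<le> (\<Sum>t = 1..T. 2 * gam * wt t + slack)"
    by (rule sum_mono) (rule opt)
  then have O: "gam * (\<Sum>t = 1..T. ind t * lgap t \<omega>) \<le> 2 * gam * ?W + real T * slack"
    by (simp add: sum.distrib sum_distrib_left mult.left_commute)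
  have "p / 4 * ?L \<le> (\<Sum>t = 1..T. ind t * lgap t \<omega>) + ln (16 / delta)"
    unfolding ind_def by (rule sampled_outside[OF w(1) good(4)[of 1]]) (use params in simp)
  then have "gam * (p / 4 * ?L) \<le> gam * ((\<Sum>t = 1..T. ind t * lgap t \<omega>) + ln (16 / delta))"
    using g1 by (intro mult_left_mono) auto
  then have "p / 4 * (gam * ?L) \<le> 2 * gam * ?W + real T * slack + gam * ln (16 / delta)"
    using O by (simp add: ring_distribs mult.left_commute)
  then have "4 / p * (p / 4 * (gam * ?L)) \<le> 4 / p * (2 * gam * ?W + real T * slack + gam * ln (16 / delta))"
    using p_pos by (intro mult_left_mono) auto
  then have L: "gam * ?L \<le> 4 / p * (2 * gam * ?W + real T * slack + gam * ln (16 / delta))" using p_pos by simp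
  have "regret T A x theta (\<lambda>t. a t \<omega>) = (\<Sum>t = 1..T. reg t)" by (simp add: regret_def reg_def)
  also have "\<dots> \<le> (\<Sum>t = 1..T. gam * lgap t \<omega> + gam * wt t + slack)" by (rule sum_mono) (rule one)
  also have "\<dots> = gam * ?L + gam * ?W + real T * slack" by (simp add: sum.distrib sum_distrib_left)
  also have "\<dots> \<le> gam * (1 + 8 / p) * ?W + (1 + 4 / p) * real T * slack + 4 / p * gam * ln (16 / delta)"
    using L by (simp add: algebra_simps)
  also have "gam * (1 + 8 / p) * ?W \<le> gam * (1 + 8 / p) * sqrt (2 * real T * (real d * ln (1 + real T / real d)))"
    using W g1 p_pos by (intro mult_left_mono mult_nonneg_nonneg) auto
  finally show ?thesis by simp
qed

text \<open>All logarithms are absorbed by the single quantity \<open>L\<close>. Both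
  \<open>beta\<close> and \<open>1 + rad\<close> are of order sqrt d times \<open>L\<close>, so
  \<open>gam\<close> contributes the factor \<open>d\<close>; the remaining sqrt d of the regret
  comes from the elliptical potential.\<close>

lemma gam_le:
  assumes b': "0 < b'"
  defines "L \<equiv> 1 + ln (real d * real T / delta)"
  shows "1 \<le> L" "ln (1 + real T / real d) \<le> L" "ln (16 / delta) \<le> 16 * L"
    "gam \<le> 4 * (1 + sqrt (b * (1 + \<bar>ln (16 * b' / p)\<bar>))) * real d * L\<^sup>2"
proof -
  let ?y = "real d * real T / delta"
  have d1: "1 \<le> real d" and T1: "1 \<le> real T" using params by auto
  have dT: "real T \<le> real d * real T" "1 \<le> real d * real T"
    using d1 T1 mult_mono[of 1 "real d" 1 "real T"] by auto
  have "real d * real T * delta \<le> real d * real T * 1" using params by (intro mult_left_mono) auto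
  then have y: "real d * real T \<le> ?y" using params by (simp add: le_divide_eq)
  have y0: "1 \<le> ?y" using y dT by linarith
  then show L: "1 \<le> L" by (simp add: L_def)
  have "1 + real T / real d \<le> 1 + real T" using d1 T1 by (simp add: divide_le_eq)
  also have "\<dots> \<le> 2 * ?y" using y dT T1 by linarith
  finally have "ln (1 + real T / real d) \<le> ln (2 * ?y)" by (subst ln_le_cancel_iff) (use y0 in \<open>auto simp: add_pos_nonneg\<close>)
  also have "\<dots> = ln 2 + ln ?y" using y0 by (intro ln_mult_pos) auto
  also have "\<dots> \<le> L" using ln_le_minus_one[of 2] by (simp add: L_def)
  finally show lT: "ln (1 + real T / real d) \<le> L" .
  have "1 / delta \<le> ?y" using dT params by (simp add: divide_right_mono)
  then have "ln (16 / delta) \<le> ln (16 * ?y)" using y0 params by (subst ln_le_cancel_iff) auto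
  also have "\<dots> = ln 16 + ln ?y" using y0 by (intro ln_mult_pos) auto
  also have "\<dots> \<le> 16 * L" using ln_le_minus_one[of 16] L by (simp add: L_def)
  finally show "ln (16 / delta) \<le> 16 * L" .
  have LL: "L \<le> L\<^sup>2" using mult_left_mono[OF L, of L] L by (simp add: power2_eq_square)
  have "beta \<le> 4 * (sqrt (real d) * L)"
  proof -
    have "1 / (delta / (4 * real T)) \<le> 4 * ?y" using dT params by (simp add: divide_right_mono)
    then have "ln (1 / (delta / (4 * real T))) \<le> ln (4 * ?y)" using params T1 y0 by (subst ln_le_cancel_iff) auto
    also have "\<dots> = ln 4 + ln ?y" using y0 by (intro ln_mult_pos) auto
    also have "\<dots> \<le> 3 * L" using ln_le_minus_one[of 4] L by (simp add: L_def)
    finally have 1: "ln (1 / (delta / (4 * real T))) \<le> 3 * L" .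
    have 2: "real d * ln (1 + real T / real d) \<le> real d * L" using lT by (intro mult_left_mono) auto
    have "1 * L \<le> real d * L" using d1 L by (intro mult_right_mono) auto
    \<comment> \<open>The factor 7 is available; 9 is taken for its square root.\<close>
    then have "2 * ln (1 / (delta / (4 * real T))) + real d * ln (1 + real T / real d) \<le> 9 * (real d * L)"
      using 1 2 L by linarith
    also have "\<dots> \<le> 9 * (real d * L\<^sup>2)" using LL by (intro mult_left_mono) auto
    also have "\<dots> = (3 * (sqrt (real d) * L))\<^sup>2" by (simp add: power_mult_distrib)
    finally have "sqrt (2 * ln (1 / (delta / (4 * real T))) + real d * ln (1 + real T / real d)) \<le> 3 * (sqrt (real d) * L)"
      using L by (intro real_le_lsqrt) auto
    moreover have "1 * 1 \<le> sqrt (real d) * L" using d1 L by (intro mult_mono) auto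
    ultimately show ?thesis by (simp add: conf_radius_def)
  qed
  moreover have "1 + rad \<le> (1 + sqrt (b * (1 + \<bar>ln (16 * b' / p)\<bar>))) * (sqrt (real d) * L)"
  proof -
    let ?B = "1 + \<bar>ln (16 * b' / p)\<bar>"
    have q0: "0 < 16 * b' / p" using b' p_pos by simp
    have y1: "0 < ?y" using y0 by linarith
    have "b' * real d / tail = 16 * b' / p * ?y" by (simp add: tail_def mult_ac)
    then have "ln (b' * real d / tail) = ln (16 * b' / p * ?y)" by (rule arg_cong)
    also have "\<dots> = ln (16 * b' / p) + ln ?y"
      by (rule ln_mult_pos[OF q0 y1])
    also have "\<dots> \<le> \<bar>ln (16 * b' / p)\<bar> * 1 + 1 * L" by (simp add: L_def)
    also have "\<dots> \<le> \<bar>ln (16 * b' / p)\<bar> * L + 1 * L" using L by (intro add_mono mult_left_mono) auto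
    also have "\<dots> = ?B * L" by (simp add: algebra_simps)
    finally have "b * real d * ln (b' * real d / tail) \<le> b * real d * (?B * L)"
      using b_pos by (intro mult_left_mono) auto
    also have "\<dots> \<le> b * real d * (?B * L\<^sup>2)" using LL b_pos by (intro mult_left_mono) auto
    also have "\<dots> = (sqrt (b * ?B) * (sqrt (real d) * L))\<^sup>2" using b_pos by (simp add: power_mult_distrib)
    finally have "rad \<le> sqrt (b * ?B) * (sqrt (real d) * L)"
      unfolding rad_def using L b_pos by (intro real_le_lsqrt) auto
    moreover have "1 * 1 \<le> sqrt (real d) * L" using d1 L by (intro mult_mono) auto
    ultimately show ?thesis by (simp add: algebra_simps)
  qed
  ultimately have "gam \<le> (4 * (sqrt (real d) * L)) * ((1 + sqrt (b * (1 + \<bar>ln (16 * b' / p)\<bar>))) * (sqrt (real d) * L))"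
    unfolding gam_def using L rad_nonneg by (intro mult_mono) auto
  also have "\<dots> = 4 * (1 + sqrt (b * (1 + \<bar>ln (16 * b' / p)\<bar>))) * (sqrt (real d) * sqrt (real d)) * L\<^sup>2"
    by (simp only: power2_eq_square mult_ac)
  finally show "gam \<le> 4 * (1 + sqrt (b * (1 + \<bar>ln (16 * b' / p)\<bar>))) * real d * L\<^sup>2" by (simp only: real_sqrt_mult_self abs_of_nat)
qed

text \<open>The factor \<open>10 + 112 / p\<close> is the sum of \<open>2 * (1 + 8 / p)\<close> for
  the widths, \<open>8 * (1 + 4 / p)\<close> for the search error and \<open>64 / p\<close> for the
  deviation of the supermartingale. The other factor comes from \<open>gam_le\<close>.\<close>

definition regret_const :: real where
  "regret_const = 4 * (1 + sqrt (b * (1 + \<bar>ln (16 * b' / p)\<bar>))) * (10 + 112 / p)"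

lemma regret_outside_le:
  assumes b': "0 < b'" and eta: "eta = 1 / sqrt (real T)" and w: "\<omega> \<in> space M" "\<omega> \<notin> bad"
  shows "regret T A x theta (\<lambda>t. a t \<omega>)
    \<le> regret_const * real d powr (3 / 2) * sqrt (real T) * (1 + ln (real d * real T / delta)) ^ 3"
proof -
  define L where "L = 1 + ln (real d * real T / delta)"
  define G where "G = 4 * (1 + sqrt (b * (1 + \<bar>ln (16 * b' / p)\<bar>)))"
  define q where "q = sqrt (real T)"
  define e where "e = sqrt (real d)"
  define X where "X = G * real d * e * q * L ^ 3"
  note L = gam_le[OF b', folded L_def G_def]
  have g1: "1 \<le> gam" by (rule gam_ge)
  have q: "1 \<le> q" "q * q = real T" "eta = 1 / q" using params by (auto simp: q_def eta)
  have e: "1 \<le> e" "e * e = real d" using params by (auto simp: e_def)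
  have G0: "0 \<le> G" using b_pos by (simp add: G_def)
  \<comment> \<open>All three terms of the regret are multiples of \<open>gam\<close> and are
    brought to the common scale \<open>X\<close>. Two logarithmic factors come from
    \<open>gam\<close> and at most one from its cofactor, which explains the third power.\<close>
  have step: "u * gam \<le> v * X" if "0 \<le> u" "u * L\<^sup>2 \<le> v * (e * q * L ^ 3)" for u v
  proof -
    have "u * gam \<le> u * (G * real d * L\<^sup>2)" using L(4) that by (intro mult_left_mono) auto
    also have "\<dots> = G * real d * (u * L\<^sup>2)" by simp
    also have "\<dots> \<le> G * real d * (v * (e * q * L ^ 3))" using that G0 by (intro mult_left_mono) auto
    finally show ?thesis by (simp add: X_def mult_ac)
  qed
  have L3: "L\<^sup>2 \<le> L ^ 3" using L(1) by (intro power_increasing) auto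
  have "sqrt (2 * real T * (real d * ln (1 + real T / real d))) \<le> 2 * (q * (e * L))"
  proof (rule real_le_lsqrt)
    have "L \<le> L\<^sup>2" using mult_left_mono[OF L(1), of L] L(1) by (simp add: power2_eq_square)
    then have "2 * real T * (real d * ln (1 + real T / real d)) \<le> 2 * real T * (real d * L\<^sup>2)"
      using L(2) by (intro mult_left_mono) auto
    also have "\<dots> \<le> 4 * (real T * (real d * L\<^sup>2))" by simp
    also have "\<dots> = (2 * (q * (e * L)))\<^sup>2"
      unfolding q(2)[symmetric] e(2)[symmetric] by (simp add: power2_eq_square)
    finally show "2 * real T * (real d * ln (1 + real T / real d)) \<le> (2 * (q * (e * L)))\<^sup>2" .
  qed (use q e L in auto)
  then have "gam * (1 + 8 / p) * sqrt (2 * real T * (real d * ln (1 + real T / real d)))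
      \<le> gam * (1 + 8 / p) * (2 * (q * (e * L)))"
    using g1 p_pos by (intro mult_left_mono mult_nonneg_nonneg) auto
  also have "\<dots> = ((1 + 8 / p) * (2 * (q * (e * L)))) * gam" by simp
  also have "\<dots> \<le> (2 * (1 + 8 / p)) * X"
    using p_pos q e L by (intro step) (auto simp: power2_eq_square power3_eq_cube)
  finally have t1: "gam * (1 + 8 / p) * sqrt (2 * real T * (real d * ln (1 + real T / real d))) \<le> 2 * (1 + 8 / p) * X" .
  \<comment> \<open>Here the choice of \<open>eta\<close> pays off: the search error of one step is
    of order \<open>gam / sqrt T\<close>, so all steps together stay within the scale of the regret
    bound.\<close>
  have slk: "real T * slack \<le> 8 * q * gam"
  proof -
    have "slack \<le> 4 * ep * (2 * gam)" unfolding slack_def using g1 ep_pos by (intro mult_left_mono) auto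
    moreover have "ep \<le> 1 / q" using params q by (simp add: par_eps_def divide_le_eq)
    then have "4 * ep * (2 * gam) \<le> 4 * (1 / q) * (2 * gam)" using g1 by (intro mult_right_mono mult_left_mono) auto
    ultimately have "real T * slack \<le> real T * (4 * (1 / q) * (2 * gam))" by (intro mult_left_mono) auto
    also have "\<dots> = 8 * q * gam" unfolding q(2)[symmetric] using q(1) by simp
    finally show ?thesis .
  qed
  have "(1 + 4 / p) * real T * slack \<le> (1 + 4 / p) * (8 * q * gam)"
    unfolding mult.assoc using slk p_pos by (intro mult_left_mono) (auto simp: mult.assoc)
  also have "\<dots> = ((1 + 4 / p) * (8 * q)) * gam" by simp
  also have "\<dots> \<le> (8 * (1 + 4 / p)) * X"
  proof (rule step)
    have "q * L\<^sup>2 \<le> q * (e * L ^ 3)" using mult_mono[OF e(1) L3] e(1) L(1) q by (intro mult_left_mono) auto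
    then have "8 * (1 + 4 / p) * (q * L\<^sup>2) \<le> 8 * (1 + 4 / p) * (q * (e * L ^ 3))"
      by (rule mult_left_mono) (use p_pos in simp)
    then show "(1 + 4 / p) * (8 * q) * L\<^sup>2 \<le> 8 * (1 + 4 / p) * (e * q * L ^ 3)" by (simp add: mult_ac)
  qed (use q p_pos in auto)
  finally have t2: "(1 + 4 / p) * real T * slack \<le> 8 * (1 + 4 / p) * X" .
  have "4 / p * gam * ln (16 / delta) \<le> 4 / p * gam * (16 * L)"
    using L(3) g1 p_pos by (intro mult_left_mono) auto
  also have "\<dots> = (64 / p * L) * gam" by simp
  also have "\<dots> \<le> 64 / p * X"
  proof (rule step)
    have "1 * L ^ 3 \<le> (e * q) * L ^ 3" using mult_mono[OF e(1) q(1)] e(1) L(1) by (intro mult_right_mono) auto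
    then have "64 / p * L ^ 3 \<le> 64 / p * (e * q * L ^ 3)" by (intro mult_left_mono) (use p_pos in auto)
    then show "64 / p * L * L\<^sup>2 \<le> 64 / p * (e * q * L ^ 3)" by (simp add: power2_eq_square power3_eq_cube mult_ac)
  qed (use L p_pos in auto)
  finally have t3: "4 / p * gam * ln (16 / delta) \<le> 64 / p * X" .
  have "regret T A x theta (\<lambda>t. a t \<omega>) \<le> 2 * (1 + 8 / p) * X + 8 * (1 + 4 / p) * X + 64 / p * X"
    using regret_outside[OF w] t1 t2 t3 by linarith
  also have "\<dots> = (10 + 112 / p) * X" using p_pos by (simp add: field_simps)
  also have "\<dots> = regret_const * (real d * e) * q * L ^ 3" by (simp add: X_def regret_const_def G_def)
  also have "real d * e = real d powr (3 / 2)"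
    using params powr_add[of "real d" 1 "1 / 2"] by (simp add: e_def powr_half_sqrt)
  finally show ?thesis by (simp add: q_def L_def)
qed

lemma regret_le_two_T: "\<omega> \<in> space M \<Longrightarrow> regret T A x theta (\<lambda>t. a t \<omega>) \<le> 2 * real T"
proof -
  assume w: "\<omega> \<in> space M"
  have le: "\<bar>x e \<bullet> theta\<bar> \<le> 1" if t: "t \<in> {1..T}" and e: "e \<in> A t" for t e
  proof -
    have xe: "x e \<in> carrier_vec d" "vnorm (x e) \<le> 1" using features[OF _ e] t by auto
    have "\<bar>x e \<bullet> theta\<bar> \<le> vnorm (x e) * vnorm theta" by (rule abs_scalar_prod_le_vnorm[OF xe(1) theta(1)])
    also have "\<dots> \<le> 1 * 1" using xe(2) theta(2) by (intro mult_mono) auto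
    finally show ?thesis by simp
  qed
  have "regret T A x theta (\<lambda>t. a t \<omega>) \<le> (\<Sum>t = 1..T. 2)"
    unfolding regret_def
  proof (rule sum_mono)
    fix t assume t: "t \<in> {1..T}"
    show "x (opt_arm A x theta t) \<bullet> theta - x (a t \<omega>) \<bullet> theta \<le> 2"
      using le[OF t opt_arm(1)[OF t]] le[OF t arm_in[OF t w]] by linarith
  qed
  then show ?thesis by simp
qed

lemma regret_prob:
  assumes b': "0 < b'" and eta: "eta = 1 / sqrt (real T)"
  defines "R \<equiv> regret_const * real d powr (3 / 2) * sqrt (real T) * (1 + ln (real d * real T / delta)) ^ 3"
  shows "1 - delta \<le> prob {\<omega> \<in> space M. regret T A x theta (\<lambda>t. a t \<omega>) \<le> R}"
proof -
  let ?E = "{\<omega> \<in> space M. regret T A x theta (\<lambda>t. a t \<omega>) \<le> R}"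
  have "(\<lambda>\<omega>. regret T A x theta (\<lambda>t. a t \<omega>)) \<in> borel_measurable M"
    unfolding regret_def
  proof (intro borel_measurable_sum borel_measurable_diff borel_measurable_const)
    fix t assume "t \<in> {1..T}"
    from measurable_compose[OF arm_measurable[OF this], of "\<lambda>a. x a \<bullet> theta" borel]
    show "(\<lambda>\<omega>. x (a t \<omega>) \<bullet> theta) \<in> borel_measurable M" by simp
  qed
  then have E: "?E \<in> events" by (intro borel_measurable_le) auto
  show ?thesis
  proof (cases "256 \<le> T")
    case True
    note B = bad[OF solver_bad_le[OF eta True]]
    have "space M - bad \<subseteq> ?E" using regret_outside_le[OF b' eta] by (auto simp: R_def)
    then have "prob (space M - bad) \<le> prob ?E" using E by (intro finite_measure_mono) auto
    then show ?thesis using B prob_compl[OF B(1)] by simp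
  next
    \<comment> \<open>For small \<open>T\<close> the copies may be too few for the union bound over all queries, but then the
      trivial bound \<open>2 T\<close> on the regret suffices.\<close>
    case False
    let ?q = "sqrt (real T)" and ?L = "1 + ln (real d * real T / delta)"
    have q: "?q \<le> 16" using False by (intro real_le_lsqrt) auto
    have "real T = ?q * ?q" by simp
    also have "\<dots> \<le> 16 * ?q" using q by (intro mult_right_mono) auto
    finally have T: "2 * real T \<le> 40 * 1 * ?q * 1" by simp
    \<comment> \<open>The constant is at least 40, whereas \<open>2 T\<close> \<le> 32 sqrt T for T
      < 256.\<close>
    have "4 * 1 * 10 \<le> regret_const" unfolding regret_const_def using p_pos b_pos by (intro mult_mono) auto
    moreover have "1 \<le> real d powr (3 / 2)" using params by (intro ge_one_powr_ge_zero) auto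
    moreover have "1 \<le> ?L ^ 3" using gam_le(1)[OF b'] by (rule one_le_power)
    ultimately have "40 * 1 * ?q * 1 \<le> R" unfolding R_def by (intro mult_mono) auto
    then have "?E = space M" using regret_le_two_T T by fastforce
    then show ?thesis using params prob_space by simp
  qed
qed

end

end

section \<open>Running time\<close>

text \<open>Growth \<open>K powr (e + o(1))\<close> without naming the vanishing term, so that sums and products
  combine directly.\<close>

definition power_order :: "real \<Rightarrow> (nat \<Rightarrow> real) \<Rightarrow> bool" where
  "power_order e f \<longleftrightarrow> (\<forall>K. 0 \<le> f K) \<and> (\<forall>z>0. \<forall>\<^sub>F K in at_top. f K \<le> real K powr (e + z))"

lemma power_orderI:
  assumes "\<And>K. 0 \<le> f K" "g \<longlonglongrightarrow> 0" "\<forall>\<^sub>F K in at_top. f K \<le> real K powr (e + g K)"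
  shows "power_order e f"
  unfolding power_order_def
proof (intro conjI allI impI assms(1))
  fix z :: real assume z: "0 < z"
  have "\<forall>\<^sub>F K in at_top. g K < z" using order_tendstoD(2)[OF assms(2) z] .
  then show "\<forall>\<^sub>F K in at_top. f K \<le> real K powr (e + z)"
    using assms(3) eventually_ge_at_top[of 1]
  proof eventually_elim
    case (elim K)
    have "real K powr (e + g K) \<le> real K powr (e + z)" using elim by (intro powr_mono) auto
    then show ?case using elim by linarith
  qed
qed

lemma bounded_by_power_order:
  assumes "bounded_by_power e f"
  shows "power_order e f"
proof -
  obtain g where g: "g \<in> o[at_top](\<lambda>_. 1)" "\<forall>\<^sub>F K in at_top. f K \<le> real K powr (e + g K)"
    using assms by (auto simp: bounded_by_power_def)
  then have "g \<longlonglongrightarrow> 0" by (auto dest: smalloD_tendsto)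
  then show ?thesis using power_orderI[of f g e] assms g(2) by (auto simp: bounded_by_power_def)
qed

lemma power_order_mono:
  assumes "power_order e f" "e \<le> e'"
  shows "power_order e' f"
  unfolding power_order_def
proof (intro conjI allI impI)
  fix z :: real assume "0 < z"
  then have "0 < e' + z - e" using assms by simp
  then have "\<forall>\<^sub>F K in at_top. f K \<le> real K powr (e + (e' + z - e))"
    using assms(1) unfolding power_order_def by blast
  then show "\<forall>\<^sub>F K in at_top. f K \<le> real K powr (e' + z)" by simp
qed (use assms in \<open>auto simp: power_order_def\<close>)

lemma power_order_add:
  assumes "power_order e f" "power_order e g"
  shows "power_order e (\<lambda>K. f K + g K)"
  unfolding power_order_def
proof (intro conjI allI impI)
  fix z :: real assume z: "0 < z"
  have "\<forall>\<^sub>F K in at_top. f K \<le> real K powr (e + z / 2)" "\<forall>\<^sub>F K in at_top. g K \<le> real K powr (e + z / 2)"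
    using assms z unfolding power_order_def by (auto dest: spec[of _ "z / 2"])
  moreover have "\<forall>\<^sub>F K :: nat in at_top. 2 \<le> real K powr (z / 2)" using z by real_asymp
  ultimately show "\<forall>\<^sub>F K in at_top. f K + g K \<le> real K powr (e + z)"
  proof eventually_elim
    case (elim K)
    have "f K + g K \<le> real K powr (e + z / 2) * 2" using elim by simp
    also have "\<dots> \<le> real K powr (e + z / 2) * real K powr (z / 2)" using elim by (intro mult_left_mono) auto
    also have "\<dots> = real K powr (e + z)" by (simp add: powr_add[symmetric] add.commute)
    finally show ?case .
  qed
qed (use assms in \<open>auto simp: power_order_def\<close>)

lemma power_order_mult:
  assumes "power_order e f" "power_order e' g"
  shows "power_order (e + e') (\<lambda>K. f K * g K)"
  unfolding power_order_def
proof (intro conjI allI impI)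
  fix z :: real assume z: "0 < z"
  have "\<forall>\<^sub>F K in at_top. f K \<le> real K powr (e + z / 2)" "\<forall>\<^sub>F K in at_top. g K \<le> real K powr (e' + z / 2)"
    using assms z unfolding power_order_def by (auto dest: spec[of _ "z / 2"])
  then show "\<forall>\<^sub>F K in at_top. f K * g K \<le> real K powr (e + e' + z)"
  proof eventually_elim
    case (elim K)
    have "f K * g K \<le> real K powr (e + z / 2) * real K powr (e' + z / 2)"
      using elim assms by (intro mult_mono) (auto simp: power_order_def)
    also have "\<dots> = real K powr (e + e' + z)" by (simp add: powr_add[symmetric] algebra_simps)
    finally show ?case .
  qed
qed (use assms in \<open>auto simp: power_order_def\<close>)

lemma power_order_const: "0 \<le> c \<Longrightarrow> power_order 0 (\<lambda>_. c)"
  unfolding power_order_def by (intro conjI allI impI; real_asymp?) auto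

lemma power_order_sum:
  assumes "finite J" "\<And>j. j \<in> J \<Longrightarrow> power_order e (f j)" "0 \<le> e"
  shows "power_order e (\<lambda>K. \<Sum>j\<in>J. f j K)"
  using assms(1,2)
proof (induction J rule: finite_induct)
  case empty
  then show ?case using power_order_mono[OF power_order_const[of 0] assms(3)] by simp
next
  case (insert j J)
  then show ?case using power_order_add[of e "f j"] by simp
qed

lemma power_order_num_copies:
  assumes "1 \<le> d" "0 < eta" "0 < delta"
  shows "power_order 0 (\<lambda>K. real (num_copies d K eta delta))"
  unfolding power_order_def
proof (intro conjI allI impI)
  fix z :: real assume z: "0 < z"
  define c where "c = real d / (par_eps d eta * par_delta d eta delta)"
  have c: "0 < c" using assms by (simp add: c_def par_eps_def par_delta_def)
  have "\<forall>\<^sub>F K :: nat in at_top. real d * (ln (real K) + \<bar>ln c\<bar>) + 1 \<le> real K powr z"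
    using z by real_asymp
  then show "\<forall>\<^sub>F K in at_top. real (num_copies d K eta delta) \<le> real K powr (0 + z)"
    using eventually_ge_at_top[of 1]
  proof eventually_elim
    case (elim K)
    have "real (num_copies d K eta delta) \<le> max 0 (real d * ln (real K * c) + 1)"
      unfolding num_copies_def copies_def c_def times_divide_eq_right by linarith
    also have "ln (real K * c) \<le> ln (real K) + \<bar>ln c\<bar>"
      using elim(2) c by (simp add: ln_mult)
    then have "max 0 (real d * ln (real K * c) + 1) \<le> real d * (ln (real K) + \<bar>ln c\<bar>) + 1"
      using elim(2) mult_left_mono[of "ln (real K * c)" "ln (real K) + \<bar>ln c\<bar>" "real d"] by simp
    finally show ?case using elim(1) by simp
  qed
qed simp

lemma num_copies_pos:
  assumes "1 \<le> d" "0 < eta" "eta \<le> 1" "0 < delta" "delta < 1" "1 \<le> K"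
  shows "1 \<le> num_copies d K eta delta"
proof -
  have "eta\<^sup>2 * delta \<le> 1 * 1" using assms by (intro mult_mono power_le_one) auto
  moreover have "1 \<le> real d ^ 3" using assms by simp
  moreover have "0 < eta\<^sup>2 * delta" using assms by simp
  ultimately have "1 < 2 * real d ^ 3 / (eta\<^sup>2 * delta)" by (simp add: less_divide_eq)
  also note copies_arg_gt[OF assms]
  finally have "0 < real d * ln (real K * real d / (par_eps d eta * par_delta d eta delta))" using assms by simp
  then show ?thesis unfolding num_copies_def copies_def by linarith
qed

section \<open>The query exponent and the cost of a step\<close>

lemma rho_q_eq:
  assumes "0 < c" "c < 1" "0 < r" "r < 3"
  shows "1 - rho_q c r = (r * (1 - c) / (6 - r * (1 + c)))\<^sup>2"
proof -
  have cr: "c * r < r" using assms by simp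
  define u where "u = (3 - c * r) / (3 - r)"
  have u: "0 < u" unfolding u_def using assms cr by (intro divide_pos_pos) linarith+
  have "rho_q c r = 4 * u / (1 + u)\<^sup>2" using u by (simp add: rho_q_def Let_def u_def)
  also have "1 - \<dots> = ((u - 1) / (u + 1))\<^sup>2"
  proof -
    have "(1 + u)\<^sup>2 \<noteq> 0" using u by simp
    then have "1 - 4 * u / (1 + u)\<^sup>2 = ((1 + u)\<^sup>2 - 4 * u) / (1 + u)\<^sup>2" by (simp add: diff_divide_distrib)
    also have "(1 + u)\<^sup>2 - 4 * u = (u - 1)\<^sup>2" by (simp add: power2_eq_square algebra_simps)
    finally show ?thesis by (simp add: power_divide add.commute)
  qed
  also have "(u - 1) / (u + 1) = r * (1 - c) / (6 - r * (1 + c))"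
  proof -
    have "u - 1 = r * (1 - c) / (3 - r)" "u + 1 = (6 - r * (1 + c)) / (3 - r)"
      using assms by (auto simp: u_def field_simps)
    then show ?thesis using assms by simp
  qed
  finally show ?thesis .
qed

text \<open>The product \<open>r * (1 - c)\<close> equals \<open>(eta / d) * (i / (i + 1))\<close>,
  so the index nearly cancels and all solvers have comparable exponents. The numerator lies between
  half of \<open>eta / d\<close> and \<open>eta / d\<close>, the denominator between 2 and 6;
  squaring the resulting factors 1/12 and 1/2 gives the constants.\<close>

lemma rho_q_bounds:
  assumes "1 \<le> d" "0 < eta" "eta \<le> 1" "i \<in> {1..num_solvers d eta}"
  shows "eta\<^sup>2 / (144 * (real d)\<^sup>2) \<le> 1 - rho_q (par_c i) (par_r d eta i)"
    "1 - rho_q (par_c i) (par_r d eta i) \<le> eta\<^sup>2 / (4 * (real d)\<^sup>2)"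
proof -
  let ?c = "par_c i" and ?r = "par_r d eta i" and ?e = "eta / real d"
  have e: "0 < ?e" "?e \<le> 1" using assms by (auto simp: divide_le_eq)
  note c = solver_par_range(1,2)[OF assms] and r = solver_par_range(3,4)[OF assms]
  have num: "?r * (1 - ?c) = ?e * (real i / (real i + 1))" by (simp add: par_r_def par_c_def)
  have i: "1 / 2 \<le> real i / (real i + 1)" "real i / (real i + 1) \<le> 1" using assms(4) by (auto simp: field_simps)
  have den: "2 \<le> 6 - ?r * (1 + ?c)" "6 - ?r * (1 + ?c) \<le> 6"
    using mult_mono[of ?r 2 "1 + ?c" 2] r c by (auto simp: mult_nonneg_nonneg)
  have "?e / 2 / 6 \<le> ?r * (1 - ?c) / (6 - ?r * (1 + ?c))"
    unfolding num using e i den mult_left_mono[OF i(1), of ?e] by (intro frac_le) auto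
  then have "(?e / 2 / 6)\<^sup>2 \<le> 1 - rho_q ?c ?r"
    unfolding rho_q_eq[OF c r(1) order_le_less_trans[OF r(2), of 3, simplified]] using e by (intro power_mono) auto
  then show "eta\<^sup>2 / (144 * (real d)\<^sup>2) \<le> 1 - rho_q ?c ?r" by (simp add: power_divide power2_eq_square)
  have "?r * (1 - ?c) / (6 - ?r * (1 + ?c)) \<le> ?e / 2"
    unfolding num using e i den mult_left_mono[OF i(2), of ?e] by (intro frac_le) auto
  then have "1 - rho_q ?c ?r \<le> (?e / 2)\<^sup>2"
    unfolding rho_q_eq[OF c r(1) order_le_less_trans[OF r(2), of 3, simplified]] using r c den by (intro power_mono) auto
  then show "1 - rho_q ?c ?r \<le> eta\<^sup>2 / (4 * (real d)\<^sup>2)" by (simp add: power_divide power2_eq_square)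
qed

text \<open>The specification fixes the exponent of the query time up to a vanishing term in both
  directions, and so yields a lower bound as well.\<close>

lemma query_time_order:
  assumes "mips_solver_spec S" "1 \<le> d" "0 < c" "c < 1" "0 < r" "r < 3"
  shows "power_order (rho_q c r) (query_time S d c r)"
    "e < rho_q c r \<Longrightarrow> \<forall>\<^sub>F K in at_top. real K powr e \<le> query_time S d c r K"
proof -
  obtain g where g: "g \<in> o[at_top](\<lambda>K. ln (real K) powr (- 0.45))"
    and q: "\<forall>\<^sub>F K in at_top. query_time S d c r K = real K powr (rho_q c r + g K)"
    using assms unfolding mips_solver_spec_def by blast
  have "(\<lambda>K::nat. ln (real K) powr (- 0.45)) \<in> O(\<lambda>_. 1)" by real_asymp
  from landau_o.small_big_trans[OF g this] have lim: "g \<longlonglongrightarrow> 0" by (auto dest: smalloD_tendsto)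
  have "\<forall>\<^sub>F K in at_top. query_time S d c r K \<le> real K powr (rho_q c r + g K)"
    using q by (rule eventually_mono) simp
  moreover have "0 \<le> query_time S d c r K" for K using assms unfolding mips_solver_spec_def by blast
  ultimately show "power_order (rho_q c r) (query_time S d c r)" using lim by (intro power_orderI)
  assume "e < rho_q c r"
  then have "\<forall>\<^sub>F K in at_top. e - rho_q c r < g K" using order_tendstoD(1)[OF lim] by simp
  then show "\<forall>\<^sub>F K in at_top. real K powr e \<le> query_time S d c r K"
    using q eventually_ge_at_top[of 1]
    by eventually_elim (auto intro!: powr_mono)
qed

text \<open>\<open>U\<close> dominates the cost of every step and does not mention the arm sets,
  features, seeds or query, so one threshold \<open>K0\<close> serves all instances.\<close>

lemma step_time_bounds:
  assumes spec: "mips_solver_spec S" and par: "1 \<le> d" "0 < eta" "eta \<le> 1" "0 < delta" "delta < 1"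
    and rest: "\<And>t. bounded_by_power 0 (\<lambda>K. rest K t)"
  shows "\<exists>K0. \<forall>K\<ge>K0. \<forall>A x s q. \<forall>t\<in>{1..T}. card (A t - A (t - 1)) + card (A (t - 1) - A t) \<le> C \<longrightarrow>
    real K powr (1 - eta\<^sup>2 / (2 * (real d)\<^sup>2)) \<le> step_time S (rest K) d K eta delta A x s t q \<and>
    step_time S (rest K) d K eta delta A x s t q \<le> real K powr (1 - eta\<^sup>2 / (288 * (real d)\<^sup>2))"
proof -
  define n where "n = num_solvers d eta"
  define h where "h = eta\<^sup>2 / (real d)\<^sup>2"
  have h: "0 < h" "h \<le> 1" using par by (auto simp: h_def divide_le_eq intro!: power_mono order_trans[of "eta\<^sup>2" 1] power_le_one)
  let ?c = par_c and ?r = "par_r d eta"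
  let ?k = "\<lambda>K. real (num_copies d K eta delta)"
  have n: "1 \<le> n" unfolding n_def by (rule num_solvers_bounds(1)[OF par(1,2)])
  have rng: "0 < ?c i" "?c i < 1" "0 < ?r i" "?r i < 3" if "i \<in> {1..n}" for i
    using solver_par_range[OF par(1-3), of i] that unfolding n_def by auto
  \<comment> \<open>The lower bound is weakened from \<open>1 - h / 4\<close> to a strict one by
    \<open>1 - h / 2\<close>, which leaves room for the vanishing term in the exponent.\<close>
  have rho: "rho_q (?c i) (?r i) \<le> 1 - h / 144" "1 - h / 2 < rho_q (?c i) (?r i)" if "i \<in> {1..n}" for i
    using rho_q_bounds[OF par(1-3), of i] that h by (auto simp: n_def h_def)
  let ?q = "\<lambda>i. query_time S d (?c i) (?r i)"
  let ?a = "\<lambda>i. add_time S d (?c i) (?r i)" and ?d = "\<lambda>i. del_time S d (?c i) (?r i)"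
  define U where "U K = (\<Sum>i = 1..n. ?k K * (real C * (?a i K + ?d i K))) + (\<Sum>i = 1..n. ?k K * ?q i K)
    + (\<Sum>t = 1..T. rest K t)" for K
  have ad: "power_order 0 (?a i)" "power_order 0 (?d i)" if "i \<in> {1..n}" for i
    using spec rng[OF that] par(1) unfolding mips_solver_spec_def by (blast intro: bounded_by_power_order)+
  note k = power_order_num_copies[OF par(1,2,4)]
  have "power_order (1 - h / 144) U"
    unfolding U_def
  proof (intro power_order_add power_order_sum)
    fix i assume i: "i \<in> {1..n}"
    have "power_order (0 + (0 + 0)) (\<lambda>K. ?k K * (real C * (?a i K + ?d i K)))"
      by (intro power_order_mult k power_order_add power_order_const ad i) simp
    then show "power_order (1 - h / 144) (\<lambda>K. ?k K * (real C * (?a i K + ?d i K)))"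
      by (rule power_order_mono) (use h in simp)
    have "power_order (0 + rho_q (?c i) (?r i)) (\<lambda>K. ?k K * ?q i K)"
      by (intro power_order_mult k query_time_order spec par rng i)
    then show "power_order (1 - h / 144) (\<lambda>K. ?k K * ?q i K)"
      by (rule power_order_mono) (use rho i in simp)
  next
    fix t
    show "power_order (1 - h / 144) (\<lambda>K. rest K t)"
      by (rule power_order_mono[OF bounded_by_power_order[OF rest]]) (use h in simp)
  qed (use h in auto)
  \<comment> \<open>Half of the margin \<open>h / 144\<close> is spent on the vanishing
    terms.\<close>
  then have "\<forall>\<^sub>F K in at_top. U K \<le> real K powr (1 - h / 144 + h / 288)"
    using h unfolding power_order_def by (metis divide_pos_pos zero_less_numeral)
  moreover have "\<forall>\<^sub>F K in at_top. \<forall>i\<in>{1..n}. real K powr (1 - h / 2) \<le> ?q i K"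
    by (intro eventually_ball_finite ballI query_time_order(2) spec par rng rho) auto
  ultimately have "\<forall>\<^sub>F K in at_top. 1 \<le> K \<and> U K \<le> real K powr (1 - h / 144 + h / 288) \<and>
      (\<forall>i\<in>{1..n}. real K powr (1 - h / 2) \<le> ?q i K)"
    using eventually_ge_at_top[of 1] by eventually_elim simp
  then obtain K0 where K0: "\<And>K. K0 \<le> K \<Longrightarrow> 1 \<le> K \<and> U K \<le> real K powr (1 - h / 144 + h / 288) \<and>
      (\<forall>i\<in>{1..n}. real K powr (1 - h / 2) \<le> ?q i K)"
    unfolding eventually_at_top_linorder by blast
  show ?thesis
  proof (intro exI[of _ K0] allI impI ballI)
    fix K :: nat and A :: "nat \<Rightarrow> nat set" and x s q t
    assume K: "K0 \<le> K" and t: "t \<in> {1..T}" and C: "card (A t - A (t - 1)) + card (A (t - 1) - A t) \<le> C"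
    define P where "P = bsearch_probes (\<lambda>i. ts_answer S d K eta delta A x s t q i \<noteq> None) 0 (Suc n)"
    define upd where "upd = (\<Sum>i = 1..n. ?k K * (real (card (A t - A (t - 1))) * ?a i K + real (card (A (t - 1) - A t)) * ?d i K))"
    have st: "step_time S (rest K) d K eta delta A x s t q = upd + (\<Sum>i\<in>P. ?k K * ?q i K) + rest K t"
      by (simp add: step_time_def Let_def upd_def P_def n_def)
    have P: "P \<subseteq> {1..n}" using bsearch_probes_subset[of _ 0 "Suc n"] unfolding P_def by fastforce
    have "P \<noteq> {}" unfolding P_def by (rule bsearch_probes_nonempty) (use n in simp)
    then obtain i where i: "i \<in> P" by blast
    have finP: "finite P" using P finite_subset by blast
    have nn: "0 \<le> ?a i K" "0 \<le> ?d i K" "0 \<le> ?q i K" if "i \<in> {1..n}" for i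
      using ad[OF that] query_time_order(1)[OF spec par(1) rng[OF that]] by (auto simp: power_order_def)
    have r: "0 \<le> rest K t" for t using rest by (auto simp: bounded_by_power_def)
    have k1: "1 \<le> ?k K" using num_copies_pos[OF par] K0[OF K] by simp
    have upd0: "0 \<le> upd" unfolding upd_def using nn k1 by (intro sum_nonneg mult_nonneg_nonneg add_nonneg_nonneg) auto
    have "real K powr (1 - h / 2) \<le> 1 * ?q i K" using K0[OF K] i P by auto
    also have "\<dots> \<le> ?k K * ?q i K" using k1 nn i P by (intro mult_right_mono) auto
    also have "\<dots> \<le> (\<Sum>i\<in>P. ?k K * ?q i K)"
      using P nn by (intro member_le_sum i finP mult_nonneg_nonneg) auto
    finally have lower: "real K powr (1 - h / 2) \<le> upd + (\<Sum>i\<in>P. ?k K * ?q i K) + rest K t" using upd0 r[of t] by linarith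
    have "upd \<le> (\<Sum>i = 1..n. ?k K * (real C * (?a i K + ?d i K)))"
      unfolding upd_def ring_distribs
      using C nn by (intro sum_mono add_mono mult_left_mono mult_right_mono) auto
    moreover have "(\<Sum>i\<in>P. ?k K * ?q i K) \<le> (\<Sum>i = 1..n. ?k K * ?q i K)"
      using P nn by (intro sum_mono2 mult_nonneg_nonneg) auto
    moreover have "rest K t \<le> (\<Sum>t = 1..T. rest K t)" using t r by (intro member_le_sum) auto
    ultimately have "upd + (\<Sum>i\<in>P. ?k K * ?q i K) + rest K t \<le> U K" by (simp add: U_def)
    also have "\<dots> \<le> real K powr (1 - h / 144 + h / 288)" using K0[OF K] by simp
    finally show "real K powr (1 - eta\<^sup>2 / (2 * (real d)\<^sup>2)) \<le> step_time S (rest K) d K eta delta A x s t q \<and>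
        step_time S (rest K) d K eta delta A x s t q \<le> real K powr (1 - eta\<^sup>2 / (288 * (real d)\<^sup>2))"
      using lower unfolding st by (simp add: h_def mult.commute)
  qed
qed

lemma exponent_between:
  fixes k :: real
  assumes "1 < k" "k powr (1 - u) \<le> y" "y \<le> k powr (1 - l)"
  shows "\<exists>e. l \<le> e \<and> e \<le> u \<and> y = k powr (1 - e)"
proof (intro exI conjI)
  have y: "0 < y" using assms(1,2) by (intro less_le_trans[OF _ assms(2)]) simp
  show "l \<le> 1 - log k y" using assms y log_le_iff[of k y "1 - l"] by simp
  show "1 - log k y \<le> u" using assms y le_log_iff[of k y "1 - u"] by simp
  show "y = k powr (1 - (1 - log k y))" using assms(1) y by simp
qed

lemma step_time_exponent:
  assumes spec: "mips_solver_spec S" and par: "1 \<le> d" "1 \<le> T" "0 < delta" "delta < 1"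
    and rest: "\<And>t. bounded_by_power 0 (\<lambda>K. rest K t)"
  shows "\<exists>K0. \<forall>K\<ge>K0. \<forall>A x s q. \<forall>t\<in>{1..T}. card (A t - A (t - 1)) + card (A (t - 1) - A t) \<le> C \<longrightarrow>
    (\<exists>e. 1 / (288 * (real d)\<^sup>2) / real T \<le> e \<and> e \<le> 1 / (2 * (real d)\<^sup>2) / real T \<and>
      step_time S (rest K) d K (1 / sqrt (real T)) delta A x s t q = real K powr (1 - e))"
proof -
  let ?eta = "1 / sqrt (real T)"
  have eta: "0 < ?eta" "?eta \<le> 1" "?eta\<^sup>2 = 1 / real T" using par by (auto simp: power_divide)
  have ex: "?eta\<^sup>2 / (2 * (real d)\<^sup>2) = 1 / (2 * (real d)\<^sup>2) / real T"
    "?eta\<^sup>2 / (288 * (real d)\<^sup>2) = 1 / (288 * (real d)\<^sup>2) / real T"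
    unfolding eta(3) by (simp_all add: mult_ac)
  obtain K0 where K0: "\<forall>K\<ge>K0. \<forall>A x s q. \<forall>t\<in>{1..T}.
      card (A t - A (t - 1)) + card (A (t - 1) - A t) \<le> C \<longrightarrow>
      real K powr (1 - ?eta\<^sup>2 / (2 * (real d)\<^sup>2)) \<le> step_time S (rest K) d K ?eta delta A x s t q \<and>
      step_time S (rest K) d K ?eta delta A x s t q \<le> real K powr (1 - ?eta\<^sup>2 / (288 * (real d)\<^sup>2))"
    using step_time_bounds[OF spec par(1) eta(1,2) par(3,4) rest, of T C] ..
  show ?thesis
  \<comment> \<open>The exponent is read off by a logarithm, which calls for a base above 1.\<close>
  proof (intro exI[of _ "max 2 K0"] allI impI ballI)
    fix K :: nat and A :: "nat \<Rightarrow> nat set" and x s q t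
    assume K: "max 2 K0 \<le> K" and t: "t \<in> {1..T}"
      and C: "card (A t - A (t - 1)) + card (A (t - 1) - A t) \<le> C"
    have K2: "1 < real K" "K0 \<le> K" using K by auto
    have "real K powr (1 - ?eta\<^sup>2 / (2 * (real d)\<^sup>2)) \<le> step_time S (rest K) d K ?eta delta A x s t q \<and>
        step_time S (rest K) d K ?eta delta A x s t q \<le> real K powr (1 - ?eta\<^sup>2 / (288 * (real d)\<^sup>2))"
      using K0[rule_format, OF K2(2) t C] .
    then show "\<exists>e. 1 / (288 * (real d)\<^sup>2) / real T \<le> e \<and> e \<le> 1 / (2 * (real d)\<^sup>2) / real T \<and>
        step_time S (rest K) d K ?eta delta A x s t q = real K powr (1 - e)"
      unfolding ex by (elim conjE) (rule exponent_between[OF K2(1)])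
  qed
qed

lemma run_facts:
  assumes "mips_solver_spec S" "0 < p" "0 < b" "0 < b'"
    and run: "sublinear_ts_run M S p b b' C_change d T K delta (1 / sqrt (real T)) A x theta dflt D s \<xi> a r noise"
  shows "1 - delta \<le> measure M {\<omega> \<in> space M. regret T A x theta (\<lambda>t. a t \<omega>)
      \<le> 4 * (1 + sqrt (b * (1 + \<bar>ln (16 * b' / p)\<bar>))) * (10 + 112 / p) * real d powr (3 / 2) * sqrt (real T) *
        (1 + ln (real d * real T / delta)) ^ 3}"
    and "t \<in> {1..T} \<Longrightarrow> card (A t - A (t - 1)) + card (A (t - 1) - A t) \<le> C_change"
proof -
  interpret ts_run M S p b b' C_change d T K delta "1 / sqrt (real T)" A x theta dflt D s \<xi> a r noise
    "{1..num_solvers d (1 / sqrt (real T))} \<times> {..<num_copies d K (1 / sqrt (real T)) delta}"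
    "\<lambda>ij. seed S d (par_c (fst ij)) (par_r d (1 / sqrt (real T)) (fst ij)) K"
    by (intro ts_run.intro ts_run_axioms.intro run assms(1) reflexive)
  show "1 - delta \<le> measure M {\<omega> \<in> space M. regret T A x theta (\<lambda>t. a t \<omega>)
      \<le> 4 * (1 + sqrt (b * (1 + \<bar>ln (16 * b' / p)\<bar>))) * (10 + 112 / p) * real d powr (3 / 2) * sqrt (real T) *
        (1 + ln (real d * real T / delta)) ^ 3}"
    using regret_prob[OF assms(2-4) refl] unfolding regret_const_def[OF assms(2,3)] .
  show "t \<in> {1..T} \<Longrightarrow> card (A t - A (t - 1)) + card (A (t - 1) - A t) \<le> C_change" by (rule change)
qed

theorem corollary6p2:
  fixes S :: "'s mips_solver" and p b b' :: real and C_change :: nat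
  assumes "mips_solver_spec S" and "0 < p" and "0 < b" and "0 < b'"
  shows "\<exists>C > 0. \<exists>m::nat. \<forall>d \<ge> 1. \<exists>c1 > 0. \<exists>c2 > 0. \<forall>T \<ge> 1. \<forall>delta. 0 < delta \<and> delta < 1 \<longrightarrow>
    (\<forall>rest :: nat \<Rightarrow> nat \<Rightarrow> real. (\<forall>t. bounded_by_power 0 (\<lambda>K. rest K t)) \<longrightarrow>
      (\<exists>K0. \<forall>K (M :: 'w measure) A x theta dflt D s \<xi> a r noise.
        sublinear_ts_run M S p b b' C_change d T K delta (1 / sqrt (real T))
            A x theta dflt D s \<xi> a r noise \<longrightarrow>
          measure M {\<omega> \<in> space M. regret T A x theta (\<lambda>t. a t \<omega>)
              \<le> C * real d powr (3 / 2) * sqrt (real T) * (1 + ln (real d * real T / delta)) ^ m}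
            \<ge> 1 - delta \<and>
          (K \<ge> K0 \<longrightarrow> (\<forall>t \<in> {1..T}. \<forall>\<omega> \<in> space M. \<exists>e. c1 / real T \<le> e \<and> e \<le> c2 / real T \<and>
             step_time S (rest K) d K (1 / sqrt (real T)) delta A x (\<lambda>i j. s i j \<omega>) t
                 (ts_query d T delta x (\<lambda>k. a k \<omega>) (\<lambda>k. r k \<omega>) t (\<xi> t \<omega>))
               = real K powr (1 - e)))))"
proof -
  let ?C = "4 * (1 + sqrt (b * (1 + \<bar>ln (16 * b' / p)\<bar>))) * (10 + 112 / p)"
  have C: "0 < ?C" using assms by (intro mult_pos_pos add_pos_nonneg) auto
  show ?thesis
  \<comment> \<open>The order of the witnesses matters: the regret constant and the power of the
    logarithm are chosen before \<open>d\<close>, the two constants of the exponent, of order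
    \<open>1 / d\<^sup>2\<close>, after it.\<close>
  proof (rule exI[of _ ?C], rule conjI[OF C], rule exI[of _ 3], intro allI impI)
    fix d :: nat assume d: "1 \<le> d"
    let ?c1 = "1 / (288 * (real d)\<^sup>2)" and ?c2 = "1 / (2 * (real d)\<^sup>2)"
    have c: "0 < ?c1" "0 < ?c2" using d by auto
    show "\<exists>c1 > 0. \<exists>c2 > 0. \<forall>T \<ge> 1. \<forall>delta. 0 < delta \<and> delta < 1 \<longrightarrow>
    (\<forall>rest :: nat \<Rightarrow> nat \<Rightarrow> real. (\<forall>t. bounded_by_power 0 (\<lambda>K. rest K t)) \<longrightarrow>
      (\<exists>K0. \<forall>K (M :: 'w measure) A x theta dflt D s \<xi> a r noise.
        sublinear_ts_run M S p b b' C_change d T K delta (1 / sqrt (real T))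
            A x theta dflt D s \<xi> a r noise \<longrightarrow>
          measure M {\<omega> \<in> space M. regret T A x theta (\<lambda>t. a t \<omega>)
              \<le> ?C * real d powr (3 / 2) * sqrt (real T) * (1 + ln (real d * real T / delta)) ^ 3}
            \<ge> 1 - delta \<and>
          (K \<ge> K0 \<longrightarrow> (\<forall>t \<in> {1..T}. \<forall>\<omega> \<in> space M. \<exists>e. c1 / real T \<le> e \<and> e \<le> c2 / real T \<and>
             step_time S (rest K) d K (1 / sqrt (real T)) delta A x (\<lambda>i j. s i j \<omega>) t
                 (ts_query d T delta x (\<lambda>k. a k \<omega>) (\<lambda>k. r k \<omega>) t (\<xi> t \<omega>))
               = real K powr (1 - e)))))"
    proof (rule exI[of _ ?c1], rule conjI[OF c(1)], rule exI[of _ ?c2], rule conjI[OF c(2)], intro allI impI, elim conjE)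
      fix T :: nat and delta :: real and rest :: "nat \<Rightarrow> nat \<Rightarrow> real"
      assume T: "1 \<le> T" and delta: "0 < delta" "delta < 1" and rest: "\<forall>t. bounded_by_power 0 (\<lambda>K. rest K t)"
      obtain K0 where K0: "\<forall>K\<ge>K0. \<forall>A x s q. \<forall>t\<in>{1..T}. card (A t - A (t - 1)) + card (A (t - 1) - A t) \<le> C_change \<longrightarrow>
          (\<exists>e. ?c1 / real T \<le> e \<and> e \<le> ?c2 / real T \<and>
            step_time S (rest K) d K (1 / sqrt (real T)) delta A x s t q = real K powr (1 - e))"
        using step_time_exponent[OF assms(1) d T delta rest[rule_format], of C_change] ..
      show "\<exists>K0. \<forall>K (M :: 'w measure) A x theta dflt D s \<xi> a r noise.
        sublinear_ts_run M S p b b' C_change d T K delta (1 / sqrt (real T)) A x theta dflt D s \<xi> a r noise \<longrightarrow>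
          measure M {\<omega> \<in> space M. regret T A x theta (\<lambda>t. a t \<omega>)
              \<le> ?C * real d powr (3 / 2) * sqrt (real T) * (1 + ln (real d * real T / delta)) ^ 3}
            \<ge> 1 - delta \<and>
          (K \<ge> K0 \<longrightarrow> (\<forall>t \<in> {1..T}. \<forall>\<omega> \<in> space M. \<exists>e. ?c1 / real T \<le> e \<and> e \<le> ?c2 / real T \<and>
             step_time S (rest K) d K (1 / sqrt (real T)) delta A x (\<lambda>i j. s i j \<omega>) t
                 (ts_query d T delta x (\<lambda>k. a k \<omega>) (\<lambda>k. r k \<omega>) t (\<xi> t \<omega>))
               = real K powr (1 - e)))"
      proof (rule exI[of _ K0], intro allI impI, rule conjI)
        fix K and M :: "'w measure" and A x theta dflt D s \<xi> a r noise
        assume run: "sublinear_ts_run M S p b b' C_change d T K delta (1 / sqrt (real T)) A x theta dflt D s \<xi> a r noise"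
        note run = run_facts[OF assms run]
        show "1 - delta \<le> measure M {\<omega> \<in> space M. regret T A x theta (\<lambda>t. a t \<omega>)
              \<le> ?C * real d powr (3 / 2) * sqrt (real T) * (1 + ln (real d * real T / delta)) ^ 3}"
          by (rule run(1))
        show "K \<ge> K0 \<longrightarrow> (\<forall>t \<in> {1..T}. \<forall>\<omega> \<in> space M. \<exists>e. ?c1 / real T \<le> e \<and> e \<le> ?c2 / real T \<and>
             step_time S (rest K) d K (1 / sqrt (real T)) delta A x (\<lambda>i j. s i j \<omega>) t
                 (ts_query d T delta x (\<lambda>k. a k \<omega>) (\<lambda>k. r k \<omega>) t (\<xi> t \<omega>))
               = real K powr (1 - e))"
          by (intro impI ballI K0[rule_format] run(2))
      qed
    qed
  qed
qed

end
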